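(* Let $\Bbbk$ be a field of characteristic zero, and let $\Delta$ be a simplicial complex whose connected components are $\Delta_1,\dots,\Delta_n$. Assume that each $\Delta_i$ is pure. Then the following conditions are equivalent: (1) the Stanley--Reisner ring $\Bbbk[\Delta]$ is nearly regular; (2) each $\Delta_i$ is a simplex, and $\dim\Delta_i=\dim\Delta$ for all $1\le i\le n$. In particular, if $\Bbbk[\Delta]$ is nearly regular, then $\operatorname{tr}_{\Bbbk[\Delta]}(\omega_{\Bbbk[\Delta]})\supseteq\mathfrak m_{\Bbbk[\Delta]}$.
   Context: A simplicial complex on a finite vertex set $V=\{1,\dots,N\}$ is a nonempty family $\Delta\subseteq2^V$ closed under taking subsets and containing $\{v\}$ for every $v\in V$. Its Stanley--Reisner ring is $\Bbbk[\Delta]=\Bbbk[x_1,\dots,x_N]/I_\Delta$, where $I_\Delta$ is generated by the squarefree monomials $x_{i_1}\cdots x_{i_p}$ with $\{i_1,\dots,i_p\}\notin\Delta$; it is standard graded, with graded maximal ideal $\mathfrak m_{\Bbbk[\Delta]}=(x_1,\dots,x_N)$. Pure means that all facets (maximal faces) have the same dimension; a simplex is a complex with a single facet. For a ring $S$ and an $S$-module $M$, $\operatorname{tr}_S(M)=\sum_{f\in\operatorname{Hom}_S(M,S)}f(M)$. A Noetherian $\mathbb{Z}_{\ge0}$-graded ring $S$ with $S_0=\Bbbk$ is nearly regular if $\operatorname{tr}_S(\Omega^{\dim S}_{S/\Bbbk})\supseteq\mathfrak m_S:=\bigoplus_{i>0}S_i$, where $\Omega^i_{S/\Bbbk}=\bigwedge^i_S\Omega^1_{S/\Bbbk}$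 (Kähler differentials). $\omega_S$ denotes the (graded) canonical module of $S$: for $S=P/I$ with $P$ a polynomial ring over $\Bbbk$, $\omega_S=\operatorname{Ext}^{\dim P-\dim S}_P(S,P)$ up to a degree shift. *)

theory Defs
  imports "HOL-Algebra.QuotRing" "HOL-Algebra.Module"
    "HOL-Library.Poly_Mapping" "HOL-Library.Extended_Nat"
begin

section \<open>Module constructions over a commutative ring\<close>

text \<open>The multiplicative fields of the module record play no role, except in
  \<open>regular_module\<close>; they are set to \<^term>\<open>undefined\<close>.\<close>

definition regular_module :: "('a, 'r) ring_scheme \<Rightarrow> ('a, 'a) module" where
  "regular_module R = \<lparr>carrier = carrier R, mult = mult R, one = one R,
     zero = zero R, add = add R, smult = mult R\<rparr>"

text \<open>Functions \<open>B \<rightarrow> R\<close> of finite support, extended by zero outside \<open>B\<close>.\<close>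

definition free_module :: "('a, 'r) ring_scheme \<Rightarrow> 'b set \<Rightarrow> ('a, 'b \<Rightarrow> 'a) module" where
  "free_module R B = \<lparr>carrier = {f. range f \<subseteq> carrier R \<and>
        finite {b. f b \<noteq> \<zero>\<^bsub>R\<^esub>} \<and> {b. f b \<noteq> \<zero>\<^bsub>R\<^esub>} \<subseteq> B},
     mult = undefined, one = undefined, zero = (\<lambda>_. \<zero>\<^bsub>R\<^esub>),
     add = (\<lambda>f g b. f b \<oplus>\<^bsub>R\<^esub> g b), smult = (\<lambda>r f b. r \<otimes>\<^bsub>R\<^esub> f b)\<rparr>"

definition unit_vec :: "('a, 'r) ring_scheme \<Rightarrow> 'b \<Rightarrow> 'b \<Rightarrow> 'a" where
  "unit_vec R b = (\<lambda>c. if c = b then \<one>\<^bsub>R\<^esub> else \<zero>\<^bsub>R\<^esub>)"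

definition submodule_gen ::
    "('a, 'r) ring_scheme \<Rightarrow> ('a, 'b, 'm) module_scheme \<Rightarrow> 'b set \<Rightarrow> 'b set" where
  "submodule_gen R M X = \<Inter> {N. submodule N R M \<and> X \<subseteq> N}"

text \<open>The scalar multiplication mirrors \<^const>\<open>rcoset_mult\<close>: for a submodule \<open>N\<close>
  all members of the union coincide.\<close>

definition quotient_module ::
    "('a, 'b, 'm) module_scheme \<Rightarrow> 'b set \<Rightarrow> ('a, 'b set) module" where
  "quotient_module M N = \<lparr>carrier = a_rcosets\<^bsub>M\<^esub> N, mult = undefined, one = undefined,
     zero = N, add = set_add M, smult = (\<lambda>r X. \<Union>x\<in>X. N +>\<^bsub>M\<^esub> (r \<odot>\<^bsub>M\<^esub> x))\<rparr>"

definition module_hom :: "('a, 'r) ring_scheme \<Rightarrow> ('a, 'b, 'm) module_scheme \<Rightarrow>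
    ('a, 'c, 'n) module_scheme \<Rightarrow> ('b \<Rightarrow> 'c) set" where
  "module_hom R M N = {f \<in> carrier M \<rightarrow>\<^sub>E carrier N.
     (\<forall>x\<in>carrier M. \<forall>y\<in>carrier M. f (x \<oplus>\<^bsub>M\<^esub> y) = f x \<oplus>\<^bsub>N\<^esub> f y) \<and>
     (\<forall>r\<in>carrier R. \<forall>x\<in>carrier M. f (r \<odot>\<^bsub>M\<^esub> x) = r \<odot>\<^bsub>N\<^esub> f x)}"

definition hom_module :: "('a, 'r) ring_scheme \<Rightarrow> ('a, 'b, 'm) module_scheme \<Rightarrow>
    ('a, 'c, 'n) module_scheme \<Rightarrow> ('a, 'b \<Rightarrow> 'c) module" where
  "hom_module R M N = \<lparr>carrier = module_hom R M N, mult = undefined, one = undefined,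
     zero = (\<lambda>x\<in>carrier M. \<zero>\<^bsub>N\<^esub>),
     add = (\<lambda>f g. \<lambda>x\<in>carrier M. f x \<oplus>\<^bsub>N\<^esub> g x),
     smult = (\<lambda>r f. \<lambda>x\<in>carrier M. r \<odot>\<^bsub>N\<^esub> f x)\<rparr>"

definition module_iso :: "('a, 'r) ring_scheme \<Rightarrow> ('a, 'b, 'm) module_scheme \<Rightarrow>
    ('a, 'c, 'n) module_scheme \<Rightarrow> bool" where
  "module_iso R M N \<longleftrightarrow> (\<exists>f\<in>module_hom R M N. bij_betw f (carrier M) (carrier N))"

text \<open>The sum of the submodules \<open>f(M)\<close>, \<open>f \<in> Hom(M, R)\<close>, i.e. the set of all finite sums
  of elements of these submodules.\<close>

definition trace_ideal :: "('a, 'r) ring_scheme \<Rightarrow> ('a, 'b, 'm) module_scheme \<Rightarrow> 'a set" where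
  "trace_ideal R M = {\<Oplus>\<^bsub>R\<^esub>f\<in>A. f (x f) | A x.
     finite A \<and> A \<subseteq> module_hom R M (regular_module R) \<and> x \<in> A \<rightarrow> carrier M}"

text \<open>The \<open>i\<close>-th exterior power: the free module on \<open>i\<close>-tuples of elements of \<open>M\<close> modulo
  multilinearity and alternation.\<close>

definition exterior_relations ::
    "('a, 'r) ring_scheme \<Rightarrow> ('a, 'b, 'm) module_scheme \<Rightarrow> nat \<Rightarrow> ('b list \<Rightarrow> 'a) set" where
  "exterior_relations R M i =
    (let T = {xs. length xs = i \<and> set xs \<subseteq> carrier M}; F = free_module R T; e = unit_vec R in
      {e (xs[j := x \<oplus>\<^bsub>M\<^esub> y]) \<ominus>\<^bsub>F\<^esub> (e (xs[j := x]) \<oplus>\<^bsub>F\<^esub> e (xs[j := y])) | xs j x y.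
         xs \<in> T \<and> j < i \<and> x \<in> carrier M \<and> y \<in> carrier M} \<union>
      {e (xs[j := r \<odot>\<^bsub>M\<^esub> x]) \<ominus>\<^bsub>F\<^esub> (r \<odot>\<^bsub>F\<^esub> e (xs[j := x])) | xs j r x.
         xs \<in> T \<and> j < i \<and> r \<in> carrier R \<and> x \<in> carrier M} \<union>
      {e xs | xs. xs \<in> T \<and> (\<exists>j k. j < k \<and> k < i \<and> xs ! j = xs ! k)})"

definition exterior_power :: "('a, 'r) ring_scheme \<Rightarrow> ('a, 'b, 'm) module_scheme \<Rightarrow> nat \<Rightarrow>
    ('a, ('b list \<Rightarrow> 'a) set) module" where
  "exterior_power R M i =
    (let F = free_module R {xs. length xs = i \<and> set xs \<subseteq> carrier M} in
       quotient_module F (submodule_gen R F (exterior_relations R M i)))"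

text \<open>The Kaehler differentials of \<open>R\<close> over a subring \<open>K\<close>: the free module on symbols \<open>da\<close>
  modulo additivity, the Leibniz rule and \<open>dc = 0\<close> for \<open>c \<in> K\<close>.\<close>

definition kaehler_relations :: "('a, 'r) ring_scheme \<Rightarrow> 'a set \<Rightarrow> ('a \<Rightarrow> 'a) set" where
  "kaehler_relations R K =
    (let F = free_module R (carrier R); d = unit_vec R in
      {d (a \<oplus>\<^bsub>R\<^esub> b) \<ominus>\<^bsub>F\<^esub> (d a \<oplus>\<^bsub>F\<^esub> d b) | a b. a \<in> carrier R \<and> b \<in> carrier R} \<union>
      {d (a \<otimes>\<^bsub>R\<^esub> b) \<ominus>\<^bsub>F\<^esub> (a \<odot>\<^bsub>F\<^esub> d b \<oplus>\<^bsub>F\<^esub> b \<odot>\<^bsub>F\<^esub> d a) | a b. a \<in> carrier R \<and> b \<in> carrier R} \<union>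
      d ` K)"

definition kaehler :: "('a, 'r) ring_scheme \<Rightarrow> 'a set \<Rightarrow> ('a, ('a \<Rightarrow> 'a) set) module" where
  "kaehler R K = (let F = free_module R (carrier R) in
     quotient_module F (submodule_gen R F (kaehler_relations R K)))"

definition krull_dim :: "('a, 'r) ring_scheme \<Rightarrow> enat" where
  "krull_dim R = (SUP n \<in> {n. \<exists>p :: nat \<Rightarrow> 'a set.
     (\<forall>i\<le>n. primeideal (p i) R) \<and> (\<forall>i<n. p i \<subset> p (Suc i))}. enat n)"

section \<open>Graded rings and near regularity\<close>

text \<open>A graded ring is given by \<open>R\<close> together with its homogeneous components \<open>G i\<close>.
  The base field of the differentials is the degree zero component.\<close>

definition irrelevant_ideal :: "('a, 'r) ring_scheme \<Rightarrow> (nat \<Rightarrow> 'a set) \<Rightarrow> 'a set" where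
  "irrelevant_ideal R G =
     {\<Oplus>\<^bsub>R\<^esub>i\<in>A. s i | A s. finite A \<and> (\<forall>i\<in>A. 0 < i \<and> s i \<in> G i)}"

definition nearly_regular :: "('a, 'r) ring_scheme \<Rightarrow> (nat \<Rightarrow> 'a set) \<Rightarrow> bool" where
  "nearly_regular R G \<longleftrightarrow> irrelevant_ideal R G \<subseteq>
     trace_ideal R (exterior_power R (kaehler R (G 0)) (the_enat (krull_dim R)))"

section \<open>Ext and the canonical module\<close>

text \<open>\<open>\<dots> \<rightarrow> R^(B 2) \<rightarrow> R^(B 1) \<rightarrow> R^(B 0) \<rightarrow> M \<rightarrow> 0\<close> is exact, where the last map is \<open>e\<close> and
  \<open>d i\<close> goes from \<open>R^(B (i + 1))\<close> to \<open>R^(B i)\<close>.\<close>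

definition free_resolution :: "('a, 'r) ring_scheme \<Rightarrow> ('a, 'c, 'm) module_scheme \<Rightarrow>
    (nat \<Rightarrow> 'b set) \<Rightarrow> (nat \<Rightarrow> ('b \<Rightarrow> 'a) \<Rightarrow> 'b \<Rightarrow> 'a) \<Rightarrow> (('b \<Rightarrow> 'a) \<Rightarrow> 'c) \<Rightarrow> bool" where
  "free_resolution R M B d e \<longleftrightarrow>
    (let F = (\<lambda>i. free_module R (B i)) in
      e \<in> module_hom R (F 0) M \<and> e ` carrier (F 0) = carrier M \<and>
      (\<forall>i. d i \<in> module_hom R (F (Suc i)) (F i)) \<and>
      d 0 ` carrier (F (Suc 0)) = {x \<in> carrier (F 0). e x = \<zero>\<^bsub>M\<^esub>} \<and>
      (\<forall>i. d (Suc i) ` carrier (F (Suc (Suc i))) =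
             {x \<in> carrier (F (Suc i)). d i x = \<zero>\<^bsub>F i\<^esub>}))"

text \<open>The \<open>c\<close>-th cohomology module of the complex \<open>Hom(R^(B i), N)\<close>. If \<open>(B, d)\<close> is a free
  resolution of \<open>M\<close>, this is \<open>Ext^c(M, N)\<close>.\<close>

definition ext_module :: "('a, 'r) ring_scheme \<Rightarrow> (nat \<Rightarrow> 'b set) \<Rightarrow>
    (nat \<Rightarrow> ('b \<Rightarrow> 'a) \<Rightarrow> 'b \<Rightarrow> 'a) \<Rightarrow> ('a, 'c, 'n) module_scheme \<Rightarrow> nat \<Rightarrow>
    ('a, (('b \<Rightarrow> 'a) \<Rightarrow> 'c) set) module" where
  "ext_module R B d N c =
    (let F = (\<lambda>i. free_module R (B i)); H = hom_module R (F c) N;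
         Z = {f \<in> carrier H. \<forall>x\<in>carrier (F (Suc c)). f (d c x) = \<zero>\<^bsub>N\<^esub>};
         Im = (case c of 0 \<Rightarrow> {\<zero>\<^bsub>H\<^esub>}
               | Suc b \<Rightarrow> (\<lambda>g. compose (carrier (F c)) g (d b)) ` module_hom R (F b) N)
     in quotient_module (H\<lparr>carrier := Z\<rparr>) Im)"

text \<open>For an ideal \<open>I\<close> annihilating the \<open>R\<close>-module \<open>M\<close>, the induced \<open>R/I\<close>-module structure.
  The elements of \<open>M\<close> are cosets, and all members \<open>p \<odot> x\<close> of the union are the same coset.\<close>

definition induced_quotient_action ::
    "('a, 'b set, 'm) module_scheme \<Rightarrow> ('a set, 'b set) module" where
  "induced_quotient_action M = \<lparr>carrier = carrier M, mult = undefined, one = undefined,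
     zero = zero M, add = add M, smult = (\<lambda>X x. \<Union>p\<in>X. p \<odot>\<^bsub>M\<^esub> x)\<rparr>"

text \<open>\<open>W\<close> is, up to isomorphism of \<open>P/I\<close>-modules, \<open>Ext\<^sub>P^(dim P - dim P/I)(P/I, P)\<close>. It is meant for
  polynomial rings \<open>P\<close> in finitely many variables over a field. There finitely generated modules
  have free resolutions with finite \<open>B i\<close>, so that \<open>nat\<close> suffices for the index sets. The degree
  shift is disregarded, as \<open>W\<close> is not considered as a graded module.\<close>

definition canonical_module ::
    "('a, 'r) ring_scheme \<Rightarrow> 'a set \<Rightarrow> ('a set, 'w, 'm) module_scheme \<Rightarrow> bool" where
  "canonical_module P I W \<longleftrightarrow> Module.module (P Quot I) W \<and>
    (\<exists>(B :: nat \<Rightarrow> nat set) d e.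
       free_resolution P (quotient_module (regular_module P) I) B d e \<and>
       module_iso (P Quot I) W
         (induced_quotient_action (ext_module P B d (regular_module P)
            (the_enat (krull_dim P) - the_enat (krull_dim (P Quot I))))))"

section \<open>Simplicial complexes\<close>

definition simplicial_complex :: "'v set \<Rightarrow> 'v set set \<Rightarrow> bool" where
  "simplicial_complex V \<Delta> \<longleftrightarrow> finite V \<and> \<Delta> \<subseteq> Pow V \<and> \<Delta> \<noteq> {} \<and>
     (\<forall>F\<in>\<Delta>. \<forall>G. G \<subseteq> F \<longrightarrow> G \<in> \<Delta>) \<and> (\<forall>v\<in>V. {v} \<in> \<Delta>)"

definition facets :: "'v set set \<Rightarrow> 'v set set" where
  "facets \<Delta> = {F \<in> \<Delta>. \<forall>G\<in>\<Delta>. F \<subseteq> G \<longrightarrow> G = F}"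

definition face_dim :: "'v set \<Rightarrow> int" where
  "face_dim F = int (card F) - 1"

definition complex_dim :: "'v set set \<Rightarrow> int" where
  "complex_dim \<Delta> = Max (face_dim ` \<Delta>)"

definition pure :: "'v set set \<Rightarrow> bool" where
  "pure \<Delta> \<longleftrightarrow> (\<forall>F\<in>facets \<Delta>. \<forall>G\<in>facets \<Delta>. face_dim F = face_dim G)"

definition is_simplex :: "'v set set \<Rightarrow> bool" where
  "is_simplex \<Delta> \<longleftrightarrow> (\<exists>!F. F \<in> facets \<Delta>)"

text \<open>The full subcomplexes on the classes of vertices connected by edge paths; each of them
  contains the empty face. The complex \<open>{{}}\<close> has no components.\<close>

definition components :: "'v set set \<Rightarrow> 'v set set set" where
  "components \<Delta> =
     (\<lambda>v. {F \<in> \<Delta>. F \<subseteq> {(u, w). {u, w} \<in> \<Delta>}\<^sup>* `` {v}}) ` (\<Union>\<Delta>)"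

section \<open>Stanley--Reisner rings\<close>

type_synonym 'k mpoly = "(nat \<Rightarrow>\<^sub>0 nat) \<Rightarrow>\<^sub>0 'k"

definition poly_ring :: "'k::field itself \<Rightarrow> nat set \<Rightarrow> 'k mpoly ring" where
  "poly_ring _ V = \<lparr>carrier = {p. \<forall>m\<in>Poly_Mapping.keys p. Poly_Mapping.keys m \<subseteq> V},
     mult = (*), one = 1, zero = 0, add = (+)\<rparr>"

definition indet :: "nat \<Rightarrow> 'k::field mpoly" where
  "indet v = Poly_Mapping.single (Poly_Mapping.single v 1) 1"

definition homogeneous_polys :: "'k::field itself \<Rightarrow> nat set \<Rightarrow> nat \<Rightarrow> 'k mpoly set" where
  "homogeneous_polys k V i = {p \<in> carrier (poly_ring k V).
     \<forall>m\<in>Poly_Mapping.keys p. (\<Sum>v\<in>Poly_Mapping.keys m. Poly_Mapping.lookup m v) = i}"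

definition SR_ideal :: "'k::field itself \<Rightarrow> nat set \<Rightarrow> nat set set \<Rightarrow> 'k mpoly set" where
  "SR_ideal k V \<Delta> = genideal (poly_ring k V) {\<Prod>v\<in>F. indet v | F. F \<subseteq> V \<and> F \<notin> \<Delta>}"

definition SR_ring :: "'k::field itself \<Rightarrow> nat set \<Rightarrow> nat set set \<Rightarrow> 'k mpoly set ring" where
  "SR_ring k V \<Delta> = poly_ring k V Quot SR_ideal k V \<Delta>"

definition SR_grading ::
    "'k::field itself \<Rightarrow> nat set \<Rightarrow> nat set set \<Rightarrow> nat \<Rightarrow> 'k mpoly set set" where
  "SR_grading k V \<Delta> i =
     (\<lambda>p. SR_ideal k V \<Delta> +>\<^bsub>poly_ring k V\<^esub> p) ` homogeneous_polys k V i"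

end

theory Submission
  imports Defs "HOL-Combinatorics.Permutations"
begin

text \<open>Differentials. If \<open>F\<close> is a facet with monomial \<open>x\<^sub>F\<close> and \<open>u\<close> is a vertex outside \<open>F\<close>, then
  \<open>x\<^sub>F x\<^sub>u = 0\<close> gives \<open>x\<^sub>F\<^sup>2 dx\<^sub>u = 0\<close>. Hence every homomorphism from the \<open>d\<close>-th exterior power to the
  Stanley-Reisner ring, \<open>d\<close> the dimension of the ring, sends \<open>dx\<^sub>J\<close> into the minimal prime of each facet
  that does not contain \<open>J\<close>. So a variable cannot lie in the trace if its vertex lies on a facet with fewer
  than \<open>d\<close> vertices or on two different facets. Conversely, on an isolated simplex \<open>F\<close> with \<open>d\<close> vertices
  the Jacobian determinant in the variables of \<open>F\<close>, multiplied by \<open>x\<^sub>v\<close>, is a homomorphism with value \<open>x\<^sub>v\<close>.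

  Canonical module. A cocycle of the dualized resolution is evaluated on the top element of a comparison map
  from the Koszul complex of the variables outside \<open>F\<close> that lifts multiplication with \<open>x\<^sub>v\<close>; modulo
  these variables this depends only on the Ext class. A comparison map in the other direction, which exists
  because the Koszul complex is exact, provides a cocycle with value \<open>x\<^sub>v\<close>.

  Dimension. Any \<open>n + 1\<close> polynomials in \<open>n\<close> variables are algebraically dependent, which bounds the length of
  chains of primes.\<close>

section \<open>Polynomials\<close>

text \<open>Setting the variables outside a face to zero kills the Stanley-Reisner ideal and lands
  in a domain, so questions about cosets become identities of polynomials. A trace is bounded from
  above by such restrictions being zero. The obstacle lies in the other direction: k[F] is a
  quotient of the Stanley-Reisner ring, not a submodule, so a functional with values in k[F] is not
  yet a functional to the ring. If no edge leaves \<open>F\<close>, however, the variables of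
  \<open>F\<close> annihilate all others, and the ideal that they generate in k[F] is a submodule of
  the ring. This is the origin of the factor x_v in both constructions. A canonical module is given
  through some resolution, which is neither minimal nor graded. Its functionals may therefore take
  values with a constant term, which forces a separate argument for isolated vertices. Equal
  dimension of the components is what makes the degree of Ext equal to the number of variables
  outside \<open>F\<close> for every component \<open>F\<close>, which is the degree in which the
  Koszul complex of these variables ends.\<close>

abbreviation (input) "keys \<equiv> Poly_Mapping.keys"
abbreviation (input) "lookup \<equiv> Poly_Mapping.lookup"
abbreviation (input) "single \<equiv> Poly_Mapping.single"

lemma keys_add_nat: "keys (a + b :: nat \<Rightarrow>\<^sub>0 nat) = keys a \<union> keys b"
  by (auto simp: in_keys_iff lookup_add)

lemma poly_mapping_sum_single:
  "p = (\<Sum>m\<in>keys p. single m (lookup p m))"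
proof (rule poly_mapping_eqI)
  fix k
  have "(\<Sum>m\<in>keys p. lookup (single m (lookup p m)) k)
      = (\<Sum>m\<in>keys p. if m = k then lookup p k else 0)"
    by (rule sum.cong) (auto simp: lookup_single)
  then show "lookup p k =
     lookup (\<Sum>m\<in>keys p. single m (lookup p m)) k"
    by (simp add: lookup_sum in_keys_iff)
qed

lemma poly_mapping_add_induct [case_names zero single add]:
  fixes p :: "'a \<Rightarrow>\<^sub>0 'b::comm_monoid_add"
  assumes "P 0"
    and "\<And>m c. m \<in> keys p \<Longrightarrow> c \<noteq> 0 \<Longrightarrow> P (single m c)"
    and "\<And>a b. P a \<Longrightarrow> P b \<Longrightarrow> P (a + b)"
  shows "P p"
proof -
  have "P (\<Sum>m\<in>M. single m (lookup p m))"
    if "finite M" "M \<subseteq> keys p" for M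
    using that by induction (auto intro!: assms simp: in_keys_iff)
  from this[of "keys p"] show ?thesis
    by (simp flip: poly_mapping_sum_single)
qed

text \<open>The codomain is a group, so additivity alone forces the value 0 at 0; the rest is
  decomposition into terms. Multiplicative identities such as the Leibniz rule are reduced to
  monomials in this way.\<close>

lemma additive_eqI:
  fixes f g :: "('a \<Rightarrow>\<^sub>0 'b::comm_monoid_add) \<Rightarrow> 'c::ab_group_add"
  assumes f: "\<And>p q. f (p + q) = f p + f q" and g: "\<And>p q. g (p + q) = g p + g q"
    and "\<And>m c. f (single m c) = g (single m c)"
  shows "f p = g p"
proof (induction p rule: poly_mapping_add_induct)
  case zero
  show ?case using assms(1)[of 0 0] assms(2)[of 0 0] by simp
qed (simp_all add: assms)

lemma biadditive_eqI:
  fixes f g :: "('a \<Rightarrow>\<^sub>0 'b::comm_monoid_add) \<Rightarrow> ('a \<Rightarrow>\<^sub>0 'b) \<Rightarrow> 'c::ab_group_add"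
  assumes "\<And>p p' q. f (p + p') q = f p q + f p' q" "\<And>p q q'. f p (q + q') = f p q + f p q'"
    and "\<And>p p' q. g (p + p') q = g p q + g p' q" "\<And>p q q'. g p (q + q') = g p q + g p q'"
    and "\<And>m c n d. f (single m c) (single n d) =
       g (single m c) (single n d)"
  shows "f p q = g p q"
  by (rule additive_eqI[where f = "\<lambda>p. f p q" and g = "\<lambda>p. g p q"], (rule assms)+,
      rule additive_eqI, (rule assms)+)

text \<open>This is the ring endomorphism that substitutes 0 for every variable outside
  \<open>A\<close>. It replaces the projection to k[A] but stays inside one polynomial type, so that
  different faces can be compared directly.\<close>

definition restr :: "nat set \<Rightarrow> 'k::field mpoly \<Rightarrow> 'k mpoly" where
  "restr A p = (\<Sum>m\<in>keys p.
     if keys m \<subseteq> A then single m (lookup p m) else 0)"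

lemma lookup_restr:
  "lookup (restr A p) m = (if keys m \<subseteq> A then lookup p m else 0)"
proof -
  have "lookup (restr A p) m = (\<Sum>n\<in>keys p.
     if n = m then (if keys m \<subseteq> A then lookup p m else 0) else 0)"
    unfolding restr_def lookup_sum by (rule sum.cong) (auto simp: lookup_single)
  then show ?thesis by (simp add: in_keys_iff)
qed

lemma restr_add [simp]: "restr A (p + q) = restr A p + restr A q"
  by (rule poly_mapping_eqI) (simp add: lookup_restr lookup_add)

lemma restr_zero [simp]: "restr A 0 = 0"
  by (rule poly_mapping_eqI) (simp add: lookup_restr)

lemma restr_uminus [simp]: "restr A (- p) = - restr A p"
  by (rule poly_mapping_eqI) (simp add: lookup_restr)

lemma restr_diff [simp]: "restr A (p - q) = restr A p - restr A q"
  by (rule poly_mapping_eqI) (simp add: lookup_restr lookup_minus)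

lemma restr_sum: "restr A (sum f X) = (\<Sum>x\<in>X. restr A (f x))"
  by (induction X rule: infinite_finite_induct) simp_all

lemma restr_single:
  "restr A (single m c) = (if keys m \<subseteq> A then single m c else 0)"
  by (rule poly_mapping_eqI) (auto simp: lookup_restr lookup_single when_def)

lemma restr_one [simp]: "restr A 1 = 1"
  using restr_single[of A 0 1] by simp

lemma restr_mult [simp]: "restr A (p * q) = restr A p * restr A q"
  by (rule biadditive_eqI[where f = "\<lambda>p q. restr A (p * q)" and g = "\<lambda>p q. restr A p * restr A q"])
     (simp_all add: algebra_simps mult_single restr_single keys_add_nat)

lemma restr_prod: "restr A (prod f X) = (\<Prod>x\<in>X. restr A (f x))"
  by (induction X rule: infinite_finite_induct) simp_all

lemma restr_power: "restr A (p ^ n) = restr A p ^ n"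
  by (induction n) simp_all

lemma restr_restr [simp]: "restr A (restr B p) = restr (A \<inter> B) p"
  by (rule poly_mapping_eqI) (auto simp: lookup_restr)

lemma indet_ne_0 [simp]: "indet v \<noteq> (0 :: 'k::field mpoly)"
proof
  assume "indet v = (0 :: 'k mpoly)"
  then have "lookup (indet v) (single v 1) = (0 :: 'k)" by simp
  then show False by (simp add: indet_def)
qed

lemma restr_indet: "restr A (indet v) = (if v \<in> A then indet v else 0)"
  by (simp add: indet_def restr_single)

lemma restr_indet_prod:
  assumes "finite F"
  shows "restr A (\<Prod>v\<in>F. indet v) = (if F \<subseteq> A then \<Prod>v\<in>F. indet v else 0)"
proof (cases "F \<subseteq> A")
  case False
  then obtain v where "v \<in> F" "v \<notin> A" by auto
  then show ?thesis using False assms by (auto simp: restr_prod restr_indet)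
qed (auto simp: restr_prod restr_indet intro!: prod.cong)

section \<open>Polynomials in the variables of a vertex set\<close>

abbreviation PV :: "nat set \<Rightarrow> 'k::field mpoly set" where
  "PV V \<equiv> carrier (poly_ring TYPE('k) V)"

lemma in_PV_iff: "p \<in> PV V \<longleftrightarrow> (\<forall>m\<in>keys p. keys m \<subseteq> V)"
  by (simp add: poly_ring_def)

lemma in_PV_iff_restr: "p \<in> PV V \<longleftrightarrow> restr V p = p"
proof
  assume "p \<in> PV V"
  then show "restr V p = p"
    by (intro poly_mapping_eqI) (auto simp: lookup_restr in_PV_iff in_keys_iff)
next
  assume r: "restr V p = p"
  show "p \<in> PV V" unfolding in_PV_iff
    by (metis r in_keys_iff lookup_restr)
qed

lemma PV_closed [simp, intro]:
  "0 \<in> PV V" "1 \<in> PV V" "p \<in> PV V \<Longrightarrow> q \<in> PV V \<Longrightarrow> p + q \<in> PV V"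
  "p \<in> PV V \<Longrightarrow> q \<in> PV V \<Longrightarrow> p - q \<in> PV V"
  "p \<in> PV V \<Longrightarrow> q \<in> PV V \<Longrightarrow> p * q \<in> PV V" "p \<in> PV V \<Longrightarrow> - p \<in> PV V"
  "p \<in> PV V \<Longrightarrow> p ^ n \<in> PV V"
  by (simp_all add: in_PV_iff_restr restr_power)

lemma PV_sum [simp, intro]: "(\<And>x. x \<in> X \<Longrightarrow> f x \<in> PV V) \<Longrightarrow> sum f X \<in> PV V"
  by (induction X rule: infinite_finite_induct) simp_all

lemma PV_prod [simp, intro]: "(\<And>x. x \<in> X \<Longrightarrow> f x \<in> PV V) \<Longrightarrow> prod f X \<in> PV V"
  by (induction X rule: infinite_finite_induct) simp_all

lemma indet_in_PV [simp]: "indet v \<in> PV V \<longleftrightarrow> v \<in> V"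
  by (simp add: in_PV_iff_restr restr_indet)

lemma const_in_PV [simp]: "single 0 c \<in> PV V"
  by (simp add: in_PV_iff_restr restr_single)

lemma restr_in_PV [simp]: "p \<in> PV V \<Longrightarrow> restr A p \<in> PV V"
  by (auto simp: in_PV_iff_restr Int_commute) (metis Int_commute restr_restr)

lemma restr_in_PV_self: "restr A p \<in> PV A"
  by (simp add: in_PV_iff_restr)

lemma PV_mono: "A \<subseteq> V \<Longrightarrow> p \<in> PV A \<Longrightarrow> p \<in> PV V"
  by (auto simp: in_PV_iff)

lemma single_eq_indet_mult:
  assumes "v \<in> keys m"
  obtains n where "m = n + single v 1" "keys n \<subseteq> keys m"
    "\<And>c :: 'k::field. single m c = indet v * single n c"
proof -
  define n where "n = m - single v 1"
  have m: "m = n + single v 1"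
    using assms unfolding n_def
    by (intro poly_mapping_eqI) (auto simp: lookup_add lookup_minus lookup_single when_def in_keys_iff)
  then have "single m c = indet v * single n (c::'k)" for c
    by (simp add: indet_def mult_single add.commute)
  moreover have "keys n \<subseteq> keys m" by (subst m) (auto simp: keys_add_nat)
  ultimately show thesis using m that by blast
qed

lemma single_induct [consumes 1, case_names const mult]:
  fixes c :: "'k::field"
  assumes "keys m \<subseteq> V"
    and "\<And>c. P (single 0 c)"
    and "\<And>v p. v \<in> V \<Longrightarrow> p \<in> PV V \<Longrightarrow> P p \<Longrightarrow> P (indet v * p)"
  shows "P (single m c)"
  using assms(1)
proof (induction "\<Sum>v\<in>keys m. lookup m v" arbitrary: m rule: less_induct)
  case less
  show ?case
  proof (cases "keys m = {}")
    case True
    then show ?thesis using assms(2) by simp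
  next
    case False
    then obtain v where v: "v \<in> keys m" by blast
    from single_eq_indet_mult[OF v] obtain n where n: "m = n + single v 1"
       "keys n \<subseteq> keys m"
       "\<And>c :: 'k. single m c = indet v * single n c" by metis
    have "(\<Sum>w\<in>keys n. lookup n w) = (\<Sum>w\<in>keys m. lookup n w)"
      using n(2) by (intro sum.mono_neutral_left) (auto simp: in_keys_iff)
    also have "\<dots> < (\<Sum>w\<in>keys m. lookup m w)"
      by (rule sum_strict_mono_ex1) (use v in \<open>auto simp: n(1) lookup_add lookup_single when_def\<close>)
    finally have "P (single n c)" using less n(2) by auto
    moreover have "single n c \<in> PV V"
      using subset_trans[OF n(2) less.prems] by (simp add: in_PV_iff)
    ultimately show ?thesis using n(3) v less.prems assms(3)[of v "single n c"] by auto
  qed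
qed

text \<open>The cases fit a derivation: it kills constants, respects sums, and the Leibniz rule
  handles a variable times a polynomial.\<close>

lemma PV_induct [consumes 1, case_names const add mult]:
  fixes p :: "'k::field mpoly"
  assumes "p \<in> PV V"
    and "\<And>c. P (single 0 c)"
    and "\<And>p q. p \<in> PV V \<Longrightarrow> q \<in> PV V \<Longrightarrow> P p \<Longrightarrow> P q \<Longrightarrow> P (p + q)"
    and "\<And>v p. v \<in> V \<Longrightarrow> p \<in> PV V \<Longrightarrow> P p \<Longrightarrow> P (indet v * p)"
  shows "P p"
proof -
  have "p \<in> PV V \<and> P p"
  proof (induction p rule: poly_mapping_add_induct)
    case zero
    show ?case using assms(2)[of 0] by simp
  next
    case (single m c)
    have m: "keys m \<subseteq> V" using single assms(1) by (auto simp: in_PV_iff)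
    then show ?case using single_induct[of m V P c] assms(2,4) single(2) by (simp add: in_PV_iff)
  next
    case (add a b)
    then show ?case using assms(3) by blast
  qed
  then show ?thesis ..
qed

text \<open>A monomial killed by \<open>restr A\<close> contains a variable outside
  \<open>A\<close>, so the kernel is the ideal generated by these variables. With \<open>A\<close>
  empty it consists of the polynomials without constant term.\<close>

lemma ker_restr_induct [consumes 2, case_names zero add mult]:
  fixes p :: "'k::field mpoly"
  assumes "p \<in> PV V" "restr A p = 0"
    and zero: "P 0" and add: "\<And>p q. P p \<Longrightarrow> P q \<Longrightarrow> P (p + q)"
    and mult: "\<And>u q. u \<in> V - A \<Longrightarrow> q \<in> PV V \<Longrightarrow> P (indet u * q)"
  shows "P p"
proof (induction p rule: poly_mapping_add_induct)
  case (single m c)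
  have m: "keys m \<subseteq> V" using single assms(1) by (auto simp: in_PV_iff)
  have "lookup (restr A p) m = 0" using assms(2) by simp
  then have "\<not> keys m \<subseteq> A" using single by (auto simp: lookup_restr in_keys_iff)
  then obtain u where u: "u \<in> keys m" "u \<notin> A" by auto
  from single_eq_indet_mult[OF u(1)] obtain n where n: "keys n \<subseteq> keys m"
     "\<And>c :: 'k. single m c = indet u * single n c" by metis
  moreover have "single n c \<in> PV V" using subset_trans[OF n(1) m] by (simp add: in_PV_iff)
  ultimately show ?case using mult[of u "single n c"] m u by auto
qed (fact zero add)+

section \<open>Formal partial derivatives\<close>

definition pd :: "nat \<Rightarrow> 'k::field mpoly \<Rightarrow> 'k mpoly" where
  "pd u p = (\<Sum>m\<in>keys p. single (m - single u 1)
     (of_nat (lookup m u) * lookup p m))"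

lemma pd_add [simp]: "pd u (p + q) = pd u p + pd u q"
  unfolding pd_def
  by (rule setsum_keys_plus_distrib) (simp_all add: algebra_simps single_add)

lemma pd_single: "pd u (single m c) =
    single (m - single u 1) (of_nat (lookup m u) * c)"
  by (cases "c = 0") (auto simp: pd_def)

lemma pd_const [simp]: "pd u (single 0 c) = 0"
  by (simp add: pd_single)

lemma pd_indet: "pd u (indet v) = (if u = v then 1 else 0)"
  by (simp add: indet_def pd_single lookup_single)

text \<open>Subtraction of exponents is truncated, so it commutes with adding \<open>n\<close> only
  when \<open>u\<close> occurs in \<open>m\<close>. Otherwise the coefficient has the factor 0, and
  the wrong exponent does no harm.\<close>

lemma pd_mult_single_aux:
  fixes m n :: "nat \<Rightarrow>\<^sub>0 nat" and c d :: "'k::field"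
  shows "single (m + n - single u 1) (of_nat (lookup m u) * (c * d)) =
   single (m - single u 1 + n) (of_nat (lookup m u) * (c * d))"
proof (cases "lookup m u = 0")
  case False
  then have "m + n - single u 1 = m - single u 1 + n"
    by (intro poly_mapping_eqI) (auto simp: lookup_add lookup_minus lookup_single when_def)
  then show ?thesis by simp
qed simp

lemma pd_mult: "pd u (p * q) = p * pd u q + q * pd u p"
proof (rule biadditive_eqI[where f = "\<lambda>p q. pd u (p * q)" and g = "\<lambda>p q. p * pd u q + q * pd u p"])
  fix m n :: "nat \<Rightarrow>\<^sub>0 nat" and c d :: 'a
  show "pd u (single m c * single n d) =
    single m c * pd u (single n d) + single n d * pd u (single m c)"
    using pd_mult_single_aux[of m n u c d] pd_mult_single_aux[of n m u d c]
    by (simp add: mult_single pd_single lookup_add algebra_simps single_add)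
qed (simp_all add: algebra_simps)

text \<open>Linear coefficients of a multiple of a variable reveal the constant term of the
  cofactor. An equation x_w q = x_v r with distinct \<open>v\<close> and \<open>w\<close> thus
  forces \<open>q\<close> to have no constant term.\<close>

lemma lookup_indet_mult:
  "lookup (indet v * p) (single w 1) = (if v = w then lookup p 0 else 0)"
proof (rule additive_eqI[where p = p])
  fix m :: "nat \<Rightarrow>\<^sub>0 nat" and c :: 'a
  have "single v 1 + m = single w 1 \<longleftrightarrow> v = w \<and> m = 0"
  proof
    assume a: "single v 1 + m = single w 1"
    then have "lookup (single v 1 + m) v = lookup (single w 1) v" by simp
    then have "v = w" by (auto simp: lookup_add lookup_single when_def split: if_splits)
    then show "v = w \<and> m = 0" using a by simp
  qed simp
  then show "lookup (indet v * single m c) (single w 1) =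
       (if v = w then lookup (single m c) 0 else 0)"
    by (auto simp: indet_def mult_single lookup_single when_def)
qed (auto simp: algebra_simps lookup_add)

section \<open>Stanley-Reisner rings\<close>

lemma poly_ring_simps [simp]:
  "add (poly_ring k V) = (+)" "monoid.mult (poly_ring k V) = (*)"
  "one (poly_ring k V) = 1" "zero (poly_ring k V) = 0"
  by (simp_all add: poly_ring_def)

lemma cring_poly_ring: "cring (poly_ring TYPE('k::field) V)"
proof (intro cringI abelian_groupI comm_monoidI)
  fix x :: "'k mpoly" assume "x \<in> PV V"
  then show "\<exists>y\<in>PV V. y \<oplus>\<^bsub>poly_ring TYPE('k) V\<^esub> x = \<zero>\<^bsub>poly_ring TYPE('k) V\<^esub>"
    by (auto intro!: bexI[of _ "- x"])
qed (auto simp: algebra_simps)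

lemma a_inv_poly_ring: "p \<in> PV V \<Longrightarrow> \<ominus>\<^bsub>poly_ring TYPE('k::field) V\<^esub> p = - p"
  by (rule abelian_group.minus_equality) (auto intro: ring.is_abelian_group cring.axioms(1) cring_poly_ring)

locale poly_quotient =
  fixes k :: "'k::field itself" and V :: "nat set" and I :: "'k mpoly set"
  assumes ideal_I: "ideal I (poly_ring TYPE('k) V)"
begin

abbreviation "S \<equiv> poly_ring TYPE('k) V Quot I"

definition cls :: "'k mpoly \<Rightarrow> 'k mpoly set" where
  "cls p = I +>\<^bsub>poly_ring TYPE('k) V\<^esub> p"

lemma cls_eq: "cls p = (\<lambda>i. i + p) ` I"
  by (auto simp: cls_def a_r_coset_def r_coset_def)

lemma I_closed:
  "I \<subseteq> PV V" "0 \<in> I" "p \<in> I \<Longrightarrow> q \<in> I \<Longrightarrow> p + q \<in> I" "p \<in> I \<Longrightarrow> - p \<in> I"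
  "p \<in> I \<Longrightarrow> q \<in> I \<Longrightarrow> p - q \<in> I" "p \<in> I \<Longrightarrow> r \<in> PV V \<Longrightarrow> r * p \<in> I" "p \<in> I \<Longrightarrow> r \<in> PV V \<Longrightarrow> p * r \<in> I"
proof -
  interpret ideal I "poly_ring TYPE('k) V" by (fact ideal_I)
  show *: "I \<subseteq> PV V" using a_subset by auto
  show "0 \<in> I" using additive_subgroup.zero_closed[OF is_additive_subgroup] by simp
  show add: "p \<in> I \<Longrightarrow> q \<in> I \<Longrightarrow> p + q \<in> I" for p q
    using additive_subgroup.a_closed[OF is_additive_subgroup, of p q] by simp
  show minus: "p \<in> I \<Longrightarrow> - p \<in> I" for p using I_l_closed[of p "- 1"] by simp
  show "p \<in> I \<Longrightarrow> q \<in> I \<Longrightarrow> p - q \<in> I" for p q using add[of p "- q"] minus[of q] by simp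
  show "p \<in> I \<Longrightarrow> r \<in> PV V \<Longrightarrow> r * p \<in> I" "p \<in> I \<Longrightarrow> r \<in> PV V \<Longrightarrow> p * r \<in> I" for p r
    using I_l_closed[of p r] by (simp_all add: mult.commute)
qed

lemma cls_eq_iff: "cls p = cls q \<longleftrightarrow> p - q \<in> I"
proof
  assume "cls p = cls q"
  moreover have "p \<in> cls p" using I_closed(2) by (force simp: cls_eq)
  ultimately show "p - q \<in> I" by (auto simp: cls_eq)
next
  assume d: "p - q \<in> I"
  have "x \<in> cls q" if "x \<in> cls p" "p - q \<in> I" for x p q
  proof -
    obtain i where i: "i \<in> I" "x = i + p" using \<open>x \<in> cls p\<close> by (auto simp: cls_eq)
    then have "x = (i + (p - q)) + q" by simp
    then show ?thesis using i that I_closed(3) unfolding cls_eq by blast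
  qed
  moreover have "q - p \<in> I" using I_closed(4)[OF d] by simp
  ultimately show "cls p = cls q" using d by blast
qed

lemma mem_cls_iff: "x \<in> cls p \<longleftrightarrow> x - p \<in> I"
proof
  assume "x - p \<in> I"
  then show "x \<in> cls p" unfolding cls_eq by (intro image_eqI[of _ _ "x - p"]) auto
qed (auto simp: cls_eq)

lemma carrier_S: "carrier S = cls ` PV V"
  by (auto simp: FactRing_def A_RCOSETS_def RCOSETS_def cls_def a_r_coset_def)

lemma cls_in_S [simp, intro]: "p \<in> PV V \<Longrightarrow> cls p \<in> carrier S"
  by (simp add: carrier_S)

lemma in_S_E:
  assumes "X \<in> carrier S" obtains p where "p \<in> PV V" "X = cls p"
  using assms by (auto simp: carrier_S)

lemma cring_S: "cring S"
  by (rule ideal.quotient_is_cring[OF ideal_I cring_poly_ring])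

lemma S_zero: "\<zero>\<^bsub>S\<^esub> = cls 0"
  by (simp add: FactRing_def cls_eq)

lemma S_one: "\<one>\<^bsub>S\<^esub> = cls 1"
  by (simp add: FactRing_def cls_def)

lemma S_add: "p \<in> PV V \<Longrightarrow> q \<in> PV V \<Longrightarrow> cls p \<oplus>\<^bsub>S\<^esub> cls q = cls (p + q)"
  using ring_hom_add[OF ideal.rcos_ring_hom[OF ideal_I], of p q] by (simp add: cls_def)

lemma S_mult: "p \<in> PV V \<Longrightarrow> q \<in> PV V \<Longrightarrow> cls p \<otimes>\<^bsub>S\<^esub> cls q = cls (p * q)"
  using ring_hom_mult[OF ideal.rcos_ring_hom[OF ideal_I], of p q] by (simp add: cls_def)

lemma S_eq_zero_iff: "cls p = \<zero>\<^bsub>S\<^esub> \<longleftrightarrow> p \<in> I"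
  by (simp add: S_zero cls_eq_iff)

end

section \<open>Prime ideals as kernels of homomorphisms to a domain\<close>

definition hom_to_type :: "('a, 'r) ring_scheme \<Rightarrow> ('a \<Rightarrow> 'c::comm_ring_1) \<Rightarrow> bool" where
  "hom_to_type R \<rho> \<longleftrightarrow> \<rho> \<one>\<^bsub>R\<^esub> = 1 \<and>
     (\<forall>x\<in>carrier R. \<forall>y\<in>carrier R. \<rho> (x \<oplus>\<^bsub>R\<^esub> y) = \<rho> x + \<rho> y \<and> \<rho> (x \<otimes>\<^bsub>R\<^esub> y) = \<rho> x * \<rho> y)"

lemma hom_to_type_simps:
  assumes "hom_to_type R \<rho>"
  shows "\<rho> \<one>\<^bsub>R\<^esub> = 1" "x \<in> carrier R \<Longrightarrow> y \<in> carrier R \<Longrightarrow> \<rho> (x \<oplus>\<^bsub>R\<^esub> y) = \<rho> x + \<rho> y"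
    "x \<in> carrier R \<Longrightarrow> y \<in> carrier R \<Longrightarrow> \<rho> (x \<otimes>\<^bsub>R\<^esub> y) = \<rho> x * \<rho> y"
    and "cring R \<Longrightarrow> \<rho> \<zero>\<^bsub>R\<^esub> = 0" "cring R \<Longrightarrow> x \<in> carrier R \<Longrightarrow> \<rho> (\<ominus>\<^bsub>R\<^esub> x) = - \<rho> x"
proof -
  show add: "x \<in> carrier R \<Longrightarrow> y \<in> carrier R \<Longrightarrow> \<rho> (x \<oplus>\<^bsub>R\<^esub> y) = \<rho> x + \<rho> y" for x y
    using assms by (simp add: hom_to_type_def)
  show "\<rho> \<one>\<^bsub>R\<^esub> = 1" "x \<in> carrier R \<Longrightarrow> y \<in> carrier R \<Longrightarrow> \<rho> (x \<otimes>\<^bsub>R\<^esub> y) = \<rho> x * \<rho> y"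
    using assms by (simp_all add: hom_to_type_def)
  assume "cring R"
  then interpret cring R .
  show z: "\<rho> \<zero>\<^bsub>R\<^esub> = 0" using add[of "\<zero>\<^bsub>R\<^esub>" "\<zero>\<^bsub>R\<^esub>"] by simp
  show "\<rho> (\<ominus>\<^bsub>R\<^esub> x) = - \<rho> x" if x: "x \<in> carrier R"
    using add[of x "\<ominus>\<^bsub>R\<^esub> x"] x z by (simp add: r_neg add_eq_0_iff)
qed

lemma primeideal_kernel:
  fixes \<rho> :: "'a \<Rightarrow> 'c::idom"
  assumes R: "cring R" and \<rho>: "hom_to_type R \<rho>"
  shows "primeideal {x \<in> carrier R. \<rho> x = 0} R"
proof -
  interpret cring R by fact
  note simps = hom_to_type_simps[OF \<rho>] hom_to_type_simps(4,5)[OF \<rho> R]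
  show ?thesis
  proof (rule primeidealI)
    show "ideal {x \<in> carrier R. \<rho> x = 0} R"
    proof (rule idealI)
      show "subgroup {x \<in> carrier R. \<rho> x = 0} (add_monoid R)"
        by (rule group.subgroupI[OF a_group]) (auto simp: simps simp flip: a_inv_def)
    qed (auto simp: simps ring_axioms)
    show "carrier R \<noteq> {x \<in> carrier R. \<rho> x = 0}"
      using simps(1) by (metis (mono_tags, lifting) mem_Collect_eq one_closed zero_neq_one)
  qed (auto simp: simps cring_axioms)
qed

text \<open>Kernels of homomorphisms to a domain are prime, so a chain of primes can be exhibited by
  evaluation maps, without describing any ideal by generators.\<close>

lemma krull_dim_ge:
  fixes \<rho> :: "nat \<Rightarrow> 'a \<Rightarrow> 'c::idom"
  assumes R: "cring R" and \<rho>: "\<And>i. i \<le> n \<Longrightarrow> hom_to_type R (\<rho> i)"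
    and mono: "\<And>i x. i < n \<Longrightarrow> x \<in> carrier R \<Longrightarrow> \<rho> i x = 0 \<Longrightarrow> \<rho> (Suc i) x = 0"
    and strict: "\<And>i. i < n \<Longrightarrow> \<exists>x\<in>carrier R. \<rho> i x \<noteq> 0 \<and> \<rho> (Suc i) x = 0"
  shows "enat n \<le> krull_dim R"
  unfolding krull_dim_def
proof (rule SUP_upper, intro CollectI exI conjI allI impI)
  let ?p = "\<lambda>i. {x \<in> carrier R. \<rho> i x = 0}"
  fix i assume "i < n"
  then show "?p i \<subset> ?p (Suc i)" using mono[of i] strict[of i] by auto
qed (simp add: primeideal_kernel R \<rho>)

lemma ideal_ker_restr: "ideal {p \<in> PV V. restr A p = 0} (poly_ring TYPE('k::field) V)"
proof (rule idealI)
  interpret cring "poly_ring TYPE('k) V" by (rule cring_poly_ring)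
  show "subgroup {p \<in> PV V. restr A p = 0} (add_monoid (poly_ring TYPE('k) V))"
    by (rule group.subgroupI[OF a_group]) (auto simp: a_inv_poly_ring[unfolded a_inv_def, simplified])
  show "ring (poly_ring TYPE('k) V)" by (rule ring_axioms)
qed auto

section \<open>The Stanley-Reisner ideal and restriction to faces\<close>

locale SR =
  fixes k :: "'k::field itself" and V :: "nat set" and \<Delta> :: "nat set set"
  assumes complex: "simplicial_complex V \<Delta>"
begin

abbreviation "I \<equiv> SR_ideal TYPE('k) V \<Delta>"
abbreviation "vmon F \<equiv> (\<Prod>v\<in>F. indet v) :: 'k mpoly"

lemma fin_V: "finite V" and sub_V: "F \<in> \<Delta> \<Longrightarrow> F \<subseteq> V" and fin_face: "F \<in> \<Delta> \<Longrightarrow> finite F"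
  and face_sub: "F \<in> \<Delta> \<Longrightarrow> G \<subseteq> F \<Longrightarrow> G \<in> \<Delta>" and vertex: "v \<in> V \<Longrightarrow> {v} \<in> \<Delta>"
  and empty_face: "{} \<in> \<Delta>" and fin_\<Delta>: "finite \<Delta>" and Union_\<Delta>: "\<Union>\<Delta> = V"
  using complex unfolding simplicial_complex_def
  by (auto dest: finite_subset intro: rev_finite_subset finite_subset)

lemma gens_sub: "{vmon F | F. F \<subseteq> V \<and> F \<notin> \<Delta>} \<subseteq> PV V"
  by (auto intro!: PV_prod)

sublocale poly_quotient k V I
proof (rule poly_quotient.intro)
  interpret ring "poly_ring TYPE('k) V" by (rule cring.axioms(1)[OF cring_poly_ring])
  show "ideal I (poly_ring TYPE('k) V)"
    unfolding SR_ideal_def by (rule genideal_ideal[OF gens_sub])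
qed

lemma SR_ring_eq: "SR_ring TYPE('k) V \<Delta> = S"
  by (simp add: SR_ring_def)

lemma SR_grading_eq: "SR_grading TYPE('k) V \<Delta> i = cls ` homogeneous_polys TYPE('k) V i"
  by (simp add: SR_grading_def cls_def)

lemma nonface_in_I: "F \<subseteq> V \<Longrightarrow> F \<notin> \<Delta> \<Longrightarrow> vmon F \<in> I"
proof -
  interpret ring "poly_ring TYPE('k) V" by (rule cring.axioms(1)[OF cring_poly_ring])
  show "F \<subseteq> V \<Longrightarrow> F \<notin> \<Delta> \<Longrightarrow> vmon F \<in> I"
    unfolding SR_ideal_def using genideal_self[OF gens_sub] by auto
qed

text \<open>A nonface is not contained in the face \<open>A\<close>, so the generator belonging to
  it has a variable that is set to zero.\<close>

lemma restr_I: "A \<in> \<Delta> \<Longrightarrow> p \<in> I \<Longrightarrow> restr A p = 0"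
proof -
  assume A: "A \<in> \<Delta>"
  interpret ring "poly_ring TYPE('k) V" by (rule cring.axioms(1)[OF cring_poly_ring])
  have "I \<subseteq> {p \<in> PV V. restr A p = 0}"
    unfolding SR_ideal_def
  proof (rule genideal_minimal[OF ideal_ker_restr])
    show "{vmon F | F. F \<subseteq> V \<and> F \<notin> \<Delta>} \<subseteq> {p \<in> PV V. restr A p = 0}"
      using A face_sub fin_V by (auto intro!: PV_prod simp: restr_indet_prod finite_subset)
  qed
  then show "p \<in> I \<Longrightarrow> restr A p = 0" by auto
qed

text \<open>The projection of the Stanley-Reisner ring to k[A], computed on a chosen representative.
  For a face \<open>A\<close> the choice does not matter by \<open>restr_I\<close>; for a facet the
  kernel is a minimal prime.\<close>

definition rho :: "nat set \<Rightarrow> 'k mpoly set \<Rightarrow> 'k mpoly" where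
  "rho A X = restr A (SOME p. p \<in> X)"

lemma rho_cls: "A \<in> \<Delta> \<Longrightarrow> rho A (cls p) = restr A p"
proof -
  assume A: "A \<in> \<Delta>"
  have "p \<in> cls p" using I_closed(2) by (simp add: mem_cls_iff)
  then have "(SOME q. q \<in> cls p) \<in> cls p" by (rule someI)
  then have "restr A ((SOME q. q \<in> cls p) - p) = 0" by (intro restr_I[OF A]) (simp add: mem_cls_iff)
  then show "rho A (cls p) = restr A p" by (simp add: rho_def)
qed

lemma rho_hom: "A \<in> \<Delta> \<Longrightarrow> hom_to_type S (rho A)"
  unfolding hom_to_type_def
  by (auto simp: rho_cls S_one carrier_S S_add S_mult)

end

section \<open>Krull dimension\<close>

text \<open>Bounding each exponent separately, rather than the total degree, makes the monomials in
  the variables of \<open>F\<close> easy to count: there are at most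
  \<open>(b + 1) ^ card F\<close>.\<close>

definition exponents_le :: "nat \<Rightarrow> 'k::field mpoly \<Rightarrow> bool" where
  "exponents_le b p \<longleftrightarrow> (\<forall>m\<in>keys p. \<forall>v. lookup m v \<le> b)"

lemma exponents_le_mult: "exponents_le b p \<Longrightarrow> exponents_le c q \<Longrightarrow> exponents_le (b + c) (p * q)"
  unfolding exponents_le_def using keys_mult[of p q] by (force simp: lookup_add intro: add_mono)

lemma exponents_le_mono: "exponents_le b p \<Longrightarrow> b \<le> c \<Longrightarrow> exponents_le c p"
  unfolding exponents_le_def using le_trans by blast

lemma exponents_le_power: "exponents_le b p \<Longrightarrow> exponents_le (n * b) (p ^ n)"
proof (induction n)
  case 0
  then show ?case by (simp add: exponents_le_def)
next
  case (Suc n)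
  then show ?case using exponents_le_mult[of b p "n * b" "p ^ n"] by simp
qed

lemma exponents_le_prod:
  "(\<And>i. i < n \<Longrightarrow> exponents_le b (f i)) \<Longrightarrow> exponents_le (n * b) (\<Prod>i<n. f i)"
proof (induction n)
  case 0
  then show ?case by (simp add: exponents_le_def)
next
  case (Suc n)
  then show ?case
    using exponents_le_mult[of "n * b" "\<Prod>i<n. f i" b "f n"] by (simp add: add.commute)
qed

lemma exponents_le_ex: "\<exists>b. exponents_le b p"
proof -
  let ?E = "\<Union>m\<in>keys p. Poly_Mapping.range m"
  have "exponents_le (Max (insert 0 ?E)) p"
    unfolding exponents_le_def
  proof (intro ballI allI)
    fix m v assume m: "m \<in> keys p"
    show "lookup m v \<le> Max (insert 0 ?E)"
    proof (cases "v \<in> keys m")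
      case True
      then have "lookup m v \<in> insert 0 ?E"
        using m in_keys_lookup_in_range[OF True] by blast
      then show ?thesis by (intro Max_ge) auto
    qed (simp add: in_keys_iff)
  qed
  then show ?thesis ..
qed

lemma card_monomials:
  assumes "finite F"
  shows "finite {m :: nat \<Rightarrow>\<^sub>0 nat. keys m \<subseteq> F \<and> (\<forall>v. lookup m v \<le> b)}" (is "finite ?A")
    and "card {m :: nat \<Rightarrow>\<^sub>0 nat. keys m \<subseteq> F \<and> (\<forall>v. lookup m v \<le> b)} \<le> (b + 1) ^ card F"
proof -
  let ?f = "\<lambda>m. restrict (lookup m) F"
  have inj: "inj_on ?f ?A"
  proof (rule inj_onI, rule poly_mapping_eqI)
    fix m n v assume *: "m \<in> ?A" "n \<in> ?A" "?f m = ?f n"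
    show "lookup m v = lookup n v"
    proof (cases "v \<in> F")
      case True
      then show ?thesis using fun_cong[OF *(3), of v] by simp
    next
      case False
      then have "v \<notin> keys m" "v \<notin> keys n" using * by auto
      then show ?thesis by (simp add: in_keys_iff)
    qed
  qed
  have sub: "?f ` ?A \<subseteq> F \<rightarrow>\<^sub>E {..b}" by auto
  have fin: "finite (F \<rightarrow>\<^sub>E {..b})" using assms by (simp add: finite_PiE)
  show "finite ?A" using finite_imageD[OF finite_subset[OF sub fin] inj] .
  have "card ?A = card (?f ` ?A)" using inj by (simp add: card_image)
  also have "\<dots> \<le> card (F \<rightarrow>\<^sub>E {..b})" by (rule card_mono[OF fin sub])
  also have "\<dots> = (b + 1) ^ card F" using assms by (simp add: card_PiE)
  finally show "card ?A \<le> (b + 1) ^ card F" .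
qed

interpretation mpoly_vs: vector_space "\<lambda>c p. single 0 c * p :: 'k::field mpoly"
proof
  fix a b :: 'k and x :: "'k mpoly"
  show "single 0 (a + b) * x = single 0 a * x + single 0 b * x"
    by (simp add: single_add distrib_right)
  show "single 0 a * (single 0 b * x) = single 0 (a * b) * x"
    by (simp add: mult_single flip: mult.assoc)
qed (simp_all add: distrib_left)

text \<open>The \<open>D\<^sup>n\<close> products of powers of the \<open>y i\<close> with exponents below \<open>D\<close> lie in a space whose
  dimension grows only like \<open>D\<^bsup>card F\<^esup>\<close>.\<close>

lemma algebraic_dependence:
  fixes y :: "nat \<Rightarrow> 'k::field mpoly"
  assumes F: "finite F" "card F < n" and y: "\<And>i. i < n \<Longrightarrow> y i \<in> PV F"
  obtains E c where "finite E" "E \<noteq> {}" "E \<subseteq> extensional {..<n}" "\<And>a. a \<in> E \<Longrightarrow> c a \<noteq> 0"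
    "(\<Sum>a\<in>E. single 0 (c a) * (\<Prod>i<n. y i ^ a i)) = 0"
proof -
  have "\<forall>i. \<exists>b. exponents_le b (y i)" using exponents_le_ex by blast
  then obtain b where b: "\<And>i. exponents_le (b i) (y i)" by metis
  define e where "e = (\<Sum>i<n. b i)"
  have e: "exponents_le e (y i)" if "i < n" for i
    by (rule exponents_le_mono[OF b]) (use that in \<open>auto simp: e_def intro: member_le_sum\<close>)
  \<comment> \<open>The products with exponents below \<open>D\<close> only involve monomials with
    exponents at most \<open>n * (D * e)\<close>, and there are at most
    \<open>D ^ card F * (n * e + 1) ^ card F\<close> of these. Since \<open>D\<close> exceeds the
    second factor, this is less than \<open>D ^ Suc (card F)\<close>, hence less than the number
    \<open>D ^ n\<close> of products.\<close>
  define D where "D = (n * e + 1) ^ card F + 1"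
  define X where "X = {..<n} \<rightarrow>\<^sub>E {..<D}"
  define w where "w = (\<lambda>a. \<Prod>i<n. y i ^ a i)"
  have finX: "finite X" unfolding X_def by (rule finite_PiE) auto
  have cardX: "card X = D ^ n" by (simp add: X_def card_PiE)
  \<comment> \<open>Extensional exponent vectors are determined by their entries below
    \<open>n\<close>. The elimination of variables along a chain of primes starts from this.\<close>
  have ext: "X \<subseteq> extensional {..<n}" by (auto simp: X_def PiE_def)
  show thesis
  proof (cases "inj_on w X")
    case False
    \<comment> \<open>Two equal products already form a relation, with coefficients 1 and
      -1.\<close>
    then obtain a a' where a: "a \<in> X" "a' \<in> X" "a \<noteq> a'" "w a = w a'" by (auto simp: inj_on_def)
    show thesis
    proof (rule that[of "{a, a'}" "\<lambda>x. if x = a then 1 else - 1"])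
      show "(\<Sum>x\<in>{a, a'}. single 0 (if x = a then 1 else - 1) * (\<Prod>i<n. y i ^ x i)) = 0"
        using a by (simp add: single_uminus w_def)
    qed (use a ext in auto)
  next
    case True
    define M where "M = {m :: nat \<Rightarrow>\<^sub>0 nat. keys m \<subseteq> F \<and> (\<forall>v. lookup m v \<le> n * (D * e))}"
    define T where "T = (\<lambda>m. single m (1::'k)) ` M"
    have finT: "finite T" unfolding T_def M_def using card_monomials(1)[OF F(1)] by blast
    have "card T \<le> card M" unfolding T_def by (rule card_image_le) (use card_monomials(1)[OF F(1)] M_def in auto)
    also have "\<dots> \<le> (n * (D * e) + 1) ^ card F" unfolding M_def by (rule card_monomials(2)[OF F(1)])
    also have "\<dots> \<le> (D * (n * e + 1)) ^ card F" by (rule power_mono) (auto simp: D_def algebra_simps)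
    also have "\<dots> = D ^ card F * (n * e + 1) ^ card F" by (rule power_mult_distrib)
    also have "\<dots> < D ^ card F * D" by (rule mult_strict_left_mono) (auto simp: D_def)
    also have "\<dots> = D ^ Suc (card F)" by simp
    also have "\<dots> \<le> D ^ n" using F(2) by (intro power_increasing) (auto simp: D_def)
    finally have less: "card T < card (w ` X)" using True by (simp add: card_image cardX)
    have "w ` X \<subseteq> mpoly_vs.span T"
    proof (rule image_subsetI)
      fix a assume a: "a \<in> X"
      have "exponents_le (n * (D * e)) (w a)"
        unfolding w_def
      proof (rule exponents_le_prod)
        fix i assume i: "i < n"
        then have "a i < D" using a by (auto simp: X_def)
        then show "exponents_le (D * e) (y i ^ a i)"
          by (intro exponents_le_mono[OF exponents_le_power[OF e[OF i]]]) simp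
      qed
      moreover have "w a \<in> PV F" unfolding w_def using y by auto
      ultimately have keys: "keys (w a) \<subseteq> M" by (auto simp: M_def exponents_le_def in_PV_iff)
      show "w a \<in> mpoly_vs.span T"
      proof (rule poly_mapping_add_induct[of "\<lambda>x. x \<in> mpoly_vs.span T" "w a"])
        show "0 \<in> mpoly_vs.span T" by (rule mpoly_vs.span_zero)
      next
        fix m and c :: 'k
        assume "m \<in> keys (w a)"
        then have "single m 1 \<in> T" using keys by (auto simp: T_def)
        then have "single 0 c * single m 1 \<in> mpoly_vs.span T"
          by (intro mpoly_vs.span_scale mpoly_vs.span_base)
        then show "single m c \<in> mpoly_vs.span T" by (simp add: mult_single)
      qed (rule mpoly_vs.span_add)
    qed
    then have "mpoly_vs.dependent (w ` X)"
      using mpoly_vs.independent_span_bound[OF finT, of "w ` X"] less by auto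
    then obtain t u where t: "finite t" "t \<subseteq> w ` X" "(\<Sum>v\<in>t. single 0 (u v) * v) = 0" "\<exists>v\<in>t. u v \<noteq> 0"
      unfolding mpoly_vs.dependent_explicit by auto
    define E where "E = {a \<in> X. w a \<in> t \<and> u (w a) \<noteq> 0}"
    have inj: "inj_on w E" using True by (rule inj_on_subset) (auto simp: E_def)
    show thesis
    proof (rule that[of E "u \<circ> w"])
      show "finite E" using finX by (simp add: E_def)
      show "E \<noteq> {}" using t(2,4) by (auto simp: E_def)
      show "E \<subseteq> extensional {..<n}" using ext by (auto simp: E_def)
      have "(\<Sum>a\<in>E. single 0 ((u \<circ> w) a) * (\<Prod>i<n. y i ^ a i)) =
         (\<Sum>a\<in>E. single 0 (u (w a)) * w a)" by (simp add: w_def)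
      also have "\<dots> = (\<Sum>v\<in>w ` E. single 0 (u v) * v)" using inj by (simp add: sum.reindex)
      also have "\<dots> = (\<Sum>v\<in>t. single 0 (u v) * v)"
      proof (rule sum.mono_neutral_left)
        show "\<forall>v\<in>t - w ` E. single 0 (u v) * v = 0"
        proof
          fix v assume v: "v \<in> t - w ` E"
          then obtain a where "a \<in> X" "v = w a" using t(2) by auto
          then have "u v = 0" using v by (auto simp: E_def)
          then show "single 0 (u v) * v = 0" by simp
        qed
      qed (use t(1) in \<open>auto simp: E_def\<close>)
      finally show "(\<Sum>a\<in>E. single 0 ((u \<circ> w) a) * (\<Prod>i<n. y i ^ a i)) = 0" using t(3) by simp
    qed (auto simp: E_def)
  qed
qed

section \<open>Chains of primes in polynomial rings and their quotients\<close>

definition poly_prime :: "nat set \<Rightarrow> 'k::field mpoly set \<Rightarrow> bool" where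
  "poly_prime V q \<longleftrightarrow> q \<subseteq> PV V \<and> 0 \<in> q \<and> (\<forall>a\<in>q. \<forall>b\<in>q. a + b \<in> q) \<and> (\<forall>r\<in>PV V. \<forall>a\<in>q. r * a \<in> q) \<and>
     1 \<notin> q \<and> (\<forall>a\<in>PV V. \<forall>b\<in>PV V. a * b \<in> q \<longrightarrow> a \<in> q \<or> b \<in> q)"

lemma poly_primeD:
  assumes "poly_prime V q"
  shows "q \<subseteq> PV V" "0 \<in> q" "a \<in> q \<Longrightarrow> b \<in> q \<Longrightarrow> a + b \<in> q" "r \<in> PV V \<Longrightarrow> a \<in> q \<Longrightarrow> r * a \<in> q"
    "1 \<notin> q" "a \<in> PV V \<Longrightarrow> b \<in> PV V \<Longrightarrow> a * b \<in> q \<Longrightarrow> a \<in> q \<or> b \<in> q"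
    "a \<in> q \<Longrightarrow> b \<in> q \<Longrightarrow> a - b \<in> q" "finite X \<Longrightarrow> (\<And>x. x \<in> X \<Longrightarrow> f x \<in> PV V) \<Longrightarrow> prod f X \<in> q \<Longrightarrow> \<exists>x\<in>X. f x \<in> q"
    "a \<in> PV V \<Longrightarrow> a ^ n \<in> q \<Longrightarrow> a \<in> q"
proof -
  note * = assms[unfolded poly_prime_def]
  show "q \<subseteq> PV V" "0 \<in> q" "1 \<notin> q" using * by auto
  show add: "a \<in> q \<Longrightarrow> b \<in> q \<Longrightarrow> a + b \<in> q" for a b using * by auto
  show mult: "r \<in> PV V \<Longrightarrow> a \<in> q \<Longrightarrow> r * a \<in> q" for r a using * by auto
  show prime: "a \<in> PV V \<Longrightarrow> b \<in> PV V \<Longrightarrow> a * b \<in> q \<Longrightarrow> a \<in> q \<or> b \<in> q" for a b using * by auto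
  show "a \<in> q \<Longrightarrow> b \<in> q \<Longrightarrow> a - b \<in> q" using add[of a "- b"] mult[of "- 1" b] by simp
  show "finite X \<Longrightarrow> (\<And>x. x \<in> X \<Longrightarrow> f x \<in> PV V) \<Longrightarrow> prod f X \<in> q \<Longrightarrow> \<exists>x\<in>X. f x \<in> q"
  proof (induction X rule: finite_induct)
    case (insert x X)
    then have "f x \<in> q \<or> prod f X \<in> q" by (intro prime) auto
    then show ?case using insert by auto
  qed (use * in auto)
  show "a \<in> PV V \<Longrightarrow> a ^ n \<in> q \<Longrightarrow> a \<in> q"
  proof (induction n)
    case (Suc n)
    then show ?case using prime[of a "a ^ n"] by auto
  qed (use * in auto)
qed

text \<open>Dividing a relation by the lowest power of \<open>y j\<close> and reducing modulo the prime that
  contains \<open>y j\<close> removes \<open>y j\<close> from the relation.\<close>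

lemma chain_step:
  fixes y :: "nat \<Rightarrow> 'k::field mpoly"
  assumes q: "poly_prime V q" "poly_prime V q'" "q \<subseteq> q'" and j: "j < n"
    and y: "\<And>i. i < n \<Longrightarrow> y i \<in> PV V" "y j \<notin> q" "y j \<in> q'"
    and E: "finite E" "E \<noteq> {}" "\<And>a b. a \<in> E \<Longrightarrow> b \<in> E \<Longrightarrow> (\<forall>i\<in>{j..<n}. a i = b i) \<Longrightarrow> a = b"
    and rel: "(\<Sum>a\<in>E. single 0 (c a) * (\<Prod>i\<in>{j..<n}. y i ^ a i)) \<in> q"
  obtains E' where "E' \<subseteq> E" "E' \<noteq> {}" "\<forall>a\<in>E'. \<forall>b\<in>E'. (\<forall>i\<in>{Suc j..<n}. a i = b i) \<longrightarrow> a = b"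
    "(\<Sum>a\<in>E'. single 0 (c a) * (\<Prod>i\<in>{Suc j..<n}. y i ^ a i)) \<in> q'"
proof -
  define m where "m = Min ((\<lambda>a. a j) ` E)"
  have m: "m \<le> a j" if "a \<in> E" for a using E(1) that by (auto simp: m_def)
  have "m \<in> (\<lambda>a. a j) ` E" unfolding m_def by (rule Min_in) (use E in auto)
  define E' where "E' = {a \<in> E. a j = m}"
  define t where "t = (\<lambda>a. single 0 (c a) * (\<Prod>i\<in>{Suc j..<n}. y i ^ a i))"
  have t: "t a \<in> PV V" for a unfolding t_def by (intro PV_closed(5) const_in_PV PV_prod PV_closed(7) y(1)) simp
  have split: "single 0 (c a) * (\<Prod>i\<in>{j..<n}. y i ^ a i) = y j ^ m * (y j ^ (a j - m) * t a)"
    if a: "a \<in> E" for a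
  proof -
    have "{j..<n} = insert j {Suc j..<n}" using j by auto
    then have "(\<Prod>i\<in>{j..<n}. y i ^ a i) = y j ^ a j * (\<Prod>i\<in>{Suc j..<n}. y i ^ a i)" by simp
    moreover have "y j ^ a j = y j ^ m * y j ^ (a j - m)" using m[OF a] by (simp flip: power_add)
    ultimately show ?thesis by (simp add: t_def algebra_simps)
  qed
  have "(\<Sum>a\<in>E. single 0 (c a) * (\<Prod>i\<in>{j..<n}. y i ^ a i)) = (\<Sum>a\<in>E. y j ^ m * (y j ^ (a j - m) * t a))"
    by (rule sum.cong) (auto simp: split)
  then have "y j ^ m * (\<Sum>a\<in>E. y j ^ (a j - m) * t a) \<in> q" using rel by (simp add: sum_distrib_left)
  moreover have yj: "y j \<in> PV V" using y(1) j by simp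
  \<comment> \<open>The prime \<open>q\<close> does not contain \<open>y j\<close>, so the common
    factor \<open>y j ^ m\<close> can be cancelled.\<close>
  ultimately have "(\<Sum>a\<in>E. y j ^ (a j - m) * t a) \<in> q"
    using poly_primeD(6)[OF q(1)] poly_primeD(9)[OF q(1) yj] y(2) t by (meson PV_closed PV_sum)
  then have sum: "(\<Sum>a\<in>E. y j ^ (a j - m) * t a) \<in> q'" using q(3) by auto
  have "E = E' \<union> (E - E')" by (auto simp: E'_def)
  then have "(\<Sum>a\<in>E. y j ^ (a j - m) * t a) = (\<Sum>a\<in>E'. y j ^ (a j - m) * t a) + (\<Sum>a\<in>E-E'. y j ^ (a j - m) * t a)"
    using E(1) by (subst sum.subset_diff[of E' E]) (auto simp: E'_def add.commute)
  also have "(\<Sum>a\<in>E'. y j ^ (a j - m) * t a) = (\<Sum>a\<in>E'. t a)" by (rule sum.cong) (auto simp: E'_def)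
  also have "(\<Sum>a\<in>E-E'. y j ^ (a j - m) * t a) = y j * (\<Sum>a\<in>E-E'. y j ^ (a j - m - 1) * t a)"
    unfolding sum_distrib_left
  proof (rule sum.cong)
    fix a assume "a \<in> E - E'"
    then have "a j - m = Suc (a j - m - 1)" using m[of a] by (auto simp: E'_def)
    then show "y j ^ (a j - m) * t a = y j * (y j ^ (a j - m - 1) * t a)" by (metis mult.assoc power_Suc)
  qed simp
  finally have eq: "(\<Sum>a\<in>E'. t a) = (\<Sum>a\<in>E. y j ^ (a j - m) * t a) - (\<Sum>a\<in>E-E'. y j ^ (a j - m - 1) * t a) * y j"
    by (simp add: algebra_simps)
  have "(\<Sum>a\<in>E-E'. y j ^ (a j - m - 1) * t a) * y j \<in> q'"
    by (rule poly_primeD(4)[OF q(2)]) (use y(3) yj t in auto)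
  then have "(\<Sum>a\<in>E'. t a) \<in> q'" unfolding eq by (rule poly_primeD(7)[OF q(2) sum])
  show thesis
  proof (rule that[of E'])
    \<comment> \<open>All members of \<open>E'\<close> have the exponent \<open>m\<close> at
      \<open>j\<close>, so the remaining exponents still tell them apart and no two terms
      collapse.\<close>
    show "\<forall>a\<in>E'. \<forall>b\<in>E'. (\<forall>i\<in>{Suc j..<n}. a i = b i) \<longrightarrow> a = b"
    proof (intro ballI impI, rule E(3))
      fix a b assume ab: "a \<in> E'" "b \<in> E'" "\<forall>i\<in>{Suc j..<n}. a i = b i"
      then show "a \<in> E" "b \<in> E" by (auto simp: E'_def)
      show "\<forall>i\<in>{j..<n}. a i = b i"
      proof
        fix i assume "i \<in> {j..<n}"
        then have "i = j \<or> i \<in> {Suc j..<n}" by auto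
        then show "a i = b i" using ab by (auto simp: E'_def)
      qed
    qed
    show "E' \<noteq> {}" using \<open>m \<in> _\<close> by (auto simp: E'_def)
  qed (use \<open>(\<Sum>a\<in>E'. t a) \<in> q'\<close> in \<open>auto simp: E'_def t_def\<close>)
qed

text \<open>In a longer chain choose \<open>y i\<close> in \<open>q (Suc i)\<close> but not in
  \<open>q i\<close>. Modulo the variables outside \<open>F\<close> these are
  \<open>n > card F\<close> polynomials in \<open>card F\<close> variables, hence algebraically
  dependent. Eliminating \<open>y 0\<close>, \<open>y 1\<close> and so on along the chain turns the
  relation into a nonzero constant in \<open>q n\<close>.\<close>

lemma chain_length_le:
  fixes q :: "nat \<Rightarrow> 'k::field mpoly set"
  assumes F: "finite F" "F \<subseteq> V" and q: "\<And>i. i \<le> n \<Longrightarrow> poly_prime V (q i)" "\<And>i. i < n \<Longrightarrow> q i \<subset> q (Suc i)"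
    and ker: "\<And>p. p \<in> PV V \<Longrightarrow> restr F p = 0 \<Longrightarrow> p \<in> q 0"
  shows "n \<le> card F"
proof (rule ccontr)
  assume "\<not> n \<le> card F"
  then have n: "card F < n" by simp
  have q0: "q 0 \<subseteq> q i" if "i \<le> n" for i
    using that
  proof (induction i)
    case (Suc i)
    then show ?case using q(2)[of i] by auto
  qed simp
  have "\<forall>i. \<exists>z. i < n \<longrightarrow> z \<in> q (Suc i) - q i" using q(2) by blast
  then obtain z where z: "\<And>i. i < n \<Longrightarrow> z i \<in> q (Suc i) - q i" by metis
  have zV: "z i \<in> PV V" if "i < n" for i using poly_primeD(1)[OF q(1)[of "Suc i"]] z[OF that] that by auto
  \<comment> \<open>Dropping the variables outside \<open>F\<close> changes \<open>z i\<close> by an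
    element of \<open>q 0\<close>, which is contained in every member of the chain.\<close>
  define y where "y i = restr F (z i)" for i
  have diff: "z i - y i \<in> q 0" if "i < n" for i
    by (rule ker) (use zV[OF that] in \<open>auto simp: y_def\<close>)
  have yF: "y i \<in> PV F" for i by (simp add: y_def restr_in_PV_self)
  have yV: "y i \<in> PV V" for i by (rule PV_mono[OF F(2) yF])
  have y1: "y i \<in> q (Suc i)" if i: "i < n" for i
    using poly_primeD(7)[OF q(1)[of "Suc i"], of "z i" "z i - y i"] z[OF i] diff[OF i] q0[of "Suc i"] i by auto
  have y2: "y i \<notin> q i" if i: "i < n" for i
    using poly_primeD(3)[OF q(1)[of i], of "y i" "z i - y i"] z[OF i] diff[OF i] q0[of i] i by auto
  obtain E c where E: "finite E" "E \<noteq> {}" "E \<subseteq> extensional {..<n}" "\<And>a. a \<in> E \<Longrightarrow> c a \<noteq> (0::'k)"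
    "(\<Sum>a\<in>E. single 0 (c a) * (\<Prod>i<n. y i ^ a i)) = 0"
    by - (rule algebraic_dependence[where y = y, OF F(1) n], rule yF, rule that; assumption)
  have "\<exists>E'. E' \<subseteq> E \<and> E' \<noteq> {} \<and> (\<forall>a\<in>E'. \<forall>b\<in>E'. (\<forall>i\<in>{j..<n}. a i = b i) \<longrightarrow> a = b) \<and>
     (\<Sum>a\<in>E'. single 0 (c a) * (\<Prod>i\<in>{j..<n}. y i ^ a i)) \<in> q j" if "j \<le> n" for j
    using that
  proof (induction j)
    case 0
    have "a = b" if "a \<in> E" "b \<in> E" "\<forall>i\<in>{0..<n}. a i = b i" for a b
      by (rule extensionalityI[of _ "{..<n}"]) (use that E(3) in auto)
    moreover have "(\<Sum>a\<in>E. single 0 (c a) * (\<Prod>i\<in>{0..<n}. y i ^ a i)) \<in> q 0"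
      unfolding atLeast0LessThan E(5) by (rule poly_primeD(2)[OF q(1)]) simp
    ultimately show ?case using E(2) by blast
  next
    case (Suc j)
    from Suc.IH[OF Suc_leD[OF Suc.prems]] obtain E' where E': "E' \<subseteq> E" "E' \<noteq> {}"
      and inj: "\<forall>a\<in>E'. \<forall>b\<in>E'. (\<forall>i\<in>{j..<n}. a i = b i) \<longrightarrow> a = b"
      and rel: "(\<Sum>a\<in>E'. single 0 (c a) * (\<Prod>i\<in>{j..<n}. y i ^ a i)) \<in> q j"
      by (elim exE conjE)
    have inj': "\<And>a b. a \<in> E' \<Longrightarrow> b \<in> E' \<Longrightarrow> (\<forall>i\<in>{j..<n}. a i = b i) \<Longrightarrow> a = b" using inj by blast
    have j: "j < n" using Suc.prems by simp
    have q': "poly_prime V (q j)" "poly_prime V (q (Suc j))" "q j \<subseteq> q (Suc j)" using q(1)[of j] q(1)[of "Suc j"] q(2)[OF j] j by auto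
    have "\<exists>E''. E'' \<subseteq> E' \<and> E'' \<noteq> {} \<and> (\<forall>a\<in>E''. \<forall>b\<in>E''. (\<forall>i\<in>{Suc j..<n}. a i = b i) \<longrightarrow> a = b) \<and>
      (\<Sum>a\<in>E''. single 0 (c a) * (\<Prod>i\<in>{Suc j..<n}. y i ^ a i)) \<in> q (Suc j)"
    proof (rule chain_step[of V "q j" "q (Suc j)" j n y E' c])
      fix i assume "i < n"
      show "y i \<in> PV V" by (rule yV)
    next
      fix a b assume "a \<in> E'" "b \<in> E'" "\<forall>i\<in>{j..<n}. a i = b i"
      then show "a = b" by (rule inj')
    next
      fix E'' assume "E'' \<subseteq> E'" "E'' \<noteq> {}" "\<forall>a\<in>E''. \<forall>b\<in>E''. (\<forall>i\<in>{Suc j..<n}. a i = b i) \<longrightarrow> a = b"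
        "(\<Sum>a\<in>E''. single 0 (c a) * (\<Prod>i\<in>{Suc j..<n}. y i ^ a i)) \<in> q (Suc j)"
      then show ?thesis by blast
    qed (fact q' j y2[OF j] y1[OF j] finite_subset[OF E'(1) E(1)] E'(2) rel)+
    then show ?case using E'(1) by (elim exE) (rule exI, erule conjE, rule conjI, erule subset_trans, assumption+)
  qed
  \<comment> \<open>For \<open>j = n\<close> no exponents are left to compare, so the injectivity
    condition makes \<open>E'\<close> a singleton and the relation a single constant.\<close>
  from this[OF order_refl] obtain E' where E': "E' \<subseteq> E" "E' \<noteq> {}" "\<forall>a\<in>E'. \<forall>b\<in>E'. a = b"
    "(\<Sum>a\<in>E'. single 0 (c a)) \<in> q n" by (elim exE conjE) simp
  from E'(2) obtain a where "a \<in> E'" by blast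
  then have a: "E' = {a}" using E'(3) by blast
  then have "single 0 (inverse (c a)) * single 0 (c a) \<in> q n"
    using E'(4) by (intro poly_primeD(4)[OF q(1)]) auto
  then have "(1 :: 'k mpoly) \<in> q n" using E(4)[of a] E'(1) a by (simp add: mult_single)
  then show False using poly_primeD(5)[OF q(1)] by auto
qed

lemma krull_dim_le:
  assumes "\<And>n p. (\<And>i. i \<le> n \<Longrightarrow> primeideal (p i) R) \<Longrightarrow> (\<And>i. i < n \<Longrightarrow> p i \<subset> p (Suc i)) \<Longrightarrow> n \<le> d"
  shows "krull_dim R \<le> enat d"
  unfolding krull_dim_def by (rule SUP_least) (use assms in auto)

lemma (in poly_quotient) poly_prime_vimage:
  assumes "primeideal p S"
  shows "poly_prime V {x \<in> PV V. cls x \<in> p}"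
proof -
  interpret p: primeideal p S by fact
  have one: "\<one>\<^bsub>S\<^esub> \<notin> p" using p.I_notcarr p.one_imp_carrier by auto
  show ?thesis
    unfolding poly_prime_def
  proof (intro conjI ballI impI)
    show "0 \<in> {x \<in> PV V. cls x \<in> p}" using additive_subgroup.zero_closed[OF p.is_additive_subgroup] by (simp add: S_zero)
    show "1 \<notin> {x \<in> PV V. cls x \<in> p}" using one by (simp add: S_one)
    show "a + b \<in> {x \<in> PV V. cls x \<in> p}" if ab: "a \<in> {x \<in> PV V. cls x \<in> p}" "b \<in> {x \<in> PV V. cls x \<in> p}" for a b
    proof -
      have "cls a \<oplus>\<^bsub>S\<^esub> cls b \<in> p"
        by (rule additive_subgroup.a_closed[OF p.is_additive_subgroup]) (use ab in simp_all)
      moreover have "cls a \<oplus>\<^bsub>S\<^esub> cls b = cls (a + b)" by (rule S_add) (use ab in simp_all)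
      ultimately show ?thesis using ab by simp
    qed
    show "r * a \<in> {x \<in> PV V. cls x \<in> p}" if "r \<in> PV V" "a \<in> {x \<in> PV V. cls x \<in> p}" for r a
      using p.I_l_closed[of "cls a" "cls r"] that by (auto simp: S_mult)
    show "a \<in> {x \<in> PV V. cls x \<in> p} \<or> b \<in> {x \<in> PV V. cls x \<in> p}"
      if "a \<in> PV V" "b \<in> PV V" "a * b \<in> {x \<in> PV V. cls x \<in> p}" for a b
      using p.I_prime[of "cls a" "cls b"] that by (auto simp: S_mult)
  qed auto
qed

lemma poly_prime_primeideal:
  assumes "primeideal p (poly_ring TYPE('k::field) V)"
  shows "poly_prime V p"
proof -
  interpret p: primeideal p "poly_ring TYPE('k) V" by fact
  have one: "1 \<notin> p" using p.I_notcarr p.one_imp_carrier by auto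
  show ?thesis
    unfolding poly_prime_def
  proof (intro conjI ballI impI)
    show "p \<subseteq> PV V" by (rule p.a_subset)
    show "0 \<in> p" using additive_subgroup.zero_closed[OF p.is_additive_subgroup] by simp
    show "1 \<notin> p" by (fact one)
    show "a + b \<in> p" if "a \<in> p" "b \<in> p" for a b using additive_subgroup.a_closed[OF p.is_additive_subgroup, of a b] that by auto
    show "r * a \<in> p" if "r \<in> PV V" "a \<in> p" for r a using p.I_l_closed[of a r] that by auto
    show "a \<in> p \<or> b \<in> p" if "a \<in> PV V" "b \<in> PV V" "a * b \<in> p" for a b
      using p.I_prime[of a b] that by auto
  qed
qed

lemma restr_chain:
  assumes "finite F"
  obtains A where "A (0::nat) = F" "\<And>i. i < card F \<Longrightarrow> A (Suc i) \<subset> A i" "\<And>i. A i \<subseteq> F"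
proof -
  obtain f where f: "bij_betw f {0..<card F} F" using ex_bij_betw_nat_finite[OF assms] by blast
  show thesis
  proof (rule that[of "\<lambda>i. f ` {i..<card F}"])
    show "f ` {0..<card F} = F" using f by (simp add: bij_betw_def)
    show "f ` {Suc i..<card F} \<subset> f ` {i..<card F}" if i: "i < card F" for i
    proof -
      have "f i \<notin> f ` {Suc i..<card F}"
      proof
        assume "f i \<in> f ` {Suc i..<card F}"
        then obtain x where "x \<in> {Suc i..<card F}" "f i = f x" by auto
        then show False using inj_onD[OF bij_betw_imp_inj_on[OF f], of i x] i by auto
      qed
      moreover have "f i \<in> f ` {i..<card F}" using i by auto
      moreover have "f ` {Suc i..<card F} \<subseteq> f ` {i..<card F}" by auto
      ultimately show ?thesis by blast
    qed
    show "f ` {i..<card F} \<subseteq> F" for i using f by (auto simp: bij_betw_def)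
  qed
qed

lemma restr_mono_0: "A \<subseteq> B \<Longrightarrow> restr B p = 0 \<Longrightarrow> restr A p = 0"
  by (metis inf.absorb_iff1 restr_restr restr_zero)

text \<open>For the upper bound the kernel condition of \<open>chain_length_le\<close> is trivial,
  as restriction to \<open>V\<close> is the identity. For the lower bound the variables are set to
  zero one after the other.\<close>

lemma krull_dim_poly_ring:
  assumes V: "finite V"
  shows "krull_dim (poly_ring TYPE('k::field) V) = enat (card V)"
proof (rule antisym)
  show "krull_dim (poly_ring TYPE('k) V) \<le> enat (card V)"
  proof (rule krull_dim_le)
    fix n and p :: "nat \<Rightarrow> 'k mpoly set"
    assume p: "\<And>i. i \<le> n \<Longrightarrow> primeideal (p i) (poly_ring TYPE('k) V)" "\<And>i. i < n \<Longrightarrow> p i \<subset> p (Suc i)"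
    show "n \<le> card V"
      by (rule chain_length_le[of V V n p])
         (use V p(2) poly_primeD(2)[OF poly_prime_primeideal[OF p(1)[of 0]]] in
           \<open>auto simp: in_PV_iff_restr intro!: poly_prime_primeideal p(1)\<close>)
  qed
  obtain A where A: "A (0::nat) = V" "\<And>i. i < card V \<Longrightarrow> A (Suc i) \<subset> A i" "\<And>i. A i \<subseteq> V"
    using restr_chain[OF V] by metis
  show "enat (card V) \<le> krull_dim (poly_ring TYPE('k) V)"
  proof (rule krull_dim_ge[OF cring_poly_ring, where \<rho> = "\<lambda>i. restr (A i)"])
    fix i assume i: "i < card V"
    show "restr (A (Suc i)) x = 0" if "restr (A i) x = 0" for x :: "'k mpoly"
      using A(2)[OF i] that restr_mono_0 by blast
    obtain v where "v \<in> A i - A (Suc i)" using A(2)[OF i] by auto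
    then show "\<exists>x\<in>carrier (poly_ring TYPE('k) V). restr (A i) x \<noteq> 0 \<and> restr (A (Suc i)) x = 0"
      using A(3)[of i] by (intro bexI[of _ "indet v"]) (auto simp: restr_indet)
  qed (simp add: hom_to_type_def)
qed

text \<open>The first prime of a chain contains a variable of every nonface. The vertices whose
  variables it misses therefore form a face \<open>F\<close>, and it contains all variables outside
  \<open>F\<close>, so the chain has length at most \<open>card F\<close>. Conversely, deleting the
  vertices of a largest face one by one gives a chain.\<close>

lemma (in SR) krull_dim_S: "krull_dim S = enat (Max (card ` \<Delta>))"
proof (rule antisym)
  show "krull_dim S \<le> enat (Max (card ` \<Delta>))"
  proof (rule krull_dim_le)
    fix n and p :: "nat \<Rightarrow> 'k mpoly set set"
    assume p: "\<And>i. i \<le> n \<Longrightarrow> primeideal (p i) S" "\<And>i. i < n \<Longrightarrow> p i \<subset> p (Suc i)"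
    define q where "q i = {x \<in> PV V. cls x \<in> p i}" for i
    have q: "poly_prime V (q i)" if "i \<le> n" for i unfolding q_def by (rule poly_prime_vimage[OF p(1)[OF that]])
    have pS: "p i \<subseteq> carrier S" if "i \<le> n" for i
    proof -
      interpret primeideal "p i" S by (rule p(1)[OF that])
      show ?thesis by (rule a_subset)
    qed
    define F where "F = {v \<in> V. indet v \<notin> q 0}"
    have I: "x \<in> q 0" if "x \<in> I" for x
    proof -
      interpret primeideal "p 0" S by (rule p(1)) simp
      have "cls x = \<zero>\<^bsub>S\<^esub>" using that by (simp add: S_eq_zero_iff)
      then show ?thesis using additive_subgroup.zero_closed[OF is_additive_subgroup] that I_closed(1) by (auto simp: q_def)
    qed
    have "F \<in> \<Delta>"
    proof (rule ccontr)
      assume "F \<notin> \<Delta>"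
      then have "vmon F \<in> q 0" by (intro I nonface_in_I) (auto simp: F_def)
      then show False using poly_primeD(8)[OF q[of 0], of F indet] fin_V by (auto simp: F_def)
    qed
    moreover have "n \<le> card F"
    proof (rule chain_length_le[of F V n q])
      show "p \<in> q 0" if "p \<in> PV V" "restr F p = 0" for p
        using that
      proof (induction rule: ker_restr_induct)
        case (mult u r)
        then have "indet u \<in> q 0" by (auto simp: F_def)
        then show ?case using poly_primeD(4)[OF q[of 0] mult(2), of "indet u"] by (simp add: mult.commute)
      qed (use poly_primeD(2,3)[OF q[of 0]] in auto)
      show "q i \<subset> q (Suc i)" if i: "i < n" for i
      proof -
        obtain X where X: "X \<in> p (Suc i)" "X \<notin> p i" using p(2)[OF i] by auto
        then obtain x where "x \<in> PV V" "X = cls x" using pS[of "Suc i"] i by (auto elim: in_S_E)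
        then show ?thesis using X p(2)[OF i] by (auto simp: q_def)
      qed
    qed (use q fin_V in \<open>auto simp: F_def\<close>)
    ultimately show "n \<le> Max (card ` \<Delta>)" using fin_\<Delta> by (meson Max_ge finite_imageI image_eqI le_trans)
  qed
  have "Max (card ` \<Delta>) \<in> card ` \<Delta>" using fin_\<Delta> empty_face by (intro Max_in) auto
  then obtain F where F: "F \<in> \<Delta>" "Max (card ` \<Delta>) = card F" by auto
  obtain A where A: "A (0::nat) = F" "\<And>i. i < card F \<Longrightarrow> A (Suc i) \<subset> A i" "\<And>i. A i \<subseteq> F"
    using restr_chain[OF fin_face[OF F(1)]] by metis
  have A\<Delta>: "A i \<in> \<Delta>" for i using A(3) F(1) face_sub by blast
  show "enat (Max (card ` \<Delta>)) \<le> krull_dim S"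
    unfolding F(2)
  proof (rule krull_dim_ge[OF cring_S, where \<rho> = "\<lambda>i. rho (A i)"])
    fix i assume i: "i < card F"
    show "rho (A (Suc i)) x = 0" if "rho (A i) x = 0" "x \<in> carrier S" for x
      using restr_mono_0[OF psubset_imp_subset[OF A(2)[OF i]]] that by (auto elim!: in_S_E simp: rho_cls A\<Delta>)
    obtain v where "v \<in> A i - A (Suc i)" using A(2)[OF i] by auto
    moreover from this have "v \<in> V" using A\<Delta> sub_V by blast
    ultimately show "\<exists>x\<in>carrier S. rho (A i) x \<noteq> 0 \<and> rho (A (Suc i)) x = 0"
      by (intro bexI[of _ "cls (indet v)"]) (auto simp: restr_indet rho_cls A\<Delta>)
  qed (simp add: rho_hom A\<Delta>)
qed

section \<open>Free modules, quotients and traces\<close>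

lemma free_module_simps:
  "f \<in> carrier (free_module R B) \<longleftrightarrow> range f \<subseteq> carrier R \<and> finite {b. f b \<noteq> \<zero>\<^bsub>R\<^esub>} \<and> {b. f b \<noteq> \<zero>\<^bsub>R\<^esub>} \<subseteq> B"
  "f \<oplus>\<^bsub>free_module R B\<^esub> g = (\<lambda>b. f b \<oplus>\<^bsub>R\<^esub> g b)"
  "r \<odot>\<^bsub>free_module R B\<^esub> f = (\<lambda>b. r \<otimes>\<^bsub>R\<^esub> f b)"
  "\<zero>\<^bsub>free_module R B\<^esub> = (\<lambda>b. \<zero>\<^bsub>R\<^esub>)"
  by (simp_all add: free_module_def)

lemma module_free_module:
  fixes R :: "('a, 'r) ring_scheme"
  assumes "cring R"
  shows "Module.module R (free_module R B)"
proof -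
  interpret cring R by fact
  have val: "f b \<in> carrier R" if "f \<in> carrier (free_module R B)" for f :: "'b \<Rightarrow> 'a" and b
    using that by (auto simp: free_module_simps)
  have closed: "(\<lambda>b. h (f b) (g b)) \<in> carrier (free_module R B)"
    if "f \<in> carrier (free_module R B)" "g \<in> carrier (free_module R B)" "h \<zero>\<^bsub>R\<^esub> \<zero>\<^bsub>R\<^esub> = \<zero>\<^bsub>R\<^esub>"
      "\<And>x y. x \<in> carrier R \<Longrightarrow> y \<in> carrier R \<Longrightarrow> h x y \<in> carrier R" for f g :: "'b \<Rightarrow> 'a" and h
  proof -
    have "{b. h (f b) (g b) \<noteq> \<zero>\<^bsub>R\<^esub>} \<subseteq> {b. f b \<noteq> \<zero>\<^bsub>R\<^esub>} \<union> {b. g b \<noteq> \<zero>\<^bsub>R\<^esub>}" using that(3) by auto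
    moreover have "finite ({b. f b \<noteq> \<zero>\<^bsub>R\<^esub>} \<union> {b. g b \<noteq> \<zero>\<^bsub>R\<^esub>})" "{b. f b \<noteq> \<zero>\<^bsub>R\<^esub>} \<union> {b. g b \<noteq> \<zero>\<^bsub>R\<^esub>} \<subseteq> B"
      using that(1,2) by (auto simp: free_module_simps)
    ultimately show ?thesis
      unfolding free_module_simps using that(4)[OF val[OF that(1)] val[OF that(2)]]
      by (meson finite_subset image_subsetI order_trans)
  qed
  show ?thesis
  proof (rule Module.moduleI[OF assms])
    show "abelian_group (free_module R B)"
    proof (rule abelian_groupI)
      fix f :: "'b \<Rightarrow> 'a" assume f: "f \<in> carrier (free_module R B)"
      show "\<exists>g\<in>carrier (free_module R B). g \<oplus>\<^bsub>free_module R B\<^esub> f = \<zero>\<^bsub>free_module R B\<^esub>"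
        using closed[OF f f, of "\<lambda>x y. \<ominus>\<^bsub>R\<^esub> x"] val[OF f]
        by (intro bexI[of _ "\<lambda>b. \<ominus>\<^bsub>R\<^esub> f b"]) (auto simp: free_module_simps(2,4) l_neg)
    next
      fix f g :: "'b \<Rightarrow> 'a" assume f: "f \<in> carrier (free_module R B)" and g: "g \<in> carrier (free_module R B)"
      show "f \<oplus>\<^bsub>free_module R B\<^esub> g \<in> carrier (free_module R B)"
        using closed[OF f g, of "\<lambda>x y. x \<oplus>\<^bsub>R\<^esub> y"] by (simp add: free_module_simps(2))
      show "f \<oplus>\<^bsub>free_module R B\<^esub> g = g \<oplus>\<^bsub>free_module R B\<^esub> f"
        using val[OF f] val[OF g] by (simp add: free_module_simps(2) a_comm)
    qed (auto simp: free_module_simps(2,4) val a_assoc, auto simp: free_module_simps)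
    fix r :: 'a and f :: "'b \<Rightarrow> 'a"
    assume r: "r \<in> carrier R" and f: "f \<in> carrier (free_module R B)"
    show "r \<odot>\<^bsub>free_module R B\<^esub> f \<in> carrier (free_module R B)"
      using closed[OF f f, of "\<lambda>x y. r \<otimes>\<^bsub>R\<^esub> x"] r by (simp add: free_module_simps(3))
  qed (auto simp: free_module_simps(2,3) val l_distr r_distr m_assoc)
qed

lemma unit_vec_closed: "cring R \<Longrightarrow> b \<in> B \<Longrightarrow> unit_vec R b \<in> carrier (free_module R B)"
proof -
  assume "cring R" and b: "b \<in> B"
  then interpret cring R by simp
  have "{c. unit_vec R b c \<noteq> \<zero>\<^bsub>R\<^esub>} \<subseteq> {b}" by (auto simp: unit_vec_def)
  then show ?thesis using b finite_subset[of _ "{b}"] by (auto simp: free_module_simps unit_vec_def)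
qed

lemma free_module_induct [consumes 2, case_names zero unit add smult]:
  fixes R :: "('a, 'r) ring_scheme"
  assumes R: "cring R" and f: "f \<in> carrier (free_module R B)"
    and zero: "P (\<lambda>_. \<zero>\<^bsub>R\<^esub>)" and unit: "\<And>b. b \<in> B \<Longrightarrow> P (unit_vec R b)"
    and add: "\<And>f g. f \<in> carrier (free_module R B) \<Longrightarrow> g \<in> carrier (free_module R B) \<Longrightarrow> P f \<Longrightarrow> P g \<Longrightarrow> P (\<lambda>b. f b \<oplus>\<^bsub>R\<^esub> g b)"
    and smult: "\<And>r f. r \<in> carrier R \<Longrightarrow> f \<in> carrier (free_module R B) \<Longrightarrow> P f \<Longrightarrow> P (\<lambda>b. r \<otimes>\<^bsub>R\<^esub> f b)"
  shows "P f"
proof -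
  interpret cring R by fact
  interpret F: Module.module R "free_module R B" by (rule module_free_module[OF R])
  have "\<forall>f\<in>carrier (free_module R B). {b. f b \<noteq> \<zero>\<^bsub>R\<^esub>} = X \<longrightarrow> P f" if "finite X" for X
    using that
  proof (induction X rule: finite_induct)
    case empty
    then show ?case using zero by (auto simp: fun_eq_iff[symmetric])
  next
    case (insert x X)
    show ?case
    proof (intro ballI impI)
      fix f :: "'b \<Rightarrow> 'a"
      assume f: "f \<in> carrier (free_module R B)" and supp: "{b. f b \<noteq> \<zero>\<^bsub>R\<^esub>} = insert x X"
      have val: "f b \<in> carrier R" for b using f by (auto simp: free_module_simps)
      have x: "x \<in> B" using f supp by (auto simp: free_module_simps)
      have g: "f(x := \<zero>\<^bsub>R\<^esub>) \<in> carrier (free_module R B)"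
        using f by (auto simp: free_module_simps intro: rev_finite_subset)
      have u: "(\<lambda>b. f x \<otimes>\<^bsub>R\<^esub> unit_vec R x b) \<in> carrier (free_module R B)"
        using F.smult_closed[OF val unit_vec_closed[OF R x]] by (simp add: free_module_simps(3))
      have "{b. (f(x := \<zero>\<^bsub>R\<^esub>)) b \<noteq> \<zero>\<^bsub>R\<^esub>} = {b. f b \<noteq> \<zero>\<^bsub>R\<^esub>} - {x}" by auto
      also have "\<dots> = X" using supp insert.hyps by auto
      finally have "P (f(x := \<zero>\<^bsub>R\<^esub>))" using insert.IH g by blast
      moreover have "P (\<lambda>b. f x \<otimes>\<^bsub>R\<^esub> unit_vec R x b)"
        by (rule smult[OF val unit_vec_closed[OF R x] unit[OF x]])
      ultimately have "P (\<lambda>b. (f(x := \<zero>\<^bsub>R\<^esub>)) b \<oplus>\<^bsub>R\<^esub> (f x \<otimes>\<^bsub>R\<^esub> unit_vec R x b))"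
        by (intro add g u)
      also have "(\<lambda>b. (f(x := \<zero>\<^bsub>R\<^esub>)) b \<oplus>\<^bsub>R\<^esub> (f x \<otimes>\<^bsub>R\<^esub> unit_vec R x b)) = f"
        using val by (auto simp: unit_vec_def)
      finally show "P f" .
    qed
  qed
  then show ?thesis using f by (auto simp: free_module_simps)
qed

lemma submodule_gen_submodule:
  assumes "Module.module R M" "X \<subseteq> carrier M"
  shows "submodule (submodule_gen R M X) R M"
proof -
  interpret Module.module R M by fact
  have ne: "{N. submodule N R M \<and> X \<subseteq> N} \<noteq> {}" using carrier_is_submodule assms(2) by auto
  have zero: "\<zero>\<^bsub>M\<^esub> \<in> N" if "submodule N R M" for N
    using submodule.axioms(1)[OF that] subgroup.one_closed by fastforce
  show ?thesis
  proof (rule submoduleI)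
    show "submodule_gen R M X \<subseteq> carrier M"
      unfolding submodule_gen_def using carrier_is_submodule assms(2) by blast
  qed (auto simp: submodule_gen_def zero dest: submoduleE)
qed

lemma submodule_gen_self: "X \<subseteq> submodule_gen R M X"
  unfolding submodule_gen_def by auto

lemma submodule_gen_minimal: "submodule N R M \<Longrightarrow> X \<subseteq> N \<Longrightarrow> submodule_gen R M X \<subseteq> N"
  unfolding submodule_gen_def by auto

section \<open>Quotient modules\<close>

locale quot_module = Module.module R M for R :: "('a, 'r) ring_scheme" and M :: "('a, 'b, 'm) module_scheme" +
  fixes N :: "'b set"
  assumes submod: "submodule N R M"
begin

sublocale N: abelian_subgroup N M
  using submodule.axioms(1)[OF submod] abelian_group_axioms
  by (intro abelian_subgroupI3 additive_subgroupI)

abbreviation "Q \<equiv> quotient_module M N"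

lemma carrier_Q: "carrier Q = (\<lambda>x. N +>\<^bsub>M\<^esub> x) ` carrier M"
  by (auto simp: quotient_module_def A_RCOSETS_def RCOSETS_def a_r_coset_def)

lemma Q_add: "x \<in> carrier M \<Longrightarrow> y \<in> carrier M \<Longrightarrow> (N +>\<^bsub>M\<^esub> x) \<oplus>\<^bsub>Q\<^esub> (N +>\<^bsub>M\<^esub> y) = N +>\<^bsub>M\<^esub> (x \<oplus>\<^bsub>M\<^esub> y)"
  by (simp add: quotient_module_def N.a_rcos_sum)

lemma Q_zero: "\<zero>\<^bsub>Q\<^esub> = N +>\<^bsub>M\<^esub> \<zero>\<^bsub>M\<^esub>"
  by (simp add: quotient_module_def a_coset_add_zero N.a_subset)

lemma coset_eqI: "x \<in> carrier M \<Longrightarrow> n \<in> N \<Longrightarrow> N +>\<^bsub>M\<^esub> (n \<oplus>\<^bsub>M\<^esub> x) = N +>\<^bsub>M\<^esub> x"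
  by (metis N.a_subset N.a_subgroup a_rcosI a_repr_independence)

lemma Q_eq_zero: "x \<in> N \<Longrightarrow> N +>\<^bsub>M\<^esub> x = \<zero>\<^bsub>Q\<^esub>"
  using coset_eqI[of "\<zero>\<^bsub>M\<^esub>" x] N.a_subset by (auto simp: Q_zero)

lemma Q_smult: "r \<in> carrier R \<Longrightarrow> x \<in> carrier M \<Longrightarrow> r \<odot>\<^bsub>Q\<^esub> (N +>\<^bsub>M\<^esub> x) = N +>\<^bsub>M\<^esub> (r \<odot>\<^bsub>M\<^esub> x)"
proof -
  assume r: "r \<in> carrier R" and x: "x \<in> carrier M"
  have "N +>\<^bsub>M\<^esub> (r \<odot>\<^bsub>M\<^esub> y) = N +>\<^bsub>M\<^esub> (r \<odot>\<^bsub>M\<^esub> x)" if "y \<in> N +>\<^bsub>M\<^esub> x" for y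
  proof -
    obtain n where n: "n \<in> N" "y = n \<oplus>\<^bsub>M\<^esub> x" using \<open>y \<in> _\<close> by (auto simp: a_r_coset_def r_coset_def)
    then show ?thesis
      using coset_eqI[of "r \<odot>\<^bsub>M\<^esub> x" "r \<odot>\<^bsub>M\<^esub> n"] r x N.a_subset submodule.smult_closed[OF submod]
      by (auto simp: smult_r_distr subset_iff)
  qed
  moreover have "x \<in> N +>\<^bsub>M\<^esub> x" using x by (rule N.a_rcos_self)
  ultimately have "(\<Union>y\<in>N +>\<^bsub>M\<^esub> x. N +>\<^bsub>M\<^esub> (r \<odot>\<^bsub>M\<^esub> y)) = N +>\<^bsub>M\<^esub> (r \<odot>\<^bsub>M\<^esub> x)"
    using UN_constant_eq by blast
  then show ?thesis by (simp add: quotient_module_def)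
qed

lemma module_Q: "Module.module R Q"
proof (rule Module.moduleI)
  show "cring R" by (rule R.cring_axioms)
  show "abelian_group Q"
  proof (rule abelian_groupI)
    fix X assume "X \<in> carrier Q"
    then obtain x where "x \<in> carrier M" "X = N +>\<^bsub>M\<^esub> x" by (auto simp: carrier_Q)
    then show "\<exists>Y\<in>carrier Q. Y \<oplus>\<^bsub>Q\<^esub> X = \<zero>\<^bsub>Q\<^esub>"
      by (intro bexI[of _ "N +>\<^bsub>M\<^esub> (\<ominus>\<^bsub>M\<^esub> x)"]) (auto simp: carrier_Q Q_add Q_zero M.l_neg)
  next
    fix X Y assume "X \<in> carrier Q" "Y \<in> carrier Q"
    then show "X \<oplus>\<^bsub>Q\<^esub> Y = Y \<oplus>\<^bsub>Q\<^esub> X" by (auto simp: carrier_Q Q_add M.a_comm)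
  qed (auto simp: carrier_Q Q_add Q_zero M.a_assoc)
  fix X assume "X \<in> carrier Q"
  then obtain x where "x \<in> carrier M" and "X = N +>\<^bsub>M\<^esub> x" by (auto simp: carrier_Q)
  then show "\<one>\<^bsub>R\<^esub> \<odot>\<^bsub>Q\<^esub> X = X" by (simp add: Q_smult)
next
  fix a X assume a: "a \<in> carrier R" and "X \<in> carrier Q"
  then obtain x where x: "x \<in> carrier M" and X: "X = N +>\<^bsub>M\<^esub> x" by (auto simp: carrier_Q)
  show "a \<odot>\<^bsub>Q\<^esub> X \<in> carrier Q" using a x by (simp add: X Q_smult) (simp add: carrier_Q)
  show "(a \<oplus>\<^bsub>R\<^esub> b) \<odot>\<^bsub>Q\<^esub> X = a \<odot>\<^bsub>Q\<^esub> X \<oplus>\<^bsub>Q\<^esub> b \<odot>\<^bsub>Q\<^esub> X" if "b \<in> carrier R" for b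
    using a x that by (simp add: X Q_smult Q_add smult_l_distr)
  show "(a \<otimes>\<^bsub>R\<^esub> b) \<odot>\<^bsub>Q\<^esub> X = a \<odot>\<^bsub>Q\<^esub> (b \<odot>\<^bsub>Q\<^esub> X)" if "b \<in> carrier R" for b
    using a x that by (simp add: X Q_smult smult_assoc1)
  show "a \<odot>\<^bsub>Q\<^esub> (X \<oplus>\<^bsub>Q\<^esub> Y) = a \<odot>\<^bsub>Q\<^esub> X \<oplus>\<^bsub>Q\<^esub> a \<odot>\<^bsub>Q\<^esub> Y" if "Y \<in> carrier Q" for Y
  proof -
    obtain y where y: "y \<in> carrier M" and Y: "Y = N +>\<^bsub>M\<^esub> y" using \<open>Y \<in> _\<close> by (auto simp: carrier_Q)
    show ?thesis using a x y by (simp add: X Y Q_smult Q_add smult_r_distr)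
  qed
qed

end

lemma quot_module_free:
  assumes "cring R" "X \<subseteq> carrier (free_module R B)"
  shows "quot_module R (free_module R B) (submodule_gen R (free_module R B) X)"
  by (intro quot_module.intro quot_module_axioms.intro module_free_module submodule_gen_submodule assms)

section \<open>Homomorphisms and the trace ideal\<close>

lemma module_homD:
  assumes "f \<in> module_hom R M N"
  shows "x \<in> carrier M \<Longrightarrow> f x \<in> carrier N"
    "x \<in> carrier M \<Longrightarrow> y \<in> carrier M \<Longrightarrow> f (x \<oplus>\<^bsub>M\<^esub> y) = f x \<oplus>\<^bsub>N\<^esub> f y"
    "r \<in> carrier R \<Longrightarrow> x \<in> carrier M \<Longrightarrow> f (r \<odot>\<^bsub>M\<^esub> x) = r \<odot>\<^bsub>N\<^esub> f x"
  using assms by (auto simp: module_hom_def)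

lemma module_homI:
  assumes "\<And>x. x \<in> carrier M \<Longrightarrow> f x \<in> carrier N"
    "\<And>x y. x \<in> carrier M \<Longrightarrow> y \<in> carrier M \<Longrightarrow> f (x \<oplus>\<^bsub>M\<^esub> y) = f x \<oplus>\<^bsub>N\<^esub> f y"
    "\<And>r x. r \<in> carrier R \<Longrightarrow> x \<in> carrier M \<Longrightarrow> f (r \<odot>\<^bsub>M\<^esub> x) = r \<odot>\<^bsub>N\<^esub> f x"
    "Module.module R M"
  shows "restrict f (carrier M) \<in> module_hom R M N"
proof -
  interpret Module.module R M by fact
  show ?thesis using assms(1-3) by (auto simp: module_hom_def)
qed

lemma regular_module_simps [simp]:
  "carrier (regular_module R) = carrier R" "add (regular_module R) = add R"
  "zero (regular_module R) = zero R" "smult (regular_module R) = monoid.mult R"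
  by (simp_all add: regular_module_def)

lemma trace_ideal_zero: "\<zero>\<^bsub>R\<^esub> \<in> trace_ideal R M" if "cring R"
proof -
  interpret cring R by fact
  show ?thesis unfolding trace_ideal_def by (intro CollectI exI[of _ "{}"]) simp
qed

text \<open>The definition of the trace admits one argument per homomorphism. If \<open>f\<close>
  already occurs in the sum, \<open>m\<close> is added to the argument of \<open>f\<close>;
  otherwise \<open>f\<close> becomes a new summand.\<close>

lemma trace_ideal_add_hom:
  assumes M: "Module.module R M" and t: "t \<in> trace_ideal R M"
    and f: "f \<in> module_hom R M (regular_module R)" and m: "m \<in> carrier M"
  shows "t \<oplus>\<^bsub>R\<^esub> f m \<in> trace_ideal R M"
proof -
  interpret Module.module R M by fact
  obtain A x where A: "finite A" "A \<subseteq> module_hom R M (regular_module R)" "x \<in> A \<rightarrow> carrier M"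
    and t: "t = (\<Oplus>\<^bsub>R\<^esub>f\<in>A. f (x f))"
    using t by (auto simp: trace_ideal_def)
  have val: "g (x g) \<in> carrier R" if "g \<in> A" for g
    using module_homD(1)[of g R M "regular_module R" "x g"] A that by auto
  have fm: "f m \<in> carrier R" using module_homD(1)[OF f m] by simp
  define x' where "x' = (if f \<in> A then x(f := x f \<oplus>\<^bsub>M\<^esub> m) else x(f := m))"
  have "(\<Oplus>\<^bsub>R\<^esub>g\<in>insert f A. g (x' g)) = t \<oplus>\<^bsub>R\<^esub> f m"
  proof -
    have fin: "finite (A - {f})" using A by simp
    have rest: "(\<Oplus>\<^bsub>R\<^esub>g\<in>A - {f}. g (x' g)) = (\<Oplus>\<^bsub>R\<^esub>g\<in>A - {f}. g (x g))"
      by (rule R.finsum_cong') (use val in \<open>auto simp: x'_def\<close>)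
    have vals: "(\<lambda>g. g (x g)) \<in> A - {f} \<rightarrow> carrier R" "(\<lambda>g. g (x' g)) \<in> A - {f} \<rightarrow> carrier R"
      using val by (auto simp: x'_def)
    have sum_closed: "(\<Oplus>\<^bsub>R\<^esub>g\<in>A - {f}. g (x g)) \<in> carrier R" using vals by simp
    have fx': "f (x' f) = (if f \<in> A then f (x f) \<oplus>\<^bsub>R\<^esub> f m else f m)"
      using module_homD(2)[OF f, of "x f" m] A m by (auto simp: x'_def)
    have "(\<Oplus>\<^bsub>R\<^esub>g\<in>insert f (A - {f}). g (x' g)) = f (x' f) \<oplus>\<^bsub>R\<^esub> (\<Oplus>\<^bsub>R\<^esub>g\<in>A - {f}. g (x g))"
      unfolding rest[symmetric] using fin vals fx' fm val by (intro R.finsum_insert) auto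
    moreover have "t = f (x f) \<oplus>\<^bsub>R\<^esub> (\<Oplus>\<^bsub>R\<^esub>g\<in>A - {f}. g (x g))" if "f \<in> A"
    proof -
      have "(\<Oplus>\<^bsub>R\<^esub>g\<in>insert f (A - {f}). g (x g)) = f (x f) \<oplus>\<^bsub>R\<^esub> (\<Oplus>\<^bsub>R\<^esub>g\<in>A - {f}. g (x g))"
        using fin vals val that by (intro R.finsum_insert) auto
      then show ?thesis using that by (simp add: t insert_absorb)
    qed
    moreover have "t = (\<Oplus>\<^bsub>R\<^esub>g\<in>A - {f}. g (x g))" if "f \<notin> A" using that by (simp add: t)
    moreover have "f \<in> A \<Longrightarrow> f (x f) \<in> carrier R" using val by simp
    ultimately show ?thesis using sum_closed fm by (auto simp: fx' R.a_ac)
  qed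
  moreover have "x' \<in> insert f A \<rightarrow> carrier M" using A(3) m by (simp add: x'_def Pi_iff)
  ultimately show ?thesis
    unfolding trace_ideal_def using A f by (intro CollectI exI[of _ "insert f A"] exI[of _ x']) auto
qed

lemma trace_ideal_hom:
  assumes M: "Module.module R M" and f: "f \<in> module_hom R M (regular_module R)" and m: "m \<in> carrier M"
  shows "f m \<in> trace_ideal R M"
proof -
  interpret Module.module R M by fact
  have "f m \<in> carrier R" using module_homD(1)[OF f m] by simp
  then show ?thesis
    using trace_ideal_add_hom[OF M trace_ideal_zero[OF R.cring_axioms] f m] by simp
qed

lemma trace_ideal_closed: "Module.module R M \<Longrightarrow> t \<in> trace_ideal R M \<Longrightarrow> t \<in> carrier R"
proof -
  assume "Module.module R M" "t \<in> trace_ideal R M"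
  then interpret Module.module R M by simp
  show "t \<in> carrier R"
    using \<open>t \<in> trace_ideal R M\<close> module_homD(1)[of _ R M "regular_module R"]
    by (auto simp: trace_ideal_def intro!: R.finsum_closed)
qed

lemma trace_ideal_induct [consumes 2, case_names zero add]:
  assumes M: "Module.module R M" and t: "t \<in> trace_ideal R M"
    and zero: "P \<zero>\<^bsub>R\<^esub>"
    and add: "\<And>t f m. t \<in> carrier R \<Longrightarrow> f \<in> module_hom R M (regular_module R) \<Longrightarrow> m \<in> carrier M \<Longrightarrow> P t \<Longrightarrow> P (t \<oplus>\<^bsub>R\<^esub> f m)"
  shows "P t"
proof -
  interpret Module.module R M by fact
  have *: "finite A \<Longrightarrow> A \<subseteq> module_hom R M (regular_module R) \<Longrightarrow> x \<in> A \<rightarrow> carrier M \<Longrightarrow> P (\<Oplus>\<^bsub>R\<^esub>f\<in>A. f (x f))" for A x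
  proof (induction A rule: finite_induct)
    case empty
    then show ?case by (simp add: zero)
  next
    case (insert f A)
    have val: "g (x g) \<in> carrier R" if "g \<in> insert f A" for g
      using module_homD(1)[of g R M "regular_module R" "x g"] insert.prems that by auto
    have "(\<Oplus>\<^bsub>R\<^esub>g\<in>insert f A. g (x g)) = (\<Oplus>\<^bsub>R\<^esub>g\<in>A. g (x g)) \<oplus>\<^bsub>R\<^esub> f (x f)"
      using insert.hyps val by (subst R.finsum_insert) (auto intro!: R.a_comm R.finsum_closed)
    then show ?case using insert val by (auto intro!: add R.finsum_closed)
  qed
  then show ?thesis using t by (auto simp: trace_ideal_def)
qed

lemma trace_ideal_add:
  assumes M: "Module.module R M" and s: "s \<in> trace_ideal R M" and t: "t \<in> trace_ideal R M"
  shows "s \<oplus>\<^bsub>R\<^esub> t \<in> trace_ideal R M"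
  using M t
proof (induction t rule: trace_ideal_induct)
  interpret Module.module R M by fact
  have sc: "s \<in> carrier R" by (rule trace_ideal_closed[OF M s])
  {
    case zero
    show ?case using s sc by simp
  next
    case (add t f m)
    have "f m \<in> carrier R" using module_homD(1)[OF add(2,3)] by simp
    then have "s \<oplus>\<^bsub>R\<^esub> (t \<oplus>\<^bsub>R\<^esub> f m) = (s \<oplus>\<^bsub>R\<^esub> t) \<oplus>\<^bsub>R\<^esub> f m" using sc add(1) by (simp add: R.a_assoc)
    then show ?case using trace_ideal_add_hom[OF M add(4,2,3)] by simp
  }
qed

lemma trace_ideal_mult:
  assumes M: "Module.module R M" and t: "t \<in> trace_ideal R M" and r: "r \<in> carrier R"
  shows "r \<otimes>\<^bsub>R\<^esub> t \<in> trace_ideal R M"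
  using M t
proof (induction t rule: trace_ideal_induct)
  interpret Module.module R M by fact
  {
    case zero
    show ?case using r trace_ideal_zero[OF R.cring_axioms] by simp
  next
    case (add t f m)
    have "f m \<in> carrier R" using module_homD(1)[OF add(2,3)] by simp
    then have "r \<otimes>\<^bsub>R\<^esub> (t \<oplus>\<^bsub>R\<^esub> f m) = (r \<otimes>\<^bsub>R\<^esub> t) \<oplus>\<^bsub>R\<^esub> f (r \<odot>\<^bsub>M\<^esub> m)"
      using r add(1) module_homD(3)[OF add(2) r add(3)] by (simp add: R.r_distr)
    then show ?case using trace_ideal_add_hom[OF M add(4,2)] r add(3) by simp
  }
qed

section \<open>Semilinear functionals on free modules\<close>

text \<open>The extension of \<open>g\<close> from the basis to the free module, with scalars acting
  through \<open>\<rho>\<close>. Semilinearity lets functionals on modules over the quotient ring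
  take their values in an ordinary polynomial type.\<close>

definition lin_ext :: "('a, 'r) ring_scheme \<Rightarrow> ('a \<Rightarrow> 'c) \<Rightarrow> ('b \<Rightarrow> 'c) \<Rightarrow> ('b \<Rightarrow> 'a) \<Rightarrow> 'c::comm_ring_1" where
  "lin_ext R \<rho> g f = (\<Sum>b | f b \<noteq> \<zero>\<^bsub>R\<^esub>. \<rho> (f b) * g b)"

context
  fixes R :: "('a, 'r) ring_scheme" and \<rho> :: "'a \<Rightarrow> 'c::comm_ring_1"
  assumes R: "cring R" and \<rho>: "hom_to_type R \<rho>"
begin

lemma lin_ext_superset:
  "finite X \<Longrightarrow> {b. f b \<noteq> \<zero>\<^bsub>R\<^esub>} \<subseteq> X \<Longrightarrow> lin_ext R \<rho> g f = (\<Sum>b\<in>X. \<rho> (f b) * g b)"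
  unfolding lin_ext_def
  by (rule sum.mono_neutral_left) (auto simp: hom_to_type_simps(4)[OF \<rho> R])

lemma lin_ext_add:
  assumes "f \<in> carrier (free_module R B)" "f' \<in> carrier (free_module R B)"
  shows "lin_ext R \<rho> g (f \<oplus>\<^bsub>free_module R B\<^esub> f') = lin_ext R \<rho> g f + lin_ext R \<rho> g f'"
proof -
  interpret cring R by (fact R)
  let ?X = "{b. f b \<noteq> \<zero>\<^bsub>R\<^esub>} \<union> {b. f' b \<noteq> \<zero>\<^bsub>R\<^esub>}"
  have fin: "finite ?X" and val: "f b \<in> carrier R" "f' b \<in> carrier R" for b
    using assms by (auto simp: free_module_simps)
  have "lin_ext R \<rho> g (f \<oplus>\<^bsub>free_module R B\<^esub> f') = (\<Sum>b\<in>?X. \<rho> (f b \<oplus>\<^bsub>R\<^esub> f' b) * g b)"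
    unfolding free_module_simps(2) by (rule lin_ext_superset[OF fin]) auto
  also have "\<dots> = (\<Sum>b\<in>?X. \<rho> (f b) * g b) + (\<Sum>b\<in>?X. \<rho> (f' b) * g b)"
    by (simp add: hom_to_type_simps(2)[OF \<rho>] val distrib_right sum.distrib)
  also have "(\<Sum>b\<in>?X. \<rho> (f b) * g b) = lin_ext R \<rho> g f"
    by (rule lin_ext_superset[OF fin, symmetric]) auto
  also have "(\<Sum>b\<in>?X. \<rho> (f' b) * g b) = lin_ext R \<rho> g f'"
    by (rule lin_ext_superset[OF fin, symmetric]) auto
  finally show ?thesis .
qed

lemma lin_ext_smult:
  assumes "f \<in> carrier (free_module R B)" "r \<in> carrier R"
  shows "lin_ext R \<rho> g (r \<odot>\<^bsub>free_module R B\<^esub> f) = \<rho> r * lin_ext R \<rho> g f"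
proof -
  interpret cring R by (fact R)
  let ?X = "{b. f b \<noteq> \<zero>\<^bsub>R\<^esub>}"
  have fin: "finite ?X" and val: "f b \<in> carrier R" for b using assms by (auto simp: free_module_simps)
  have "lin_ext R \<rho> g (r \<odot>\<^bsub>free_module R B\<^esub> f) = (\<Sum>b\<in>?X. \<rho> (r \<otimes>\<^bsub>R\<^esub> f b) * g b)"
    unfolding free_module_simps(3) by (rule lin_ext_superset[OF fin]) (use assms(2) in auto)
  also have "\<dots> = \<rho> r * (\<Sum>b\<in>?X. \<rho> (f b) * g b)"
    by (simp add: hom_to_type_simps(3)[OF \<rho>] val assms(2) sum_distrib_left mult.assoc)
  finally show ?thesis by (simp add: lin_ext_def)
qed

lemma lin_ext_unit: "lin_ext R \<rho> g (unit_vec R b) = g b"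
proof -
  have "lin_ext R \<rho> g (unit_vec R b) = (\<Sum>c\<in>{b}. \<rho> (unit_vec R b c) * g c)"
    by (rule lin_ext_superset) (auto simp: unit_vec_def)
  then show ?thesis by (simp add: unit_vec_def hom_to_type_simps(1)[OF \<rho>])
qed

lemma lin_ext_minus:
  assumes "f \<in> carrier (free_module R B)" "f' \<in> carrier (free_module R B)"
  shows "lin_ext R \<rho> g (f \<ominus>\<^bsub>free_module R B\<^esub> f') = lin_ext R \<rho> g f - lin_ext R \<rho> g f'"
proof -
  interpret Module.module R "free_module R B" by (rule module_free_module[OF R])
  have d: "f \<ominus>\<^bsub>free_module R B\<^esub> f' \<in> carrier (free_module R B)" using assms by simp
  have "(f \<ominus>\<^bsub>free_module R B\<^esub> f') \<oplus>\<^bsub>free_module R B\<^esub> f' = f"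
    using assms by (simp add: M.minus_eq M.a_assoc M.l_neg)
  then have "lin_ext R \<rho> g f = lin_ext R \<rho> g (f \<ominus>\<^bsub>free_module R B\<^esub> f') + lin_ext R \<rho> g f'"
    using lin_ext_add[OF d assms(2), of g] by simp
  then show ?thesis by simp
qed

text \<open>The kernel of a semilinear map is a submodule, so it contains the submodule generated by
  the relations as soon as it contains the relations.\<close>

lemma lin_ext_vanishes:
  assumes "X \<subseteq> carrier (free_module R B)" "\<And>x. x \<in> X \<Longrightarrow> lin_ext R \<rho> g x = 0"
    and f: "f \<in> submodule_gen R (free_module R B) X"
  shows "lin_ext R \<rho> g f = 0"
proof -
  interpret Module.module R "free_module R B" by (rule module_free_module[OF R])
  have zero: "lin_ext R \<rho> g \<zero>\<^bsub>free_module R B\<^esub> = 0"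
    using lin_ext_add[OF M.zero_closed M.zero_closed, of g] by simp
  have "submodule {f \<in> carrier (free_module R B). lin_ext R \<rho> g f = 0} R (free_module R B)"
  proof (rule submoduleI)
    fix f assume f: "f \<in> {f \<in> carrier (free_module R B). lin_ext R \<rho> g f = 0}"
    then show "\<ominus>\<^bsub>free_module R B\<^esub> f \<in> {f \<in> carrier (free_module R B). lin_ext R \<rho> g f = 0}"
      using lin_ext_minus[OF M.zero_closed, of f] by (auto simp: M.minus_eq zero)
  qed (auto simp: lin_ext_add lin_ext_smult zero)
  then show ?thesis using submodule_gen_minimal[of _ R _ X] assms by blast
qed

end

lemma (in quot_module) coset_eq_of_minus:
  assumes "x \<in> carrier M" "y \<in> carrier M" "x \<ominus>\<^bsub>M\<^esub> y \<in> N"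
  shows "N +>\<^bsub>M\<^esub> x = N +>\<^bsub>M\<^esub> y"
proof -
  have "(x \<ominus>\<^bsub>M\<^esub> y) \<oplus>\<^bsub>M\<^esub> y = x" using assms(1,2) by (simp add: M.minus_eq M.a_assoc M.l_neg)
  then show ?thesis using coset_eqI[OF assms(2,3)] by simp
qed

text \<open>The map induced on a module given by generators and relations. It is evaluated on a
  chosen representative, which is harmless once \<open>lin_ext\<close> vanishes on the
  relations.\<close>

definition q_ext :: "('a, 'r) ring_scheme \<Rightarrow> ('a \<Rightarrow> 'c) \<Rightarrow> ('b \<Rightarrow> 'c) \<Rightarrow> ('b \<Rightarrow> 'a) set \<Rightarrow> 'c::comm_ring_1" where
  "q_ext R \<rho> g X = lin_ext R \<rho> g (SOME f. f \<in> X)"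

context
  fixes R :: "('a, 'r) ring_scheme" and \<rho> :: "'a \<Rightarrow> 'c::comm_ring_1" and X :: "('b \<Rightarrow> 'a) set"
    and B :: "'b set" and g :: "'b \<Rightarrow> 'c"
  assumes R: "cring R" and \<rho>: "hom_to_type R \<rho>" and X: "X \<subseteq> carrier (free_module R B)"
    and van: "\<And>x. x \<in> X \<Longrightarrow> lin_ext R \<rho> g x = 0"
begin

interpretation q: quot_module R "free_module R B" "submodule_gen R (free_module R B) X"
  by (rule quot_module_free[OF R X])

lemma q_ext_coset:
  assumes f: "f \<in> carrier (free_module R B)"
  shows "q_ext R \<rho> g (submodule_gen R (free_module R B) X +>\<^bsub>free_module R B\<^esub> f) = lin_ext R \<rho> g f"
proof -
  let ?N = "submodule_gen R (free_module R B) X"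
  have "f \<in> ?N +>\<^bsub>free_module R B\<^esub> f" using f by (rule q.N.a_rcos_self)
  then have "(SOME h. h \<in> ?N +>\<^bsub>free_module R B\<^esub> f) \<in> ?N +>\<^bsub>free_module R B\<^esub> f"
    by (rule someI[where P = "\<lambda>h. h \<in> ?N +>\<^bsub>free_module R B\<^esub> f"])
  then obtain n where n: "n \<in> ?N" "(SOME h. h \<in> ?N +>\<^bsub>free_module R B\<^esub> f) = n \<oplus>\<^bsub>free_module R B\<^esub> f"
    unfolding a_r_coset_def r_coset_def by auto
  have nc: "n \<in> carrier (free_module R B)" using n(1) q.N.a_subset by auto
  show ?thesis
    unfolding q_ext_def n(2) lin_ext_add[OF R \<rho> nc f] using lin_ext_vanishes[OF R \<rho> X van n(1)] by simp
qed

lemma q_ext_add: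
  "x \<in> carrier q.Q \<Longrightarrow> y \<in> carrier q.Q \<Longrightarrow> q_ext R \<rho> g (x \<oplus>\<^bsub>q.Q\<^esub> y) = q_ext R \<rho> g x + q_ext R \<rho> g y"
  by (auto simp: q.carrier_Q q.Q_add q_ext_coset lin_ext_add[OF R \<rho>])

lemma q_ext_smult:
  "x \<in> carrier q.Q \<Longrightarrow> r \<in> carrier R \<Longrightarrow> q_ext R \<rho> g (r \<odot>\<^bsub>q.Q\<^esub> x) = \<rho> r * q_ext R \<rho> g x"
  by (auto simp: q.carrier_Q q.Q_smult q_ext_coset lin_ext_smult[OF R \<rho>])

end

text \<open>Kaehler differentials and exterior powers are both free modules modulo generated
  submodules, so one induction over generators serves both.\<close>

lemma quotient_free_induct [consumes 3, case_names zero unit add smult]: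
  fixes R :: "('a, 'r) ring_scheme" and X :: "('b \<Rightarrow> 'a) set"
  defines "F B \<equiv> free_module R B"
  defines "Q B \<equiv> quotient_module (F B) (submodule_gen R (F B) X)"
  assumes R: "cring R" and X: "X \<subseteq> carrier (F B)" and w: "w \<in> carrier (Q B)"
    and zero: "P \<zero>\<^bsub>Q B\<^esub>" and unit: "\<And>b. b \<in> B \<Longrightarrow> P (submodule_gen R (F B) X +>\<^bsub>F B\<^esub> unit_vec R b)"
    and add: "\<And>x y. x \<in> carrier (Q B) \<Longrightarrow> y \<in> carrier (Q B) \<Longrightarrow> P x \<Longrightarrow> P y \<Longrightarrow> P (x \<oplus>\<^bsub>Q B\<^esub> y)"
    and smult: "\<And>r x. r \<in> carrier R \<Longrightarrow> x \<in> carrier (Q B) \<Longrightarrow> P x \<Longrightarrow> P (r \<odot>\<^bsub>Q B\<^esub> x)"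
  shows "P w"
proof -
  interpret q: quot_module R "F B" "submodule_gen R (F B) X"
    unfolding F_def by (rule quot_module_free[OF R X[unfolded F_def]])
  note Q = Q_def[of B]
  obtain f where f: "f \<in> carrier (F B)" and w: "w = submodule_gen R (F B) X +>\<^bsub>F B\<^esub> f"
    using w by (auto simp: Q q.carrier_Q)
  have in_Q: "submodule_gen R (F B) X +>\<^bsub>F B\<^esub> f \<in> carrier (Q B)" if "f \<in> carrier (F B)" for f
    using that by (auto simp: Q q.carrier_Q)
  show ?thesis
    unfolding w using R f[unfolded F_def]
  proof (induction f rule: free_module_induct)
    case zero
    then show ?case using assms(6) by (simp add: Q q.Q_zero) (simp add: F_def free_module_simps(4))
  next
    case (unit b)
    then show ?case by (rule assms(7))
  next
    case (add f g)
    then have c: "f \<in> carrier (F B)" "g \<in> carrier (F B)" by (simp_all add: F_def)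
    show ?case using assms(8)[OF in_Q in_Q, OF c add(3,4)] q.Q_add[OF c]
      by (simp add: Q) (simp add: F_def free_module_simps(2))
  next
    case (smult r f)
    then have c: "f \<in> carrier (F B)" by (simp add: F_def)
    show ?case using assms(9)[OF smult(1) in_Q, OF c smult(3)] q.Q_smult[OF smult(1) c]
      by (simp add: Q) (simp add: F_def free_module_simps(3))
  qed
qed

section \<open>Differentials and exterior powers\<close>

locale kaehler_module = R?: cring R for R :: "('a, 'r) ring_scheme" (structure) +
  fixes K :: "'a set"
  assumes K_sub: "K \<subseteq> carrier R"
begin

abbreviation "F \<equiv> free_module R (carrier R)"
abbreviation "rel \<equiv> kaehler_relations R K"
abbreviation "\<Omega> \<equiv> kaehler R K"

interpretation F: Module.module R F
  by (rule module_free_module[OF R.cring_axioms])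

lemma u_closed [simp, intro]: "a \<in> carrier R \<Longrightarrow> unit_vec R a \<in> carrier F"
  by (rule unit_vec_closed[OF R.cring_axioms])

lemma rel_sub: "rel \<subseteq> carrier F"
  unfolding kaehler_relations_def Let_def using K_sub by (auto intro!: F.minus_closed F.smult_closed)

sublocale q: quot_module R F "submodule_gen R F rel"
  by (rule quot_module_free[OF R.cring_axioms rel_sub])

lemma \<Omega>_eq: "\<Omega> = q.Q"
  by (simp add: kaehler_def Let_def)

lemma module_\<Omega>: "Module.module R \<Omega>"
  unfolding \<Omega>_eq by (rule q.module_Q)

definition dd :: "'a \<Rightarrow> ('a \<Rightarrow> 'a) set" where
  "dd a = submodule_gen R F rel +>\<^bsub>F\<^esub> unit_vec R a"

lemma dd_closed [simp, intro]: "a \<in> carrier R \<Longrightarrow> dd a \<in> carrier \<Omega>"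
  by (auto simp: dd_def \<Omega>_eq q.carrier_Q)

lemma dd_add:
  assumes "a \<in> carrier R" "b \<in> carrier R"
  shows "dd (a \<oplus> b) = dd a \<oplus>\<^bsub>\<Omega>\<^esub> dd b"
proof -
  have "unit_vec R (a \<oplus> b) \<ominus>\<^bsub>F\<^esub> (unit_vec R a \<oplus>\<^bsub>F\<^esub> unit_vec R b) \<in> rel"
    unfolding kaehler_relations_def Let_def by (rule UnI1, rule UnI1, rule CollectI, rule exI[of _ a], rule exI[of _ b], intro conjI, rule refl, (rule assms)+)
  then have "unit_vec R (a \<oplus> b) \<ominus>\<^bsub>F\<^esub> (unit_vec R a \<oplus>\<^bsub>F\<^esub> unit_vec R b) \<in> submodule_gen R F rel"
    by (rule subsetD[OF submodule_gen_self])
  then show ?thesis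
    unfolding dd_def \<Omega>_eq using assms by (subst q.coset_eq_of_minus) (auto simp: q.Q_add)
qed

lemma dd_mult:
  assumes "a \<in> carrier R" "b \<in> carrier R"
  shows "dd (a \<otimes> b) = a \<odot>\<^bsub>\<Omega>\<^esub> dd b \<oplus>\<^bsub>\<Omega>\<^esub> b \<odot>\<^bsub>\<Omega>\<^esub> dd a"
proof -
  have "unit_vec R (a \<otimes> b) \<ominus>\<^bsub>F\<^esub> (a \<odot>\<^bsub>F\<^esub> unit_vec R b \<oplus>\<^bsub>F\<^esub> b \<odot>\<^bsub>F\<^esub> unit_vec R a) \<in> rel"
    unfolding kaehler_relations_def Let_def by (rule UnI1, rule UnI2, rule CollectI, rule exI[of _ a], rule exI[of _ b], intro conjI, rule refl, (rule assms)+)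
  then have "unit_vec R (a \<otimes> b) \<ominus>\<^bsub>F\<^esub> (a \<odot>\<^bsub>F\<^esub> unit_vec R b \<oplus>\<^bsub>F\<^esub> b \<odot>\<^bsub>F\<^esub> unit_vec R a) \<in> submodule_gen R F rel"
    by (rule subsetD[OF submodule_gen_self])
  then show ?thesis
    unfolding dd_def \<Omega>_eq using assms
    by (subst q.coset_eq_of_minus) (auto simp: q.Q_add q.Q_smult)
qed

lemma dd_const: "c \<in> K \<Longrightarrow> dd c = \<zero>\<^bsub>\<Omega>\<^esub>"
proof -
  assume "c \<in> K"
  then have "unit_vec R c \<in> rel" unfolding kaehler_relations_def Let_def by (intro UnI2 imageI)
  then show ?thesis unfolding dd_def \<Omega>_eq by (intro q.Q_eq_zero subsetD[OF submodule_gen_self])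
qed

lemma \<Omega>_induct [consumes 1, case_names zero dd add smult]:
  assumes w: "w \<in> carrier \<Omega>" and zero: "P \<zero>\<^bsub>\<Omega>\<^esub>" and dd: "\<And>a. a \<in> carrier R \<Longrightarrow> P (dd a)"
    and add: "\<And>x y. x \<in> carrier \<Omega> \<Longrightarrow> y \<in> carrier \<Omega> \<Longrightarrow> P x \<Longrightarrow> P y \<Longrightarrow> P (x \<oplus>\<^bsub>\<Omega>\<^esub> y)"
    and smult: "\<And>r x. r \<in> carrier R \<Longrightarrow> x \<in> carrier \<Omega> \<Longrightarrow> P x \<Longrightarrow> P (r \<odot>\<^bsub>\<Omega>\<^esub> x)"
  shows "P w"
  by (rule quotient_free_induct[OF R.cring_axioms rel_sub w[unfolded \<Omega>_eq]])
     (use assms in \<open>simp_all add: \<Omega>_eq dd_def\<close>)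

end

section \<open>Exterior powers\<close>

locale exterior_module = M: Module.module R M for R :: "('a, 'r) ring_scheme" and M :: "('a, 'b, 'm) module_scheme" +
  fixes d :: nat
begin

abbreviation "T \<equiv> {xs. length xs = d \<and> set xs \<subseteq> carrier M}"
abbreviation "F \<equiv> free_module R T"
abbreviation "rel \<equiv> exterior_relations R M d"
abbreviation "\<Lambda> \<equiv> exterior_power R M d"

interpretation F: Module.module R F
  by (rule module_free_module[OF M.R.cring_axioms])

lemma u_closed [intro]: "xs \<in> T \<Longrightarrow> unit_vec R xs \<in> carrier F"
  by (rule unit_vec_closed[OF M.R.cring_axioms])

lemma T_update [intro]: "xs \<in> T \<Longrightarrow> x \<in> carrier M \<Longrightarrow> xs[j := x] \<in> T"
  using set_update_subset_insert[of xs j x] by auto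

lemma rel_sub: "rel \<subseteq> carrier F"
  unfolding exterior_relations_def Let_def
  by ((intro Un_least; rule subsetI; erule CollectE; (erule exE conjE)+; hypsubst);
      intro F.minus_closed F.smult_closed F.M.a_closed u_closed T_update M.M.a_closed M.smult_closed; assumption)

sublocale q: quot_module R F "submodule_gen R F rel"
  by (rule quot_module_free[OF M.R.cring_axioms rel_sub])

lemma \<Lambda>_eq: "\<Lambda> = q.Q"
  by (simp add: exterior_power_def Let_def)

lemma module_\<Lambda>: "Module.module R \<Lambda>"
  unfolding \<Lambda>_eq by (rule q.module_Q)

definition wedge :: "'b list \<Rightarrow> ('b list \<Rightarrow> 'a) set" where
  "wedge xs = submodule_gen R F rel +>\<^bsub>F\<^esub> unit_vec R xs"

lemma wedge_closed [intro]: "xs \<in> T \<Longrightarrow> wedge xs \<in> carrier \<Lambda>"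
  using u_closed by (auto simp: wedge_def \<Lambda>_eq q.carrier_Q)

lemma wedge_add:
  assumes "xs \<in> T" "j < d" "x \<in> carrier M" "y \<in> carrier M"
  shows "wedge (xs[j := x \<oplus>\<^bsub>M\<^esub> y]) = wedge (xs[j := x]) \<oplus>\<^bsub>\<Lambda>\<^esub> wedge (xs[j := y])"
proof -
  let ?u = "unit_vec R"
  have "?u (xs[j := x \<oplus>\<^bsub>M\<^esub> y]) \<ominus>\<^bsub>F\<^esub> (?u (xs[j := x]) \<oplus>\<^bsub>F\<^esub> ?u (xs[j := y])) \<in> rel"
    unfolding exterior_relations_def Let_def by (rule UnI1, rule UnI1, rule CollectI, rule exI[of _ xs], rule exI[of _ j], rule exI[of _ x], rule exI[of _ y], intro conjI, rule refl, (rule assms)+)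
  then have *: "?u (xs[j := x \<oplus>\<^bsub>M\<^esub> y]) \<ominus>\<^bsub>F\<^esub> (?u (xs[j := x]) \<oplus>\<^bsub>F\<^esub> ?u (xs[j := y])) \<in> submodule_gen R F rel"
    by (rule subsetD[OF submodule_gen_self])
  have c: "?u (xs[j := x \<oplus>\<^bsub>M\<^esub> y]) \<in> carrier F" "?u (xs[j := x]) \<in> carrier F" "?u (xs[j := y]) \<in> carrier F"
    by (intro u_closed T_update M.M.a_closed assms)+
  show ?thesis
    unfolding wedge_def \<Lambda>_eq q.coset_eq_of_minus[OF c(1) F.M.a_closed[OF c(2,3)] *]
    by (rule q.Q_add[OF c(2,3), symmetric])
qed

lemma wedge_smult:
  assumes "xs \<in> T" "j < d" "x \<in> carrier M" "r \<in> carrier R"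
  shows "wedge (xs[j := r \<odot>\<^bsub>M\<^esub> x]) = r \<odot>\<^bsub>\<Lambda>\<^esub> wedge (xs[j := x])"
proof -
  let ?u = "unit_vec R"
  have "?u (xs[j := r \<odot>\<^bsub>M\<^esub> x]) \<ominus>\<^bsub>F\<^esub> (r \<odot>\<^bsub>F\<^esub> ?u (xs[j := x])) \<in> rel"
    unfolding exterior_relations_def Let_def by (rule UnI1, rule UnI2, rule CollectI, rule exI[of _ xs], rule exI[of _ j], rule exI[of _ r], rule exI[of _ x], intro conjI, rule refl, (rule assms)+)
  then have *: "?u (xs[j := r \<odot>\<^bsub>M\<^esub> x]) \<ominus>\<^bsub>F\<^esub> (r \<odot>\<^bsub>F\<^esub> ?u (xs[j := x])) \<in> submodule_gen R F rel"
    by (rule subsetD[OF submodule_gen_self])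
  have c: "?u (xs[j := r \<odot>\<^bsub>M\<^esub> x]) \<in> carrier F" "?u (xs[j := x]) \<in> carrier F"
    by (intro u_closed T_update M.smult_closed assms)+
  show ?thesis
    unfolding wedge_def \<Lambda>_eq q.coset_eq_of_minus[OF c(1) F.smult_closed[OF assms(4) c(2)] *]
    by (rule q.Q_smult[OF assms(4) c(2), symmetric])
qed

lemma wedge_alt:
  assumes "xs \<in> T" "j < k" "k < d" "xs ! j = xs ! k"
  shows "wedge xs = \<zero>\<^bsub>\<Lambda>\<^esub>"
proof -
  have "unit_vec R xs \<in> rel"
    unfolding exterior_relations_def Let_def by (rule UnI2, rule CollectI, rule exI[of _ xs], rule conjI, rule refl, rule conjI, rule assms,
       rule exI[of _ j], rule exI[of _ k], intro conjI, (rule assms)+)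
  then show ?thesis unfolding wedge_def \<Lambda>_eq by (intro q.Q_eq_zero subsetD[OF submodule_gen_self])
qed

lemma wedge_zero:
  assumes "xs \<in> T" "j < d"
  shows "wedge (xs[j := \<zero>\<^bsub>M\<^esub>]) = \<zero>\<^bsub>\<Lambda>\<^esub>"
proof -
  interpret L: Module.module R \<Lambda> by (rule module_\<Lambda>)
  have "wedge (xs[j := \<zero>\<^bsub>R\<^esub> \<odot>\<^bsub>M\<^esub> \<zero>\<^bsub>M\<^esub>]) = \<zero>\<^bsub>R\<^esub> \<odot>\<^bsub>\<Lambda>\<^esub> wedge (xs[j := \<zero>\<^bsub>M\<^esub>])"
    by (rule wedge_smult) (use assms in auto)
  moreover have "wedge (xs[j := \<zero>\<^bsub>M\<^esub>]) \<in> carrier \<Lambda>" by (intro wedge_closed T_update assms) simp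
  ultimately show ?thesis by simp
qed

lemma \<Lambda>_induct [consumes 1, case_names zero wedge add smult]:
  assumes w: "w \<in> carrier \<Lambda>" and zero: "P \<zero>\<^bsub>\<Lambda>\<^esub>" and wedge: "\<And>xs. xs \<in> T \<Longrightarrow> P (wedge xs)"
    and add: "\<And>x y. x \<in> carrier \<Lambda> \<Longrightarrow> y \<in> carrier \<Lambda> \<Longrightarrow> P x \<Longrightarrow> P y \<Longrightarrow> P (x \<oplus>\<^bsub>\<Lambda>\<^esub> y)"
    and smult: "\<And>r x. r \<in> carrier R \<Longrightarrow> x \<in> carrier \<Lambda> \<Longrightarrow> P x \<Longrightarrow> P (r \<odot>\<^bsub>\<Lambda>\<^esub> x)"
  shows "P w"
  by (rule quotient_free_induct[OF M.R.cring_axioms rel_sub w[unfolded \<Lambda>_eq]])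
     (use assms in \<open>simp_all add: \<Lambda>_eq wedge_def\<close>)

end

section \<open>Alternating sums over permutations\<close>

text \<open>The Leibniz formula for the determinant, with \<open>A i j\<close> in row
  \<open>i\<close> and column \<open>j\<close>. Entries are given by a function, so that the size
  \<open>n\<close> can be the term \<open>card F\<close>.\<close>

definition altdet :: "nat \<Rightarrow> (nat \<Rightarrow> nat \<Rightarrow> 'c::comm_ring_1) \<Rightarrow> 'c" where
  "altdet n A = (\<Sum>p | p permutes {..<n}. of_int (sign p) * (\<Prod>i<n. A i (p i)))"

lemma altdet_cong: "(\<And>i j. i < n \<Longrightarrow> j < n \<Longrightarrow> A i j = B i j) \<Longrightarrow> altdet n A = altdet n B"
  unfolding altdet_def
  by (intro sum.cong refl arg_cong2[where f = "(*)"] prod.cong) (auto dest: permutes_in_image)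

lemma altdet_row_add:
  assumes j: "j < n" and "\<And>i. i \<noteq> j \<Longrightarrow> A i = C i" "\<And>i. i \<noteq> j \<Longrightarrow> B i = C i" "\<And>c. C j c = A j c + B j c"
  shows "altdet n C = altdet n A + altdet n B"
proof -
  have split: "(\<Prod>i<n. D i (p i)) = D j (p j) * (\<Prod>i\<in>{..<n}-{j}. D i (p i))" for D :: "nat \<Rightarrow> nat \<Rightarrow> 'a" and p
    by (rule prod.remove) (use j in auto)
  have rest: "(\<Prod>i\<in>{..<n}-{j}. A i (p i)) = (\<Prod>i\<in>{..<n}-{j}. C i (p i))"
    "(\<Prod>i\<in>{..<n}-{j}. B i (p i)) = (\<Prod>i\<in>{..<n}-{j}. C i (p i))" for p
    by (rule prod.cong; simp add: assms)+
  show ?thesis unfolding altdet_def split rest assms(4) by (simp add: algebra_simps sum.distrib)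
qed

lemma altdet_row_smult:
  assumes j: "j < n" and "\<And>i. i \<noteq> j \<Longrightarrow> A i = C i" "\<And>c. C j c = r * A j c"
  shows "altdet n C = r * altdet n A"
proof -
  have split: "(\<Prod>i<n. D i (p i)) = D j (p j) * (\<Prod>i\<in>{..<n}-{j}. D i (p i))" for D :: "nat \<Rightarrow> nat \<Rightarrow> 'a" and p
    by (rule prod.remove) (use j in auto)
  have rest: "(\<Prod>i\<in>{..<n}-{j}. A i (p i)) = (\<Prod>i\<in>{..<n}-{j}. C i (p i))" for p
    by (rule prod.cong; simp add: assms)
  show ?thesis unfolding altdet_def split rest assms(3) by (simp add: algebra_simps sum_distrib_left)
qed

text \<open>Composing every permutation with the transposition of the two rows preserves the
  products and flips the signs. The determinant equals its own negative, and 2 can be cancelled in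
  characteristic zero.\<close>

lemma altdet_identical_rows:
  fixes A :: "nat \<Rightarrow> nat \<Rightarrow> 'c::{idom,ring_char_0}"
  assumes jk: "j < n" "k < n" "j \<noteq> k" and "A j = A k"
  shows "altdet n A = 0"
proof -
  define t where "t = transpose j k"
  have t: "t permutes {..<n}" unfolding t_def by (rule permutes_swap_id) (use jk in auto)
  have tt: "t (t i) = i" for i by (simp add: t_def)
  have row: "A (t i) = A i" for i using assms(4) by (auto simp: t_def transpose_def)
  have "altdet n A = (\<Sum>p | p permutes {..<n}. of_int (sign (p \<circ> t)) * (\<Prod>i<n. A i ((p \<circ> t) i)))"
    unfolding altdet_def by (rule sum_permutations_compose_right[OF t])
  also have "\<dots> = (\<Sum>p | p permutes {..<n}. - (of_int (sign p) * (\<Prod>i<n. A i (p i))))"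
  proof (rule sum.cong[OF refl])
    fix p assume p: "p \<in> {p. p permutes {..<n}}"
    have "permutation p" "permutation t" using p t by (auto simp: permutation_permutes)
    then have "sign (p \<circ> t) = sign p * sign t" by (rule sign_compose)
    moreover have "sign t = - 1" using jk by (simp add: t_def sign_swap_id)
    moreover have "(\<Prod>i<n. A i ((p \<circ> t) i)) = (\<Prod>i<n. A i (p i))"
    proof -
      have "(\<Prod>i<n. A i (p i)) = (\<Prod>i<n. A (t i) (p (t i)))"
        by (rule prod.permute[OF t, unfolded o_def])
      then show ?thesis by (simp add: row)
    qed
    ultimately show "of_int (sign (p \<circ> t)) * (\<Prod>i<n. A i ((p \<circ> t) i)) = - (of_int (sign p) * (\<Prod>i<n. A i (p i)))"
      by simp
  qed
  also have "\<dots> = - altdet n A" by (simp add: altdet_def sum_negf)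
  finally have "2 * altdet n A = 0" by simp
  then show ?thesis by simp
qed

lemma altdet_id: "altdet n (\<lambda>i j. if i = j then 1 else 0) = 1"
proof -
  have "altdet n (\<lambda>i j. if i = j then 1 else 0) =
     (\<Sum>p\<in>{id}. of_int (sign p) * (\<Prod>i<n. if i = p i then 1 else 0 :: 'a))"
    unfolding altdet_def
  proof (rule sum.mono_neutral_right)
    show "finite {p. p permutes {..<n}}" by (rule finite_permutations) simp
    show "{id} \<subseteq> {p. p permutes {..<n}}" by (auto simp: permutes_id)
    show "\<forall>p\<in>{p. p permutes {..<n}} - {id}. of_int (sign p) * (\<Prod>i<n. if i = p i then 1 else 0 :: 'a) = 0"
    proof
      fix p assume p: "p \<in> {p. p permutes {..<n}} - {id}"
      then obtain i where "p i \<noteq> i" by (auto simp: fun_eq_iff)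
      moreover from this have "i < n" using p by (auto simp: permutes_def)
      ultimately have "(\<Prod>i<n. if i = p i then 1 else 0 :: 'a) = 0" by (intro prod_zero) (auto intro!: bexI[of _ i])
      then show "of_int (sign p) * (\<Prod>i<n. if i = p i then 1 else 0 :: 'a) = 0" by simp
    qed
  qed
  then show ?thesis by simp
qed

section \<open>Top differential forms of a Stanley-Reisner ring\<close>

context SR
begin

abbreviation "grading \<equiv> SR_grading TYPE('k) V \<Delta>"
abbreviation "irr \<equiv> irrelevant_ideal S grading"

lemma homogeneous_0: "p \<in> homogeneous_polys TYPE('k) V 0 \<longleftrightarrow> (\<exists>c. p = single 0 c)"
proof
  assume p: "p \<in> homogeneous_polys TYPE('k) V 0"
  have "m = 0" if m: "m \<in> keys p" for m
  proof -
    have "\<forall>v\<in>keys m. lookup m v = 0"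
      using p m by (auto simp: homogeneous_polys_def)
    then have "lookup m v = 0" for v by (cases "v \<in> keys m") (auto simp: in_keys_iff)
    then show ?thesis by (intro poly_mapping_eqI) simp
  qed
  then have "lookup p m = 0" if "m \<noteq> 0" for m using that by (metis in_keys_iff)
  then have "p = single 0 (lookup p 0)"
    by (intro poly_mapping_eqI) (auto simp: lookup_single when_def)
  then show "\<exists>c. p = single 0 c" ..
qed (auto simp: homogeneous_polys_def split: if_splits)

lemma indet_irrelevant: "v \<in> V \<Longrightarrow> cls (indet v) \<in> irr"
proof -
  assume v: "v \<in> V"
  interpret cring S by (rule cring_S)
  have "indet v \<in> homogeneous_polys TYPE('k) V 1"
    using v by (simp add: homogeneous_polys_def) (simp add: indet_def)
  then have "cls (indet v) \<in> grading 1" by (simp add: SR_grading_eq)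
  moreover have "(\<Oplus>\<^bsub>S\<^esub>i\<in>{1::nat}. cls (indet v)) = cls (indet v)" using v by simp
  ultimately show ?thesis unfolding irrelevant_ideal_def
    by (intro CollectI exI[of _ "{1}"] exI[of _ "\<lambda>_. cls (indet v)"]) simp
qed

text \<open>The trace is an ideal, and a homogeneous polynomial of positive degree has no constant
  term, hence is a combination of variables. Both traces in the theorem are therefore tested on
  variables only.\<close>

lemma irrelevant_subset:
  assumes M: "Module.module S M" and v: "\<And>v. v \<in> V \<Longrightarrow> cls (indet v) \<in> trace_ideal S M"
  shows "irr \<subseteq> trace_ideal S M"
proof
  interpret cring S by (rule cring_S)
  note closed = trace_ideal_zero[OF cring_S, of M] trace_ideal_add[OF M] trace_ideal_mult[OF M]
  have pos: "cls p \<in> trace_ideal S M" if "p \<in> homogeneous_polys TYPE('k) V i" "0 < i" for p i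
  proof -
    have p: "p \<in> PV V" using that by (simp add: homogeneous_polys_def)
    have "lookup p 0 = 0"
      using that by (force simp: homogeneous_polys_def in_keys_iff)
    then have "restr {} p = 0" by (intro poly_mapping_eqI) (simp add: lookup_restr)
    with p have "p \<in> PV V \<and> cls p \<in> trace_ideal S M"
    proof (induction rule: ker_restr_induct)
      case zero
      then show ?case using closed(1) by (simp add: S_zero)
    next
      case (add p q)
      then show ?case using closed(2)[of "cls p" "cls q"] by (simp add: S_add)
    next
      case (mult u q)
      then show ?case using closed(3)[of "cls (indet u)" "cls q"] v[of u] by (simp add: S_mult mult.commute)
    qed
    then show ?thesis ..
  qed
  fix x assume "x \<in> irr"
  then obtain A s where A: "finite A" "\<forall>i\<in>A. 0 < i \<and> s i \<in> grading i" and x: "x = (\<Oplus>\<^bsub>S\<^esub>i\<in>A. s i)"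
    by (auto simp: irrelevant_ideal_def)
  have s: "s i \<in> trace_ideal S M" if "i \<in> A" for i
    using A(2) that pos by (auto simp: SR_grading_eq)
  show "x \<in> trace_ideal S M"
    unfolding x using A(1) s
  proof (induction A rule: finite_induct)
    case empty
    then show ?case using closed(1) by simp
  next
    case (insert i A)
    have "s j \<in> carrier S" if "j \<in> insert i A" for j using trace_ideal_closed[OF M insert.prems[OF that]] .
    then show ?case using insert closed(2) by (subst finsum_insert) auto
  qed
qed

sublocale K: kaehler_module S "grading 0"
  by (intro kaehler_module.intro kaehler_module_axioms.intro cring_S)
     (auto simp: SR_grading_eq homogeneous_0)

abbreviation "dx v \<equiv> K.dd (cls (indet v))"

text \<open>By the Leibniz rule the differential of a polynomial is a combination of the
  \<open>dx v\<close>; constants contribute nothing because they form the degree zero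
  component.\<close>

lemma \<Omega>_vertex_induct [consumes 1, case_names zero dx add smult]:
  assumes w: "w \<in> carrier K.\<Omega>" and zero: "P \<zero>\<^bsub>K.\<Omega>\<^esub>" and dx: "\<And>v. v \<in> V \<Longrightarrow> P (dx v)"
    and add: "\<And>x y. x \<in> carrier K.\<Omega> \<Longrightarrow> y \<in> carrier K.\<Omega> \<Longrightarrow> P x \<Longrightarrow> P y \<Longrightarrow> P (x \<oplus>\<^bsub>K.\<Omega>\<^esub> y)"
    and smult: "\<And>r x. r \<in> carrier S \<Longrightarrow> x \<in> carrier K.\<Omega> \<Longrightarrow> P x \<Longrightarrow> P (r \<odot>\<^bsub>K.\<Omega>\<^esub> x)"
  shows "P w"
proof -
  interpret O: Module.module S K.\<Omega> by (rule K.module_\<Omega>)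
  have dd: "P (K.dd a)" if "a \<in> carrier S" for a
  proof -
    obtain p where p: "p \<in> PV V" and a: "a = cls p" using \<open>a \<in> carrier S\<close> by (rule in_S_E)
    show ?thesis
      unfolding a using p
    proof (induction rule: PV_induct)
      case (const c)
      have "cls (single 0 c) \<in> grading 0" unfolding SR_grading_eq by (intro imageI) (auto simp: homogeneous_0)
      then show ?case using zero by (simp add: K.dd_const)
    next
      case (add p q)
      then have "P (K.dd (cls p) \<oplus>\<^bsub>K.\<Omega>\<^esub> K.dd (cls q))" by (intro assms(4)) auto
      then show ?case using add by (simp add: K.dd_add flip: S_add)
    next
      case (mult v p)
      then have "P (cls (indet v) \<odot>\<^bsub>K.\<Omega>\<^esub> K.dd (cls p) \<oplus>\<^bsub>K.\<Omega>\<^esub> cls p \<odot>\<^bsub>K.\<Omega>\<^esub> dx v)"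
        by (intro assms(4) smult dx O.smult_closed) auto
      then show ?case using mult by (simp add: K.dd_mult flip: S_mult)
    qed
  qed
  show ?thesis using w by (rule K.\<Omega>_induct[of w P]) (use zero dd add smult in auto)
qed

text \<open>Adding \<open>u\<close> to the facet gives a nonface, so x_F x_u = 0 and 0 = x_F dx_u +
  x_u dx_F. Multiplication with x_F removes the last term.\<close>

lemma facet_kills_dx:
  assumes F: "F \<in> facets \<Delta>" and u: "u \<in> V - F"
  shows "cls (vmon F * vmon F) \<odot>\<^bsub>K.\<Omega>\<^esub> dx u = \<zero>\<^bsub>K.\<Omega>\<^esub>"
proof -
  interpret O: Module.module S K.\<Omega> by (rule K.module_\<Omega>)
  have F\<Delta>: "F \<in> \<Delta>" using F by (simp add: facets_def)
  have FV: "vmon F \<in> PV V" using sub_V[OF F\<Delta>] by (auto intro!: PV_prod)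
  have uV: "indet u \<in> PV V" using u by simp
  have "insert u F \<notin> \<Delta>" using F u by (auto simp: facets_def)
  then have "vmon (insert u F) \<in> I" using sub_V[OF F\<Delta>] u by (intro nonface_in_I) auto
  then have I: "vmon F * indet u \<in> I" using fin_face[OF F\<Delta>] u by (simp add: mult.commute)
  have z: "cls (vmon F) \<otimes>\<^bsub>S\<^esub> cls (indet u) = \<zero>\<^bsub>S\<^esub>" using FV uV I by (simp add: S_mult S_eq_zero_iff)
  have "\<zero>\<^bsub>S\<^esub> \<in> grading 0" by (auto simp: SR_grading_eq homogeneous_0 S_zero intro!: image_eqI[of _ _ 0] exI[of _ 0])
  then have "\<zero>\<^bsub>K.\<Omega>\<^esub> = K.dd (cls (vmon F) \<otimes>\<^bsub>S\<^esub> cls (indet u))" by (simp add: z K.dd_const)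
  also have "\<dots> = cls (vmon F) \<odot>\<^bsub>K.\<Omega>\<^esub> dx u \<oplus>\<^bsub>K.\<Omega>\<^esub> cls (indet u) \<odot>\<^bsub>K.\<Omega>\<^esub> K.dd (cls (vmon F))"
    using FV uV by (intro K.dd_mult) auto
  finally have "cls (vmon F) \<odot>\<^bsub>K.\<Omega>\<^esub> \<zero>\<^bsub>K.\<Omega>\<^esub> = cls (vmon F) \<odot>\<^bsub>K.\<Omega>\<^esub>
      (cls (vmon F) \<odot>\<^bsub>K.\<Omega>\<^esub> dx u \<oplus>\<^bsub>K.\<Omega>\<^esub> cls (indet u) \<odot>\<^bsub>K.\<Omega>\<^esub> K.dd (cls (vmon F)))" by simp
  also have "\<dots> = (cls (vmon F) \<otimes>\<^bsub>S\<^esub> cls (vmon F)) \<odot>\<^bsub>K.\<Omega>\<^esub> dx u \<oplus>\<^bsub>K.\<Omega>\<^esub>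
      (cls (vmon F) \<otimes>\<^bsub>S\<^esub> cls (indet u)) \<odot>\<^bsub>K.\<Omega>\<^esub> K.dd (cls (vmon F))"
    using FV uV by (simp add: O.smult_r_distr O.smult_assoc1)
  also have "\<dots> = cls (vmon F * vmon F) \<odot>\<^bsub>K.\<Omega>\<^esub> dx u"
    using FV uV by (simp add: z S_mult)
  finally show ?thesis using FV by simp
qed

lemma mon_ne_0: "finite F \<Longrightarrow> vmon F \<noteq> 0"
  by (induction F rule: finite_induct) auto

text \<open>Let a homomorphism take the value \<open>p\<close> on dx_J, and let \<open>F\<close> be
  a facet above \<open>D\<close> that misses an element of \<open>J\<close>. Then x_F^2 kills dx_J,
  so x_F^2 p = 0. In the domain k[F] the factor x_F is nonzero, so \<open>p\<close> vanishes on
  \<open>F\<close> and a fortiori on \<open>D\<close>. The face \<open>D\<close> may be a facet with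
  few vertices or an intersection of two facets.\<close>

lemma trace_exterior_vanishes:
  assumes D: "D \<in> \<Delta>" and facet: "\<And>J. J \<subseteq> V \<Longrightarrow> card J = d \<Longrightarrow> \<exists>F\<in>facets \<Delta>. D \<subseteq> F \<and> \<not> J \<subseteq> F"
    and t: "t \<in> trace_ideal S (exterior_power S K.\<Omega> d)"
  shows "rho D t = 0"
proof -
  interpret E: exterior_module S K.\<Omega> d by (intro exterior_module.intro K.module_\<Omega>)
  interpret O: Module.module S K.\<Omega> by (rule K.module_\<Omega>)
  interpret L: Module.module S E.\<Lambda> by (rule E.module_\<Lambda>)
  note hom = hom_to_type_simps[OF rho_hom[OF D]] hom_to_type_simps(4)[OF rho_hom[OF D] cring_S]
  have vals: "rho D (\<phi> w) = 0" if \<phi>: "\<phi> \<in> Defs.module_hom S E.\<Lambda> (regular_module S)" and w: "w \<in> carrier E.\<Lambda>" for \<phi> w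
  proof -
    note \<phi>s = module_homD[OF \<phi>, simplified]
    have \<phi>0: "\<phi> \<zero>\<^bsub>E.\<Lambda>\<^esub> = \<zero>\<^bsub>S\<^esub>"
      using \<phi>s(3)[of "\<zero>\<^bsub>S\<^esub>" "\<zero>\<^bsub>E.\<Lambda>\<^esub>"] \<phi>s(1)[of "\<zero>\<^bsub>E.\<Lambda>\<^esub>"] by simp
    have vertices: "rho D (\<phi> (E.wedge xs)) = 0" if xs: "xs = map dx vs" "length vs = d" "set vs \<subseteq> V" for xs vs
    proof (cases "distinct vs")
      case True
      have xsT: "xs \<in> E.T" using xs by auto
      have "card (set vs) = d" using True xs by (simp add: distinct_card)
      then obtain F where F: "F \<in> facets \<Delta>" "D \<subseteq> F" "\<not> set vs \<subseteq> F" using facet[OF xs(3)] by blast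
      then obtain w where "w \<in> set vs" "w \<notin> F" by blast
      then obtain j where j: "j < d" "vs ! j \<notin> F" using xs(2) by (auto simp: in_set_conv_nth)
      have F\<Delta>: "F \<in> \<Delta>" using F by (simp add: facets_def)
      have FV: "vmon F * vmon F \<in> PV V" using sub_V[OF F\<Delta>] by (auto intro!: PV_prod PV_closed(5))
      have vj: "vs ! j \<in> V - F" using j xs by auto
      have upd: "xs[j := dx (vs ! j)] = xs" using j xs by (simp add: list_update_same_conv)
      have "E.wedge (xs[j := cls (vmon F * vmon F) \<odot>\<^bsub>K.\<Omega>\<^esub> dx (vs ! j)]) = cls (vmon F * vmon F) \<odot>\<^bsub>E.\<Lambda>\<^esub> E.wedge xs"
        using E.wedge_smult[OF xsT j(1), of "dx (vs ! j)" "cls (vmon F * vmon F)"] vj FV upd by simp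
      then have "cls (vmon F * vmon F) \<odot>\<^bsub>E.\<Lambda>\<^esub> E.wedge xs = \<zero>\<^bsub>E.\<Lambda>\<^esub>"
        using E.wedge_zero[OF xsT j(1)] by (simp add: facet_kills_dx[OF F(1) vj])
      then have "cls (vmon F * vmon F) \<otimes>\<^bsub>S\<^esub> \<phi> (E.wedge xs) = \<zero>\<^bsub>S\<^esub>"
        using \<phi>s(3)[of "cls (vmon F * vmon F)" "E.wedge xs"] \<phi>0 FV E.wedge_closed[OF xsT] by simp
      moreover obtain p where p: "p \<in> PV V" "\<phi> (E.wedge xs) = cls p"
        using \<phi>s(1)[OF E.wedge_closed[OF xsT]] by (rule in_S_E)
      ultimately have "vmon F * vmon F * p \<in> I" using FV by (simp add: S_mult S_eq_zero_iff)
      then have "restr F (vmon F * vmon F * p) = 0" by (rule restr_I[OF F\<Delta>])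
      then have "restr F p = 0"
        using mon_ne_0[OF fin_face[OF F\<Delta>]] by (simp add: restr_indet_prod fin_face[OF F\<Delta>])
      then show ?thesis using restr_mono_0[OF F(2)] p D by (simp add: rho_cls)
    next
      case False
      then obtain j k where jk: "j < k" "k < d" "vs ! j = vs ! k"
        using xs(2) by (metis distinct_conv_nth linorder_neqE_nat)
      have "E.wedge xs = \<zero>\<^bsub>E.\<Lambda>\<^esub>"
        by (rule E.wedge_alt[of xs j k]) (use jk xs in auto)
      then show ?thesis by (simp add: \<phi>0 hom)
    qed
    \<comment> \<open>The first \<open>k\<close> entries are arbitrary and the others are
      differentials of variables. Each induction step frees one more entry by linearity, until at
      \<open>k = d\<close> nothing is prescribed.\<close>
    have tuples: "\<forall>xs\<in>E.T. (\<forall>i<d. k \<le> i \<longrightarrow> (\<exists>v\<in>V. xs ! i = dx v)) \<longrightarrow> rho D (\<phi> (E.wedge xs)) = 0" for k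
    proof (induction k)
      case 0
      show ?case
      proof (intro ballI impI)
        fix xs assume xs: "xs \<in> E.T" "\<forall>i<d. 0 \<le> i \<longrightarrow> (\<exists>v\<in>V. xs ! i = dx v)"
        then have "\<forall>i. \<exists>v. i < d \<longrightarrow> v \<in> V \<and> xs ! i = dx v" by auto
        then obtain f where f: "\<And>i. i < d \<Longrightarrow> f i \<in> V \<and> xs ! i = dx (f i)" by metis
        have "xs = map dx (map f [0..<d])" using xs(1) f by (intro nth_equalityI) auto
        then show "rho D (\<phi> (E.wedge xs)) = 0" by (rule vertices) (use f in auto)
      qed
    next
      case (Suc k)
      show ?case
      proof (intro ballI impI)
        fix xs assume xs: "xs \<in> E.T" "\<forall>i<d. Suc k \<le> i \<longrightarrow> (\<exists>v\<in>V. xs ! i = dx v)"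
        show "rho D (\<phi> (E.wedge xs)) = 0"
        proof (cases "k < d")
          case False
          then show ?thesis using Suc xs by auto
        next
          case k: True
          have cl: "E.wedge (xs[k := w]) \<in> carrier E.\<Lambda>" if "w \<in> carrier K.\<Omega>" for w
            by (intro E.wedge_closed E.T_update xs(1) that)
          have "rho D (\<phi> (E.wedge (xs[k := w]))) = 0" if "w \<in> carrier K.\<Omega>" for w
            using that
          proof (induction w rule: \<Omega>_vertex_induct)
            case zero
            show ?case by (simp add: E.wedge_zero[OF xs(1) k] \<phi>0 hom)
          next
            case (dx v)
            have "xs[k := dx v] \<in> E.T" by (rule E.T_update[OF xs(1)]) (use dx in auto)
            moreover have "\<forall>i<d. k \<le> i \<longrightarrow> (\<exists>v'\<in>V. xs[k := dx v] ! i = dx v')"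
            proof (intro allI impI)
              fix i assume i: "i < d" "k \<le> i"
              show "\<exists>v'\<in>V. xs[k := dx v] ! i = dx v'"
                using xs i dx by (cases "i = k") auto
            qed
            ultimately show ?case using Suc by blast
          next
            case (add x y)
            then show ?case
              using E.wedge_add[OF xs(1) k add(1,2)] \<phi>s(2)[OF cl[OF add(1)] cl[OF add(2)]]
                \<phi>s(1)[OF cl[OF add(1)]] \<phi>s(1)[OF cl[OF add(2)]] by (simp add: hom)
          next
            case (smult r x)
            then show ?case
              using E.wedge_smult[OF xs(1) k smult(2,1)] \<phi>s(3)[OF smult(1) cl[OF smult(2)]]
                \<phi>s(1)[OF cl[OF smult(2)]] by (simp add: hom)
          qed
          moreover have "xs ! k \<in> carrier K.\<Omega>" using xs(1) k nth_mem[of k xs] by blast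
          ultimately have "rho D (\<phi> (E.wedge (xs[k := xs ! k]))) = 0" .
          then show ?thesis by simp
        qed
      qed
    qed
    show ?thesis using w
    proof (induction w rule: E.\<Lambda>_induct)
      case zero
      show ?case by (simp add: \<phi>0 hom)
    next
      case (wedge xs)
      then show ?case using tuples[of d] by auto
    next
      case (add x y)
      then show ?case using \<phi>s(1,2) by (simp add: hom)
    next
      case (smult r x)
      then show ?case using \<phi>s(1,3) by (simp add: hom)
    qed
  qed
  show ?thesis
    using E.module_\<Lambda> t
  proof (induction t rule: trace_ideal_induct)
    case zero
    show ?case by (simp add: hom)
  next
    case (add t f m)
    then show ?case using vals module_homD(1)[OF add(2,3)] by (simp add: hom)
  qed
qed

text \<open>No edge joins \<open>v\<close> to a vertex outside \<open>F\<close>, so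
  \<open>indet v\<close> annihilates every variable outside \<open>F\<close>, and these generate the
  kernel of the restriction.\<close>

lemma ker_mult_indet_in_I:
  assumes F: "v \<in> F" "F \<subseteq> V" "\<And>u w. u \<in> V - F \<Longrightarrow> w \<in> F \<Longrightarrow> {u, w} \<notin> \<Delta>" and p: "p \<in> PV V" "restr F p = 0"
  shows "indet v * p \<in> I"
  using p
proof (induction rule: ker_restr_induct)
  case (mult u q)
  have "vmon {u, v} \<in> I" using F mult by (intro nonface_in_I) auto
  moreover have "u \<noteq> v" using mult F(1) by auto
  ultimately have "indet u * indet v \<in> I" by simp
  then show ?case using I_closed(7)[of "indet u * indet v" q] mult by (simp add: algebra_simps)
qed (simp_all add: I_closed distrib_left)

end

locale SR_char_0 = SR k V \<Delta> for k :: "'k::field_char_0 itself" and V \<Delta>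
begin

text \<open>The Jacobian determinant along the facet \<open>F\<close>, times \<open>indet v\<close>, is a homomorphism to the
  Stanley-Reisner ring because \<open>indet v\<close> annihilates all variables outside \<open>F\<close>.\<close>

lemma indet_in_trace_exterior:
  assumes F: "F \<in> \<Delta>" "v \<in> F" "\<And>u w. u \<in> V - F \<Longrightarrow> w \<in> F \<Longrightarrow> {u, w} \<notin> \<Delta>"
  shows "cls (indet v) \<in> trace_ideal S (exterior_power S K.\<Omega> (card F))"
proof -
  let ?d = "card F"
  interpret E: exterior_module S K.\<Omega> ?d by (intro exterior_module.intro K.module_\<Omega>)
  note R = cring_S and hom = rho_hom[OF F(1)]
  note homs = hom_to_type_simps[OF hom]
  define g where "g u = (\<lambda>X. pd u (rho F X))" for u
  \<comment> \<open>Restriction to \<open>F\<close> followed by the partial derivative is a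
    derivation that kills constants, so it respects the relations of the Kaehler
    differentials.\<close>
  have van: "lin_ext S (rho F) (g u) x = 0" if "x \<in> K.rel" for u x
  proof -
    note lin = lin_ext_minus[OF R hom] lin_ext_add[OF R hom] lin_ext_smult[OF R hom] lin_ext_unit[OF R hom]
    have uc: "\<And>a. a \<in> carrier S \<Longrightarrow> unit_vec S a \<in> carrier K.F" by (rule K.u_closed)
    note cl = uc K.q.M.a_closed K.q.smult_closed K.R.a_closed K.R.m_closed
    have "pd u (rho F c) = 0" if "c \<in> grading 0" for c
      using that F(1) by (auto simp: SR_grading_eq homogeneous_0 rho_cls restr_single)
    then show ?thesis
      using \<open>x \<in> K.rel\<close> unfolding kaehler_relations_def Let_def
      by (auto simp: lin cl g_def homs pd_mult)
  qed
  define dl where "dl u = q_ext S (rho F) (g u)" for u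
  have dl_add: "dl u (x \<oplus>\<^bsub>K.\<Omega>\<^esub> y) = dl u x + dl u y" if "x \<in> carrier K.\<Omega>" "y \<in> carrier K.\<Omega>" for u x y
    using q_ext_add[OF R hom K.rel_sub van] that unfolding dl_def K.\<Omega>_eq by blast
  have dl_smult: "dl u (r \<odot>\<^bsub>K.\<Omega>\<^esub> x) = rho F r * dl u x" if "x \<in> carrier K.\<Omega>" "r \<in> carrier S" for u x r
    using q_ext_smult[OF R hom K.rel_sub van] that unfolding dl_def K.\<Omega>_eq by blast
  have dl_dx: "dl u (dx w) = (if u = w then 1 else 0)" if "w \<in> F" for u w
  proof -
    have w: "cls (indet w) \<in> carrier S" using that sub_V[OF F(1)] by auto
    have "dl u (dx w) = lin_ext S (rho F) (g u) (unit_vec S (cls (indet w)))"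
      unfolding dl_def K.dd_def by (rule q_ext_coset[OF R hom K.rel_sub _ K.u_closed[OF w]]) (rule van)
    then show ?thesis
      using that F(1) by (simp add: lin_ext_unit[OF R hom] g_def rho_cls restr_indet pd_indet)
  qed
  define us where "us = sorted_list_of_set F"
  have us: "length us = ?d" "set us = F" "distinct us"
    using fin_face[OF F(1)] by (auto simp: us_def)
  define D where "D xs = altdet ?d (\<lambda>i j. dl (us ! j) (xs ! i))" for xs
  have vanD: "lin_ext S (rho F) D x = 0" if "x \<in> E.rel" for x
  proof -
    note lin = lin_ext_minus[OF R hom] lin_ext_add[OF R hom] lin_ext_smult[OF R hom] lin_ext_unit[OF R hom]
    have uc: "unit_vec S (xs[j := x]) \<in> carrier E.F" if "xs \<in> E.T" "x \<in> carrier K.\<Omega>" for xs j x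
      by (intro E.u_closed E.T_update that)
    show ?thesis
      using \<open>x \<in> E.rel\<close> unfolding exterior_relations_def Let_def
    proof (elim UnE CollectE exE conjE)
      fix xs j a b
      assume x: "x = unit_vec S (xs[j := a \<oplus>\<^bsub>K.\<Omega>\<^esub> b]) \<ominus>\<^bsub>E.F\<^esub> (unit_vec S (xs[j := a]) \<oplus>\<^bsub>E.F\<^esub> unit_vec S (xs[j := b]))"
        and xs: "length xs = ?d" "set xs \<subseteq> carrier K.\<Omega>" and j: "j < ?d" and ab: "a \<in> carrier K.\<Omega>" "b \<in> carrier K.\<Omega>"
      have T: "xs \<in> E.T" using xs by simp
      have "D (xs[j := a \<oplus>\<^bsub>K.\<Omega>\<^esub> b]) = D (xs[j := a]) + D (xs[j := b])"
        unfolding D_def by (rule altdet_row_add[OF j]) (use xs j ab in \<open>auto simp: dl_add\<close>)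
      then show ?thesis
        unfolding x using uc[OF T E.M.M.a_closed[OF ab]] uc[OF T ab(1)] uc[OF T ab(2)]
        by (simp add: lin E.q.M.a_closed del: mem_Collect_eq)
    next
      fix xs j r a
      assume x: "x = unit_vec S (xs[j := r \<odot>\<^bsub>K.\<Omega>\<^esub> a]) \<ominus>\<^bsub>E.F\<^esub> (r \<odot>\<^bsub>E.F\<^esub> unit_vec S (xs[j := a]))"
        and xs: "length xs = ?d" "set xs \<subseteq> carrier K.\<Omega>" and j: "j < ?d" and a: "r \<in> carrier S" "a \<in> carrier K.\<Omega>"
      have T: "xs \<in> E.T" using xs by simp
      have "D (xs[j := r \<odot>\<^bsub>K.\<Omega>\<^esub> a]) = rho F r * D (xs[j := a])"
        unfolding D_def by (rule altdet_row_smult[OF j]) (use xs j a in \<open>auto simp: dl_smult\<close>)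
      then show ?thesis
        unfolding x using uc[OF T E.M.smult_closed[OF a]] uc[OF T a(2)] a(1)
        by (simp add: lin E.q.smult_closed del: mem_Collect_eq)
    next
      fix xs j k
      assume x: "x = unit_vec S xs" and "j < k" "k < ?d" "xs ! j = xs ! k"
      then have "D xs = 0" unfolding D_def by (intro altdet_identical_rows[of j _ k]) auto
      then show ?thesis unfolding x by (simp add: lin)
    qed
  qed
  \<comment> \<open>The additional restriction makes all values polynomials in the variables of
    \<open>F\<close>, whatever the argument; it changes neither additivity nor the value 1 attained
    below.\<close>
  define L where "L X = restr F (q_ext S (rho F) D X)" for X
  have L_add: "L (x \<oplus>\<^bsub>E.\<Lambda>\<^esub> y) = L x + L y" if "x \<in> carrier E.\<Lambda>" "y \<in> carrier E.\<Lambda>" for x y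
    using q_ext_add[OF R hom E.rel_sub vanD] that unfolding L_def E.\<Lambda>_eq by simp
  have L_smult: "L (r \<odot>\<^bsub>E.\<Lambda>\<^esub> x) = restr F (rho F r) * L x" if "x \<in> carrier E.\<Lambda>" "r \<in> carrier S" for x r
    using q_ext_smult[OF R hom E.rel_sub vanD] that unfolding L_def E.\<Lambda>_eq by simp
  have LV: "L X \<in> PV V" for X
    unfolding L_def by (rule PV_mono[OF sub_V[OF F(1)] restr_in_PV_self])
  have vV: "indet v \<in> PV V" using F(2) sub_V[OF F(1)] by auto
  define \<phi> where "\<phi> = restrict (\<lambda>X. cls (indet v * L X)) (carrier E.\<Lambda>)"
  have "\<phi> \<in> Defs.module_hom S E.\<Lambda> (regular_module S)"
    unfolding \<phi>_def
  proof (rule module_homI[OF _ _ _ E.module_\<Lambda>])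
    fix x assume x: "x \<in> carrier E.\<Lambda>"
    show "cls (indet v * L x) \<in> carrier (regular_module S)" using LV vV by simp
    show "cls (indet v * L (x \<oplus>\<^bsub>E.\<Lambda>\<^esub> y)) = cls (indet v * L x) \<oplus>\<^bsub>regular_module S\<^esub> cls (indet v * L y)"
      if "y \<in> carrier E.\<Lambda>" for y
      using x that LV vV by (simp add: L_add S_add distrib_left)
    show "cls (indet v * L (r \<odot>\<^bsub>E.\<Lambda>\<^esub> x)) = r \<odot>\<^bsub>regular_module S\<^esub> cls (indet v * L x)" if r: "r \<in> carrier S" for r
    proof -
      obtain p where p: "p \<in> PV V" "r = cls p" using r by (rule in_S_E)
      have "indet v * ((restr F p - p) * L x) \<in> I"
        by (rule ker_mult_indet_in_I[OF F(2) sub_V[OF F(1)] F(3)]) (use p LV in auto)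
      then have "cls (indet v * (restr F p * L x)) = cls (p * (indet v * L x))"
        by (simp add: cls_eq_iff algebra_simps)
      then show ?thesis using p LV vV F(1) x r by (simp add: L_smult rho_cls S_mult)
    qed
  qed
  note \<phi> = this
  \<comment> \<open>On the differentials of the vertices of \<open>F\<close> the Jacobian matrix is
    the identity matrix.\<close>
  define xs where "xs = map dx us"
  have xs: "xs \<in> E.T" using us sub_V[OF F(1)] by (auto simp: xs_def)
  have "D xs = altdet ?d (\<lambda>i j. if i = j then 1 else 0)"
    unfolding D_def
  proof (rule altdet_cong)
    fix i j assume "i < ?d" "j < ?d"
    then show "dl (us ! j) (xs ! i) = (if i = j then 1 else 0)"
      using us dl_dx[of "us ! i" "us ! j"] by (auto simp: xs_def nth_eq_iff_index_eq)
  qed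
  moreover have "q_ext S (rho F) D (E.wedge xs) = lin_ext S (rho F) D (unit_vec S xs)"
    unfolding E.wedge_def by (rule q_ext_coset[OF R hom E.rel_sub _ E.u_closed[OF xs]]) (rule vanD)
  ultimately have "L (E.wedge xs) = 1"
    unfolding L_def by (simp add: altdet_id lin_ext_unit[OF R hom])
  then have "\<phi> (E.wedge xs) = cls (indet v)" using E.wedge_closed[OF xs] by (simp add: \<phi>_def)
  then show ?thesis
    using trace_ideal_hom[OF E.module_\<Lambda> \<phi> E.wedge_closed[OF xs]] by simp
qed

end

section \<open>Koszul families\<close>

text \<open>The Koszul sign: the parity of the position of \<open>u\<close> in the increasing
  enumeration of \<open>A\<close>.\<close>

definition ksgn :: "nat \<Rightarrow> nat set \<Rightarrow> 'k::field mpoly" where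
  "ksgn u A = (- 1) ^ card {w \<in> A. w < u}"

definition kcoeff :: "nat \<Rightarrow> nat set \<Rightarrow> 'k::field mpoly" where
  "kcoeff u A = ksgn u A * indet u"

text \<open>If \<open>g A\<close> is the image of the Koszul basis element e_A under a linear map,
  this is the image of the boundary of e_A, the sum over \<open>u\<close> of the signed terms x_u
  e_(A - u).\<close>

definition kdel :: "(nat set \<Rightarrow> 'b \<Rightarrow> 'k::field mpoly) \<Rightarrow> nat set \<Rightarrow> 'b \<Rightarrow> 'k mpoly" where
  "kdel g A = (\<lambda>b. \<Sum>u\<in>A. kcoeff u A * g (A - {u}) b)"

lemma kcoeff_in_PV: "u \<in> V \<Longrightarrow> kcoeff u A \<in> PV V"
  by (simp add: kcoeff_def ksgn_def)

lemma restr_kcoeff: "u \<notin> F \<Longrightarrow> restr F (kcoeff u A) = 0"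
  by (simp add: kcoeff_def restr_indet)

lemma kcoeff_singleton [simp]: "kcoeff u {u} = indet u"
proof -
  have e: "{w \<in> {u}. w < u} = {}" by auto
  show ?thesis unfolding kcoeff_def ksgn_def e by simp
qed

text \<open>Removing the smaller element shifts the position of the larger one by one; removing the
  larger element leaves the position of the smaller one unchanged.\<close>

lemma ksgn_swap:
  assumes A: "finite A" "u \<in> A" "w \<in> A" and less: "u < w"
  shows "ksgn u A * ksgn w (A - {u}) = - (ksgn w A * ksgn u (A - {w}) :: 'k::field mpoly)"
proof -
  have "{x \<in> A - {w}. x < u} = {x \<in> A. x < u}" using less by auto
  then have 1: "ksgn u (A - {w}) = (ksgn u A :: 'k mpoly)" by (simp add: ksgn_def)
  have "{x \<in> A. x < w} = insert u {x \<in> A - {u}. x < w}" using A less by auto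
  then have "card {x \<in> A. x < w} = Suc (card {x \<in> A - {u}. x < w})" using A(1) by simp
  then have 2: "ksgn w A = - (ksgn w (A - {u}) :: 'k mpoly)" by (simp add: ksgn_def)
  show ?thesis unfolding 1 2 by simp
qed

lemma kcoeff_swap:
  assumes A: "finite A" "u \<in> A" "w \<in> A" "u \<noteq> w"
  shows "kcoeff u A * kcoeff w (A - {u}) = - (kcoeff w A * kcoeff u (A - {w}) :: 'k::field mpoly)"
proof (cases "u < w")
  case True
  have "kcoeff u A * kcoeff w (A - {u}) = (ksgn u A * ksgn w (A - {u})) * (indet u * indet w :: 'k mpoly)"
    by (simp add: kcoeff_def mult_ac)
  then show ?thesis unfolding ksgn_swap[OF A(1-3) True] by (simp add: kcoeff_def mult_ac)
next
  case False
  then have *: "w < u" using A by simp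
  have "kcoeff w A * kcoeff u (A - {w}) = (ksgn w A * ksgn u (A - {w})) * (indet u * indet w :: 'k mpoly)"
    by (simp add: kcoeff_def mult_ac)
  then show ?thesis unfolding ksgn_swap[OF A(1,3,2) *] by (simp add: kcoeff_def mult_ac)
qed

lemma kdel_kdel:
  fixes g :: "nat set \<Rightarrow> 'b \<Rightarrow> 'k::field_char_0 mpoly"
  assumes A: "finite A"
  shows "kdel (kdel g) A = (\<lambda>b. 0)"
proof
  fix b
  \<comment> \<open>Filling the diagonal with zeros makes the double sum range over a full square,
    where exchanging the two summations meets the antisymmetry of the coefficients.\<close>
  define t where "t u w = (if u = w then 0 else kcoeff u A * kcoeff w (A - {u}) * g (A - {u} - {w}) b)" for u w
  have swap: "t w u = - t u w" if "u \<in> A" "w \<in> A" for u w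
  proof (cases "u = w")
    case False
    have "A - {w} - {u} = A - {u} - {w}" by auto
    then show ?thesis using False by (simp add: t_def kcoeff_swap[OF A that False])
  qed (simp add: t_def)
  have "kdel (kdel g) A b = (\<Sum>u\<in>A. \<Sum>w\<in>A. t u w)"
  proof -
    have "kcoeff u A * (\<Sum>w\<in>A - {u}. kcoeff w (A - {u}) * g (A - {u} - {w}) b) = (\<Sum>w\<in>A. t u w)" if "u \<in> A" for u
    proof -
      have "(\<Sum>w\<in>A. t u w) = t u u + (\<Sum>w\<in>A - {u}. t u w)" by (rule sum.remove[OF A that])
      also have "(\<Sum>w\<in>A - {u}. t u w) = (\<Sum>w\<in>A - {u}. kcoeff u A * kcoeff w (A - {u}) * g (A - {u} - {w}) b)"
        by (rule sum.cong) (auto simp: t_def)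
      finally show ?thesis by (simp add: t_def sum_distrib_left mult.assoc)
    qed
    then show ?thesis by (simp add: kdel_def)
  qed
  also have "\<dots> = (\<Sum>u\<in>A. \<Sum>w\<in>A. t w u)" by (rule sum.swap)
  also have "\<dots> = - (\<Sum>u\<in>A. \<Sum>w\<in>A. t u w)"
    unfolding sum_negf[symmetric] by (intro sum.cong refl swap)
  finally have "kdel (kdel g) A b = - kdel (kdel g) A b"
    using \<open>kdel (kdel g) A b = (\<Sum>u\<in>A. \<Sum>w\<in>A. t u w)\<close> by simp
  then have "2 * kdel (kdel g) A b = 0" by (metis add.right_inverse mult_2)
  then show "kdel (kdel g) A b = 0" by simp
qed

lemma kdel_cong: "(\<And>u. u \<in> A \<Longrightarrow> g (A - {u}) = h (A - {u})) \<Longrightarrow> kdel g A = kdel h A"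
  unfolding kdel_def by (intro ext sum.cong) auto

text \<open>Recursion over the cardinality. By \<open>local\<close> the condition at
  \<open>A\<close> only looks at subsets of \<open>A\<close>, so the values at all sets of one
  cardinality can be chosen simultaneously without disturbing each other.\<close>

lemma subset_family_exists:
  fixes Q :: "('a set \<Rightarrow> 'b) \<Rightarrow> 'a set \<Rightarrow> bool"
  assumes U: "finite U"
    and local: "\<And>h h' A. (\<And>B. B \<subseteq> A \<Longrightarrow> h B = h' B) \<Longrightarrow> Q h A \<Longrightarrow> Q h' A"
    and step: "\<And>A h. A \<subseteq> U \<Longrightarrow> (\<And>B. B \<subset> A \<Longrightarrow> Q h B) \<Longrightarrow> \<exists>y. Q (h(A := y)) A"
  shows "\<exists>h. \<forall>A\<subseteq>U. Q h A"
proof -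
  have "\<exists>h. \<forall>A\<subseteq>U. card A < n \<longrightarrow> Q h A" for n
  proof (induction n)
    case (Suc n)
    then obtain h where h: "\<And>A. A \<subseteq> U \<Longrightarrow> card A < n \<Longrightarrow> Q h A" by blast
    have fin: "finite A" if "A \<subseteq> U" for A using that U by (rule finite_subset)
    have "\<exists>y. Q (h(A := y)) A" if "A \<subseteq> U" "card A = n" for A
      using that h psubset_card_mono[OF fin[OF that(1)]] by (intro step) auto
    then obtain y where y: "\<And>A. A \<subseteq> U \<Longrightarrow> card A = n \<Longrightarrow> Q (h(A := y A)) A" by metis
    define h' where "h' A = (if A \<subseteq> U \<and> card A = n then y A else h A)" for A
    have "Q h' A" if A: "A \<subseteq> U" "card A < Suc n" for A
    proof (cases "card A = n")
      case True
      have "(h(A := y A)) B = h' B" if "B \<subseteq> A" for B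
      proof (cases "B = A")
        case False
        then have "card B < card A" using that psubset_card_mono[OF fin[OF A(1)], of B] by blast
        then show ?thesis using False True by (simp add: h'_def)
      qed (use True A in \<open>simp add: h'_def\<close>)
      then show ?thesis using local[OF _ y[OF A(1) True], of h'] by blast
    next
      case False
      then have "card A < n" using A by simp
      moreover have "h B = h' B" if "B \<subseteq> A" for B
        using card_mono[OF fin[OF A(1)] that] \<open>card A < n\<close> by (simp add: h'_def)
      ultimately show ?thesis using local[OF _ h[OF A(1)], of h'] by blast
    qed
    then show ?case by blast
  qed simp
  from this[of "Suc (card U)"] show ?thesis using card_mono[OF U] by (auto simp: less_Suc_eq_le)
qed

text \<open>A target for comparison maps: exactness is demanded in positive degrees, and the
  homology in degree zero is left open. The given resolution, with homology the Stanley-Reisner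
  ring, and the Koszul complex of the variables outside \<open>F\<close>, with homology k[F], are
  both instances.\<close>

locale acyclic_complex =
  fixes V :: "nat set" and C :: "nat \<Rightarrow> ('b \<Rightarrow> 'k::field_char_0 mpoly) set"
    and dm :: "nat \<Rightarrow> ('b \<Rightarrow> 'k mpoly) \<Rightarrow> 'b \<Rightarrow> 'k mpoly"
  assumes zero: "(\<lambda>_. 0) \<in> C i"
    and add: "x \<in> C i \<Longrightarrow> y \<in> C i \<Longrightarrow> (\<lambda>b. x b + y b) \<in> C i"
    and smult: "p \<in> PV V \<Longrightarrow> x \<in> C i \<Longrightarrow> (\<lambda>b. p * x b) \<in> C i"
    and dm_closed: "x \<in> C (Suc i) \<Longrightarrow> dm i x \<in> C i"
    and dm_add: "x \<in> C (Suc i) \<Longrightarrow> y \<in> C (Suc i) \<Longrightarrow> dm i (\<lambda>b. x b + y b) = (\<lambda>b. dm i x b + dm i y b)"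
    and dm_smult: "p \<in> PV V \<Longrightarrow> x \<in> C (Suc i) \<Longrightarrow> dm i (\<lambda>b. p * x b) = (\<lambda>b. p * dm i x b)"
    and exact: "x \<in> C (Suc i) \<Longrightarrow> dm i x = (\<lambda>_. 0) \<Longrightarrow> \<exists>y\<in>C (Suc (Suc i)). dm (Suc i) y = x"
begin

lemma dm_zero: "dm i (\<lambda>_. 0) = (\<lambda>_. 0)"
  using dm_smult[of 0 "\<lambda>_. 0" i] zero by simp

lemma diff: "x \<in> C i \<Longrightarrow> y \<in> C i \<Longrightarrow> (\<lambda>b. x b - y b) \<in> C i"
  using add[of x i "\<lambda>b. - 1 * y b"] smult[of "- 1" y i] by simp

lemma dm_diff: "x \<in> C (Suc i) \<Longrightarrow> y \<in> C (Suc i) \<Longrightarrow> dm i (\<lambda>b. x b - y b) = (\<lambda>b. dm i x b - dm i y b)"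
  using dm_add[of x i "\<lambda>b. - 1 * y b"] smult[of "- 1" y "Suc i"] dm_smult[of "- 1" y i] by simp

lemma lincomb: "finite A \<Longrightarrow> (\<And>u. u \<in> A \<Longrightarrow> p u \<in> PV V \<and> x u \<in> C i) \<Longrightarrow> (\<lambda>b. \<Sum>u\<in>A. p u * x u b) \<in> C i"
  by (induction A rule: finite_induct) (simp_all add: zero add smult)

lemma dm_lincomb:
  "finite A \<Longrightarrow> (\<And>u. u \<in> A \<Longrightarrow> p u \<in> PV V \<and> x u \<in> C (Suc i)) \<Longrightarrow>
    dm i (\<lambda>b. \<Sum>u\<in>A. p u * x u b) = (\<lambda>b. \<Sum>u\<in>A. p u * dm i (x u) b)"
proof (induction A rule: finite_induct)
  case (insert a A)
  then show ?case
    using lincomb[of A p x "Suc i"] by (simp add: dm_add smult dm_smult)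
qed (simp add: dm_zero)

lemma kdel_closed:
  assumes "finite A" "A \<subseteq> V" "\<And>u. u \<in> A \<Longrightarrow> g (A - {u}) \<in> C i"
  shows "kdel g A \<in> C i"
  unfolding kdel_def using assms by (intro lincomb) (auto intro: kcoeff_in_PV)

lemma dm_kdel:
  assumes "finite A" "A \<subseteq> V" "\<And>u. u \<in> A \<Longrightarrow> g (A - {u}) \<in> C (Suc i)"
  shows "dm i (kdel g A) = kdel (\<lambda>B. dm i (g B)) A"
  unfolding kdel_def using assms by (intro dm_lincomb) (auto intro: kcoeff_in_PV)

text \<open>A chain map from the Koszul complex of \<open>U\<close> to \<open>C\<close>, recorded by
  the images of the basis elements e_A.\<close>

definition koszul_family :: "nat set \<Rightarrow> (nat set \<Rightarrow> 'b \<Rightarrow> 'k mpoly) \<Rightarrow> bool" where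
  "koszul_family U g \<longleftrightarrow> (\<forall>A\<subseteq>U. g A \<in> C (card A) \<and> (\<forall>i. card A = Suc i \<longrightarrow> dm i (g A) = kdel g A))"

lemma card_remove: "finite A \<Longrightarrow> u \<in> A \<Longrightarrow> card A = Suc i \<Longrightarrow> card (A - {u}) = i"
  by simp

text \<open>The comparison theorem. The prescribed boundary \<open>kdel f A\<close> is a cycle
  because \<open>kdel\<close> squares to zero, so exactness provides a preimage. In degree one,
  where exactness says nothing, the hypothesis \<open>lift\<close> takes over.\<close>

lemma koszul_family_exists:
  assumes U: "finite U" "U \<subseteq> V" and x: "x \<in> C 0"
    and lift: "\<And>u. u \<in> U \<Longrightarrow> (\<lambda>b. indet u * x b) \<in> dm 0 ` C (Suc 0)"
  shows "\<exists>f. koszul_family U f \<and> f {} = x"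
proof -
  define Q where "Q f A \<longleftrightarrow> f A \<in> C (card A) \<and> (A = {} \<longrightarrow> f A = x) \<and>
    (\<forall>i. card A = Suc i \<longrightarrow> dm i (f A) = kdel f A)" for f A
  have "\<exists>f. \<forall>A\<subseteq>U. Q f A"
  proof (rule subset_family_exists[OF U(1)])
    fix h h' A assume eq: "\<And>B. B \<subseteq> A \<Longrightarrow> h B = h' B" and "Q h A"
    moreover have "kdel h A = kdel h' A" by (rule kdel_cong) (use eq in auto)
    ultimately show "Q h' A" by (simp add: Q_def)
  next
    fix A f assume A: "A \<subseteq> U" and Q: "\<And>B. B \<subset> A \<Longrightarrow> Q f B"
    have fin: "finite A" and AV: "A \<subseteq> V" using A U by (auto intro: finite_subset)
    have sub: "A - {u} \<subset> A" if "u \<in> A" for u using that by auto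
    have upd: "kdel (f(A := y)) A = kdel f A" for y by (rule kdel_cong) auto
    show "\<exists>y. Q (f(A := y)) A"
    proof (cases "A = {}")
      case True
      then show ?thesis using x by (intro exI[of _ x]) (simp add: Q_def)
    next
      case False
      then obtain i where i: "card A = Suc i" using fin by (cases "card A") auto
      have fA: "f (A - {u}) \<in> C i" if "u \<in> A" for u
        using Q[OF sub[OF that]] card_remove[OF fin that i] by (simp add: Q_def)
      have "kdel f A \<in> dm i ` C (Suc i)"
      proof (cases i)
        case 0
        then obtain u where u: "A = {u}" using i by (auto simp: card_1_singleton_iff)
        have "f {} = x" using Q[of "{}"] u by (auto simp: Q_def)
        then have "kdel f A = (\<lambda>b. indet u * x b)" by (simp add: kdel_def u)
        then show ?thesis using lift[of u] u A 0 by simp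
      next
        case (Suc j)
        have "dm j (f (A - {u})) = kdel f (A - {u})" if "u \<in> A" for u
          using Q[OF sub[OF that]] card_remove[OF fin that i] Suc by (auto simp: Q_def)
        then have "dm j (kdel f A) = kdel (kdel f) A"
          using dm_kdel[OF fin AV, of f j] fA Suc by (simp add: kdel_cong[of A "\<lambda>B. dm j (f B)" "kdel f"])
        then have "dm j (kdel f A) = (\<lambda>_. 0)" by (simp add: kdel_kdel[OF fin])
        moreover have "kdel f A \<in> C (Suc j)" using kdel_closed[OF fin AV] fA Suc by simp
        ultimately show ?thesis using exact[of "kdel f A" j] Suc by (metis imageI)
      qed
      then obtain y where "y \<in> C (Suc i)" "dm i y = kdel f A" by auto
      then show ?thesis using i False by (intro exI[of _ y]) (auto simp: Q_def upd)
    qed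
  qed
  then obtain f where "\<forall>A\<subseteq>U. Q f A" by blast
  then show ?thesis by (intro exI[of _ f]) (auto simp: Q_def koszul_family_def)
qed

text \<open>A chain map that is zero on the homology in degree zero has a null homotopy
  \<open>h\<close>. It is built recursively: what remains of \<open>g A\<close> after subtracting
  \<open>kdel h A\<close> is a cycle, hence a boundary.\<close>

lemma koszul_family_null:
  assumes U: "finite U" "U \<subseteq> V" and g: "koszul_family U g" and g0: "g {} \<in> dm 0 ` C (Suc 0)"
  shows "\<exists>h. \<forall>A\<subseteq>U. h A \<in> C (Suc (card A)) \<and> dm (card A) (h A) = (\<lambda>b. g A b - kdel h A b)"
proof (rule subset_family_exists[OF U(1)])
  fix h h' A assume eq: "\<And>B. B \<subseteq> A \<Longrightarrow> h B = h' B"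
    and *: "h A \<in> C (Suc (card A)) \<and> dm (card A) (h A) = (\<lambda>b. g A b - kdel h A b)"
  have "kdel h A = kdel h' A" by (rule kdel_cong) (use eq in auto)
  then show "h' A \<in> C (Suc (card A)) \<and> dm (card A) (h' A) = (\<lambda>b. g A b - kdel h' A b)"
    using * eq[of A] by simp
next
  fix A h assume A: "A \<subseteq> U"
    and Q: "\<And>B. B \<subset> A \<Longrightarrow> h B \<in> C (Suc (card B)) \<and> dm (card B) (h B) = (\<lambda>b. g B b - kdel h B b)"
  have fin: "finite A" and AV: "A \<subseteq> V" using A U by (auto intro: finite_subset)
  have sub: "A - {u} \<subset> A" if "u \<in> A" for u using that by auto
  have upd: "kdel (h(A := y)) A = kdel h A" for y by (rule kdel_cong) auto
  have gA: "g A \<in> C (card A)" using g A by (simp add: koszul_family_def)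
  have "(\<lambda>b. g A b - kdel h A b) \<in> dm (card A) ` C (Suc (card A))"
  proof (cases "A = {}")
    case True
    then show ?thesis using g0 by (simp add: kdel_def)
  next
    case False
    then obtain i where i: "card A = Suc i" using fin by (cases "card A") auto
    have hA: "h (A - {u}) \<in> C (Suc i)" "dm i (h (A - {u})) = (\<lambda>b. g (A - {u}) b - kdel h (A - {u}) b)"
      if "u \<in> A" for u
      using Q[OF sub[OF that]] card_remove[OF fin that i] by simp_all
    have hc: "kdel h A \<in> C (Suc i)" by (rule kdel_closed[OF fin AV]) (rule hA(1))
    have "dm i (kdel h A) = kdel (\<lambda>B. dm i (h B)) A" by (rule dm_kdel[OF fin AV]) (rule hA(1))
    also have "\<dots> = kdel (\<lambda>B b. g B b - kdel h B b) A" by (rule kdel_cong) (simp add: hA(2))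
    also have "\<dots> = (\<lambda>b. kdel g A b - kdel (kdel h) A b)"
      by (simp add: kdel_def right_diff_distrib sum_subtractf)
    also have "\<dots> = kdel g A" by (simp add: kdel_kdel[OF fin])
    finally have "dm i (\<lambda>b. g A b - kdel h A b) = (\<lambda>_. 0)"
      using dm_diff[of "g A" i "kdel h A"] gA hc i g A by (simp add: koszul_family_def)
    moreover have "(\<lambda>b. g A b - kdel h A b) \<in> C (Suc i)" using diff gA hc i by simp
    ultimately obtain y where y: "y \<in> C (Suc (Suc i))" "dm (Suc i) y = (\<lambda>b. g A b - kdel h A b)"
      using exact[of _ i] by blast
    show ?thesis unfolding i y(2)[symmetric] by (rule imageI[OF y(1)])
  qed
  then obtain y where y: "(\<lambda>b. g A b - kdel h A b) = dm (card A) y" "y \<in> C (Suc (card A))" by (rule imageE)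
  then show "\<exists>y. (h(A := y)) A \<in> C (Suc (card A)) \<and>
      dm (card A) ((h(A := y)) A) = (\<lambda>b. g A b - kdel (h(A := y)) A b)"
    by (intro exI[of _ y]) (simp add: upd y(1)[symmetric])
qed

lemma koszul_family_smult:
  assumes U: "finite U" and f: "koszul_family U f" and p: "p \<in> PV V"
  shows "koszul_family U (\<lambda>A b. p * f A b)"
proof -
  have "kdel (\<lambda>A b. p * f A b) A = (\<lambda>b. p * kdel f A b)" for A
    by (simp add: kdel_def sum_distrib_left algebra_simps)
  then have 1: "kdel (\<lambda>A b. p * f A b) = (\<lambda>A b. p * kdel f A b)" by blast
  show ?thesis
    unfolding koszul_family_def 1
  proof (intro allI impI conjI)
    fix A i assume A: "A \<subseteq> U"
    then have fA: "f A \<in> C (card A)" using f by (simp add: koszul_family_def)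
    then show "(\<lambda>b. p * f A b) \<in> C (card A)" by (rule smult[OF p])
    assume i: "card A = Suc i"
    then have "dm i (f A) = kdel f A" using f A by (simp add: koszul_family_def)
    then show "dm i (\<lambda>b. p * f A b) = (\<lambda>b. p * kdel f A b)" using dm_smult[OF p, of "f A" i] fA i by simp
  qed
qed

lemma koszul_family_diff:
  assumes U: "finite U" and f: "koszul_family U f" and g: "koszul_family U g"
  shows "koszul_family U (\<lambda>A b. f A b - g A b)"
proof -
  have "kdel (\<lambda>A b. f A b - g A b) A = (\<lambda>b. kdel f A b - kdel g A b)" for A
    by (simp add: kdel_def sum_subtractf algebra_simps)
  then have 1: "kdel (\<lambda>A b. f A b - g A b) = (\<lambda>A b. kdel f A b - kdel g A b)" by blast
  show ?thesis
    unfolding koszul_family_def 1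
  proof (intro allI impI conjI)
    fix A i assume A: "A \<subseteq> U"
    then have c: "f A \<in> C (card A)" "g A \<in> C (card A)" using f g by (simp_all add: koszul_family_def)
    then show "(\<lambda>b. f A b - g A b) \<in> C (card A)" by (rule diff)
    assume i: "card A = Suc i"
    then have "dm i (f A) = kdel f A" "dm i (g A) = kdel g A" using f g A by (simp_all add: koszul_family_def)
    then show "dm i (\<lambda>b. f A b - g A b) = (\<lambda>b. kdel f A b - kdel g A b)"
      using dm_diff[of "f A" i "g A"] c i by simp
  qed
qed

end

section \<open>The Koszul complex of a set of variables\<close>

text \<open>The Koszul differential in coordinates: for the chain with coefficient
  \<open>k A\<close> at e_A, this is the coefficient of its boundary at e_B, collected from the sets
  that have one more element than \<open>B\<close>.\<close>

definition kbd :: "nat set \<Rightarrow> (nat set \<Rightarrow> 'k::field mpoly) \<Rightarrow> nat set \<Rightarrow> 'k mpoly" where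
  "kbd U k B = (\<Sum>u\<in>U - B. kcoeff u (insert u B) * k (insert u B))"

lemma kcoeff_insert_below:
  assumes "\<And>x. x \<in> A \<Longrightarrow> x < u" "w < u"
  shows "kcoeff w (insert u A) = kcoeff w A"
proof -
  have "{x \<in> insert u A. x < w} = {x \<in> A. x < w}" using assms(2) by auto
  then show ?thesis by (simp add: kcoeff_def ksgn_def)
qed

lemma kcoeff_top:
  assumes "\<And>x. x \<in> A \<Longrightarrow> x < u"
  shows "kcoeff u (insert u A) = (- 1) ^ card A * indet u"
proof -
  have "{x \<in> insert u A. x < u} = A" using assms by auto
  then show ?thesis by (simp add: kcoeff_def ksgn_def)
qed

lemma kbd_insert_out:
  assumes "finite U" "\<And>x. x \<in> U \<Longrightarrow> x < u" "B \<subseteq> U"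
  shows "kbd (insert u U) k B = kbd U k B + (- 1) ^ card B * indet u * k (insert u B)"
proof -
  have "u \<notin> U" using assms(2) by blast
  then have "insert u U - B = insert u (U - B)" "u \<notin> U - B" using assms(3) by auto
  moreover have "kcoeff u (insert u B) = (- 1) ^ card B * (indet u :: 'a mpoly)" by (rule kcoeff_top) (use assms in auto)
  ultimately show ?thesis using assms(1) by (simp add: kbd_def add.commute)
qed

lemma kbd_insert_in:
  assumes "\<And>x. x \<in> U \<Longrightarrow> x < u" "B \<subseteq> U"
  shows "kbd (insert u U) k (insert u B) = kbd U (\<lambda>B. k (insert u B)) B"
proof -
  have "insert u U - insert u B = U - B" using assms by auto
  moreover have "kcoeff w (insert w (insert u B)) = (kcoeff w (insert w B) :: 'a mpoly)" if "w \<in> U - B" for w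
    using kcoeff_insert_below[of "insert w B" u w] assms that by (auto simp: insert_commute)
  ultimately show ?thesis unfolding kbd_def by (auto intro!: sum.cong simp: insert_commute)
qed

lemma kbd_cong: "(\<And>A. A \<subseteq> U \<Longrightarrow> A \<noteq> {} \<Longrightarrow> k A = k' A) \<Longrightarrow> B \<subseteq> U \<Longrightarrow> kbd U k B = kbd U k' B"
  unfolding kbd_def by (intro sum.cong) auto

lemma kbd_in_PV: "U \<subseteq> V \<Longrightarrow> B \<subseteq> U \<Longrightarrow> (\<And>A. A \<subseteq> U \<Longrightarrow> k A \<in> PV V) \<Longrightarrow> kbd U k B \<in> PV V"
  unfolding kbd_def by (intro PV_sum PV_closed(5) kcoeff_in_PV) auto

lemma ker_restr_single_variable:
  assumes "r \<in> PV W" "restr (W - {u}) r = 0"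
  shows "\<exists>r'\<in>PV W. r = indet u * r'"
  using assms
proof (induction rule: ker_restr_induct)
  case zero
  show ?case by (intro bexI[of _ 0]) auto
next
  case (add p q)
  then obtain p' q' where "p' \<in> PV W" "q' \<in> PV W" "p = indet u * p'" "q = indet u * q'" by blast
  then show ?case by (intro bexI[of _ "p' + q'"]) (auto simp: distrib_left)
next
  case (mult w q)
  then show ?case by auto
qed

text \<open>Induction on the largest variable \<open>u\<close>: the Koszul complex is the cone of multiplication
  by \<open>u\<close> on the smaller one, and \<open>u\<close> is a nonzerodivisor modulo the other variables.\<close>

lemma koszul_exact:
  fixes k :: "nat set \<Rightarrow> 'k::field mpoly"
  assumes "finite U" "U \<subseteq> V" "\<And>B. B \<subseteq> U \<Longrightarrow> k B \<in> PV V" "\<And>B. B \<subseteq> U \<Longrightarrow> kbd U k B = 0"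
    "restr (V - U) (k {}) = 0"
  shows "\<exists>k'. (\<forall>B\<subseteq>U. k' B \<in> PV V \<and> kbd U k' B = k B)"
  using assms
proof (induction U arbitrary: k rule: finite_linorder_max_induct)
  case empty
  then have "k {} = 0" by (simp add: in_PV_iff_restr)
  then show ?case by (intro exI[of _ "\<lambda>_. 0"]) (simp add: kbd_def)
next
  case (insert u U)
  have less: "\<And>x. x \<in> U \<Longrightarrow> x < u" using insert.hyps by blast
  have uU: "u \<notin> U" using less by blast
  have UV: "U \<subseteq> V" and uV: "u \<in> V" using insert.prems by auto
  \<comment> \<open>The coefficients at the sets that contain \<open>u\<close>. The cycle condition
    splits into \<open>kb\<close> for the sets without \<open>u\<close> and \<open>bb\<close> for
    the sets with \<open>u\<close>.\<close>
  define b where "b B = k (insert u B)" for B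
  have kV: "k B \<in> PV V" if "B \<subseteq> insert u U" for B using insert.prems(2) that by blast
  have bV: "b B \<in> PV V" if "B \<subseteq> U" for B unfolding b_def by (rule kV) (use that in auto)
  have kb: "kbd U k B + (- 1) ^ card B * indet u * b B = 0" if "B \<subseteq> U" for B
    using insert.prems(3)[of B] kbd_insert_out[OF insert.hyps(1) less that, of k] that by (auto simp: b_def)
  have bb: "kbd U b B = 0" if "B \<subseteq> U" for B
    using insert.prems(3)[of "insert u B"] kbd_insert_in[OF less that, of k] that by (auto simp: b_def[abs_def])
  have restr_kbd: "restr (V - U) (kbd U k' {}) = 0" for k' :: "nat set \<Rightarrow> 'k mpoly"
    by (simp add: kbd_def restr_sum restr_indet)
  have "indet u * restr (V - U) (b {}) = 0"
    using arg_cong[OF kb[of "{}"], of "restr (V - U)"] restr_kbd[of k] uV uU by (simp add: restr_indet)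
  then have "restr (V - U) (b {}) = 0" by simp
  from insert.IH[OF UV bV bb this] obtain b' where b': "\<And>B. B \<subseteq> U \<Longrightarrow> b' B \<in> PV V \<and> kbd U b' B = b B" by blast
  have "restr (V - U - {u}) (restr (V - U) (k {})) = 0"
  proof -
    have "(V - U - {u}) \<inter> (V - U) = V - insert u U" by auto
    then show ?thesis using insert.prems(4) by simp
  qed
  from ker_restr_single_variable[OF restr_in_PV_self this] obtain r where
    r: "r \<in> PV (V - U)" "restr (V - U) (k {}) = indet u * r" by blast
  \<comment> \<open>No coefficient of a boundary depends on the value at the empty set, so this
    value may be changed to \<open>r\<close>. The choice makes \<open>a {}\<close> below vanish
    modulo the variables of \<open>U\<close>.\<close>
  define c where "c = b'({} := r)"
  have cV: "c B \<in> PV V" if "B \<subseteq> U" for B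
    using b'[OF that] PV_mono[OF _ r(1), of V] by (auto simp: c_def)
  have cb: "kbd U c B = b B" if "B \<subseteq> U" for B
    using b'[OF that] kbd_cong[of U c b' B] that by (auto simp: c_def)
  \<comment> \<open>Subtracting what the terms with \<open>u\<close> contribute leaves a cycle of
    the smaller complex, to which the induction hypothesis applies a second time.\<close>
  define a where "a B = k B - (- 1) ^ card B * indet u * c B" for B
  have aV: "a B \<in> PV V" if "B \<subseteq> U" for B
    unfolding a_def using kV[OF subset_insertI2[OF that]] cV[OF that] uV by simp
  have ab: "kbd U a B = 0" if B: "B \<subseteq> U" for B
  proof -
    have "kbd U a B = kbd U k B - (\<Sum>w\<in>U - B. kcoeff w (insert w B) * ((- 1) ^ card (insert w B) * indet u * c (insert w B)))"
      by (simp add: kbd_def a_def right_diff_distrib sum_subtractf)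
    also have "(\<Sum>w\<in>U - B. kcoeff w (insert w B) * ((- 1) ^ card (insert w B) * indet u * c (insert w B))) =
      (\<Sum>w\<in>U - B. - ((- 1) ^ card B * indet u) * (kcoeff w (insert w B) * c (insert w B)))"
      using finite_subset[OF B insert.hyps(1)] by (intro sum.cong) (auto simp: algebra_simps)
    also have "\<dots> = - ((- 1) ^ card B * indet u) * b B"
      unfolding sum_distrib_left[symmetric] cb[OF B, symmetric] by (simp add: kbd_def)
    finally show ?thesis using kb[OF B] by simp
  qed
  have "restr (V - U) (a {}) = 0"
    using r uV uU by (simp add: a_def c_def restr_indet in_PV_iff_restr)
  from insert.IH[OF UV aV ab this] obtain a' where a': "\<And>B. B \<subseteq> U \<Longrightarrow> a' B \<in> PV V \<and> kbd U a' B = a B" by blast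
  define k' where "k' B = (if u \<in> B then c (B - {u}) else a' B)" for B
  have "k' B \<in> PV V \<and> kbd (insert u U) k' B = k B" if B: "B \<subseteq> insert u U" for B
  proof (cases "u \<in> B")
    case True
    then have BU: "B - {u} \<subseteq> U" and ins: "insert u (B - {u}) = B" using B by auto
    have "kbd (insert u U) k' B = kbd U (\<lambda>B. k' (insert u B)) (B - {u})"
      using kbd_insert_in[OF less BU, of k'] ins by simp
    also have "\<dots> = kbd U c (B - {u})"
      by (rule kbd_cong[OF _ BU]) (use uU in \<open>auto simp: k'_def insert_absorb intro!: arg_cong[of _ _ c]\<close>)
    also have "\<dots> = k B" using cb[OF BU] ins by (simp add: b_def)
    finally show ?thesis using cV[OF BU] True by (simp add: k'_def)
  next
    case False
    then have BU: "B \<subseteq> U" using B by auto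
    have "kbd (insert u U) k' B = kbd U k' B + (- 1) ^ card B * indet u * k' (insert u B)"
      by (rule kbd_insert_out[OF insert.hyps(1) less BU])
    also have "k' (insert u B) = c B" using False by (simp add: k'_def)
    also have "kbd U k' B = kbd U a' B"
      by (rule kbd_cong[OF _ BU]) (use uU in \<open>auto simp: k'_def\<close>)
    also have "kbd U a' B = a B" using a'[OF BU] by blast
    finally have "kbd (insert u U) k' B = a B + (- 1) ^ card B * indet u * c B" .
    moreover have "k' B \<in> PV V" using a'[OF BU] False by (simp add: k'_def)
    ultimately show ?thesis by (simp add: a_def)
  qed
  then show ?case by blast
qed

definition kchains :: "nat set \<Rightarrow> nat set \<Rightarrow> nat \<Rightarrow> (nat set \<Rightarrow> 'k::field mpoly) set" where
  "kchains V U i = {k. \<forall>B. k B \<in> PV V \<and> (k B \<noteq> 0 \<longrightarrow> B \<subseteq> U \<and> card B = i)}"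

definition kdiff :: "nat set \<Rightarrow> (nat set \<Rightarrow> 'k::field mpoly) \<Rightarrow> nat set \<Rightarrow> 'k mpoly" where
  "kdiff U k B = (if B \<subseteq> U then kbd U k B else 0)"

lemma kdiff_lift:
  fixes x :: "nat set \<Rightarrow> 'k::field mpoly"
  assumes U: "finite U" "U \<subseteq> V" and x: "x \<in> kchains V U i" "\<And>B. B \<subseteq> U \<Longrightarrow> kbd U x B = 0" "restr (V - U) (x {}) = 0"
  shows "x \<in> kdiff U ` kchains V U (Suc i)"
proof -
  have "\<exists>k'. (\<forall>B\<subseteq>U. k' B \<in> PV V \<and> kbd U k' B = x B)"
    by (rule koszul_exact[OF U]) (use x in \<open>auto simp: kchains_def\<close>)
  then obtain k' where k': "\<And>B. B \<subseteq> U \<Longrightarrow> k' B \<in> PV V \<and> kbd U k' B = x B" by blast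
  \<comment> \<open>The preimage found above need not be homogeneous. As the differential lowers the
    size by one, only the component of size \<open>Suc i\<close> matters.\<close>
  define y where "y B = (if B \<subseteq> U \<and> card B = Suc i then k' B else 0)" for B
  have y: "y \<in> kchains V U (Suc i)" using k' by (auto simp: y_def kchains_def)
  have "kbd U y B = x B" if B: "B \<subseteq> U" for B
  proof -
    have fin: "finite B" using B U finite_subset by blast
    show ?thesis
    proof (cases "card B = i")
      case True
      then have "kbd U y B = kbd U k' B"
        unfolding kbd_def using B fin by (intro sum.cong) (auto simp: y_def)
      then show ?thesis using k'[OF B] by simp
    next
      case False
      then have "kbd U y B = 0"
        unfolding kbd_def using B fin by (intro sum.neutral) (auto simp: y_def)
      moreover have "x B = 0" using x(1) False by (auto simp: kchains_def)
      ultimately show ?thesis by simp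
    qed
  qed
  moreover have "x B = 0" if "\<not> B \<subseteq> U" for B using x(1) that by (auto simp: kchains_def)
  ultimately have "kdiff U y = x" by (auto simp: kdiff_def)
  then show ?thesis using y by blast
qed

lemma acyclic_koszul:
  assumes U: "finite U" "U \<subseteq> V"
  shows "acyclic_complex V (kchains V U :: nat \<Rightarrow> (nat set \<Rightarrow> 'k::field_char_0 mpoly) set) (\<lambda>i. kdiff U)"
proof
  show "(\<lambda>_. 0) \<in> kchains V U i" for i by (simp add: kchains_def)
next
  fix x y :: "nat set \<Rightarrow> 'k mpoly" and i assume "x \<in> kchains V U i" "y \<in> kchains V U i"
  then show "(\<lambda>b. x b + y b) \<in> kchains V U i" by (force simp: kchains_def)
next
  fix x :: "nat set \<Rightarrow> 'k mpoly" and p :: "'k mpoly" and i assume "p \<in> PV V" "x \<in> kchains V U i"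
  then show "(\<lambda>b. p * x b) \<in> kchains V U i" by (auto simp: kchains_def)
next
  fix x :: "nat set \<Rightarrow> 'k mpoly" and i assume x: "x \<in> kchains V U (Suc i)"
  have "kdiff U x B \<in> PV V" for B
    using x by (auto simp: kdiff_def kchains_def intro!: kbd_in_PV[OF U(2)])
  moreover have "card B = i" if B: "B \<subseteq> U" and ne: "kbd U x B \<noteq> 0" for B
  proof -
    obtain u where "u \<in> U - B" "x (insert u B) \<noteq> 0"
      using ne unfolding kbd_def by (metis (no_types, lifting) mult_zero_right sum.neutral)
    then show ?thesis using x finite_subset[OF B U(1)] by (auto simp: kchains_def)
  qed
  ultimately show "kdiff U x \<in> kchains V U i" by (auto simp: kchains_def kdiff_def)
next
  fix x y :: "nat set \<Rightarrow> 'k mpoly"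
  show "kdiff U (\<lambda>b. x b + y b) = (\<lambda>b. kdiff U x b + kdiff U y b)"
    by (auto simp: kdiff_def kbd_def distrib_left sum.distrib)
next
  fix x :: "nat set \<Rightarrow> 'k mpoly" and p :: "'k mpoly"
  show "kdiff U (\<lambda>b. p * x b) = (\<lambda>b. p * kdiff U x b)"
    by (auto simp: kdiff_def kbd_def sum_distrib_left algebra_simps)
next
  fix x :: "nat set \<Rightarrow> 'k mpoly" and i assume x: "x \<in> kchains V U (Suc i)" and z: "kdiff U x = (\<lambda>_. 0)"
  have "kbd U x B = 0" if "B \<subseteq> U" for B using fun_cong[OF z, of B] that by (simp add: kdiff_def)
  \<comment> \<open>In positive degree there is no coefficient at the empty set, so the condition of
    \<open>kdiff_lift\<close> on it holds automatically.\<close>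
  moreover have "x {} = 0" using x by (auto simp: kchains_def)
  ultimately have "x \<in> kdiff U ` kchains V U (Suc (Suc i))" using kdiff_lift[OF U x] by simp
  then show "\<exists>y\<in>kchains V U (Suc (Suc i)). kdiff U y = x" by auto
qed

text \<open>This reconciles the two forms of the differential, by coefficients and by basis
  elements. It makes the unit vectors a Koszul family, namely the identity chain map.\<close>

lemma kbd_unit:
  assumes U: "finite U" "A \<subseteq> U" "B \<subseteq> U"
  shows "kbd U (\<lambda>B. if B = A then 1 else 0) B = (\<Sum>u\<in>A. kcoeff u A * (if B = A - {u} then 1 else 0 :: 'k::field mpoly))"
proof (cases "\<exists>u\<in>A. B = A - {u}")
  case True
  then obtain u where u: "u \<in> A" "B = A - {u}" by blast
  have fA: "finite A" using U finite_subset by blast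
  have "kbd U (\<lambda>B. if B = A then 1 else 0) B = (\<Sum>w\<in>{u}. kcoeff w A :: 'k mpoly)"
    unfolding kbd_def
  proof (rule sum.mono_neutral_cong_right)
    show "\<forall>i\<in>U - B - {u}. kcoeff i (insert i B) * (if insert i B = A then 1 else 0 :: 'k mpoly) = 0"
      using u by auto
  qed (use u U in \<open>auto simp: insert_absorb\<close>)
  also have "(\<Sum>w\<in>{u}. kcoeff w A :: 'k mpoly) = (\<Sum>w\<in>A. kcoeff w A * (if B = A - {w} then 1 else 0))"
    by (rule sum.mono_neutral_cong_left) (use u fA in auto)
  finally show ?thesis .
next
  case False
  have "insert w B \<noteq> A" if "w \<in> U - B" for w using that False by auto
  then have "kbd U (\<lambda>B. if B = A then 1 else 0) B = (0 :: 'k mpoly)" unfolding kbd_def by (intro sum.neutral) auto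
  moreover have "(\<Sum>u\<in>A. kcoeff u A * (if B = A - {u} then 1 else 0 :: 'k mpoly)) = 0"
    using False by (intro sum.neutral) auto
  ultimately show ?thesis by simp
qed

section \<open>The canonical module\<close>

lemma kbd_kchains_0:
  assumes "k \<in> kchains V U 0" "finite U" "A \<subseteq> U"
  shows "kbd U k A = 0"
  unfolding kbd_def
proof (rule sum.neutral, rule ballI)
  fix u
  have "finite (insert u A)" using assms(2,3) finite_subset by auto
  then have "card (insert u A) \<noteq> 0" by simp
  then have "k (insert u A) = 0" using assms(1) by (auto simp: kchains_def)
  then show "kcoeff u (insert u A) * k (insert u A) = 0" by simp
qed

lemma module_regular_module:
  assumes "cring R"
  shows "Module.module R (regular_module R)"
proof -
  interpret cring R by fact
  have "abelian_group (regular_module R)"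
    by (rule abelian_groupI) (auto simp: a_ac intro: l_neg)
  then show ?thesis
    by (intro Module.moduleI assms) (auto simp: l_distr r_distr m_assoc)
qed

text \<open>The face \<open>F\<close> stands for a component that is a simplex: no edge leaves it.
  The resolution is arbitrary, because a canonical module is only known to come from some
  resolution.\<close>

locale SR_resolution = SR_char_0 k V \<Delta> for k :: "'k::field_char_0 itself" and V \<Delta> +
  fixes B :: "nat \<Rightarrow> 'b set" and d :: "nat \<Rightarrow> ('b \<Rightarrow> 'k mpoly) \<Rightarrow> 'b \<Rightarrow> 'k mpoly"
    and e :: "('b \<Rightarrow> 'k mpoly) \<Rightarrow> 'k mpoly set" and F :: "nat set"
  assumes res: "free_resolution (poly_ring TYPE('k) V)
      (quotient_module (regular_module (poly_ring TYPE('k) V)) (SR_ideal TYPE('k) V \<Delta>)) B d e"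
    and F: "F \<in> \<Delta>" and isolated: "\<And>u w. u \<in> V - F \<Longrightarrow> w \<in> F \<Longrightarrow> {u, w} \<notin> \<Delta>"
begin

abbreviation "P \<equiv> poly_ring TYPE('k) V"
abbreviation "U \<equiv> V - F"
abbreviation "C i \<equiv> carrier (free_module P (B i))"
abbreviation "dual i \<equiv> Defs.module_hom P (free_module P (B i)) (regular_module P)"

lemma fin_U: "finite U" "U \<subseteq> V" and F_sub: "F \<subseteq> V" and V_minus_U: "V - U = F"
  using fin_V sub_V[OF F] by auto

lemma C_add_eq: "f \<oplus>\<^bsub>free_module P (B i)\<^esub> g = (\<lambda>b. f b + g b)"
  and C_smult_eq: "p \<odot>\<^bsub>free_module P (B i)\<^esub> f = (\<lambda>b. p * f b)"
  and C_zero_eq: "\<zero>\<^bsub>free_module P (B i)\<^esub> = (\<lambda>b. 0)"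
  by (simp_all add: free_module_simps)

lemma C_closed:
  "(\<lambda>_. 0) \<in> C i" "f \<in> C i \<Longrightarrow> g \<in> C i \<Longrightarrow> (\<lambda>b. f b + g b) \<in> C i" "p \<in> PV V \<Longrightarrow> f \<in> C i \<Longrightarrow> (\<lambda>b. p * f b) \<in> C i"
proof -
  interpret M: Module.module P "free_module P (B i)" by (rule module_free_module[OF cring_poly_ring])
  show "(\<lambda>_. 0) \<in> C i" using M.M.zero_closed by (simp only: C_zero_eq)
  show "f \<in> C i \<Longrightarrow> g \<in> C i \<Longrightarrow> (\<lambda>b. f b + g b) \<in> C i" using M.M.a_closed[of f g] by (simp only: C_add_eq)
  show "p \<in> PV V \<Longrightarrow> f \<in> C i \<Longrightarrow> (\<lambda>b. p * f b) \<in> C i" using M.smult_closed[of p f] by (simp only: C_smult_eq)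
qed

lemma rquot: "quot_module P (regular_module P) I"
proof -
  interpret M: Module.module P "regular_module P" by (rule module_regular_module[OF cring_poly_ring])
  have inv: "\<ominus>\<^bsub>regular_module P\<^esub> a = - a" if "a \<in> PV V" for a
    by (rule M.M.minus_equality) (use that in auto)
  have "submodule I P (regular_module P)"
    by (rule M.submoduleI) (use I_closed in \<open>auto simp: inv subset_iff\<close>)
  then show ?thesis
    by (intro quot_module.intro quot_module_axioms.intro module_regular_module cring_poly_ring)
qed

lemma regular_coset: "I +>\<^bsub>regular_module P\<^esub> p = cls p"
  by (simp add: cls_def a_r_coset_def r_coset_def)

lemma e_hom: "e \<in> Defs.module_hom P (free_module P (B 0)) (quotient_module (regular_module P) I)"
  and e_surj: "e ` C 0 = cls ` PV V"
  and d_hom: "d i \<in> Defs.module_hom P (free_module P (B (Suc i))) (free_module P (B i))"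
  and d0_image: "d 0 ` C (Suc 0) = {x \<in> C 0. e x = cls 0}"
  and d_image: "d (Suc i) ` C (Suc (Suc i)) = {x \<in> C (Suc i). d i x = (\<lambda>_. 0)}"
proof -
  interpret q: quot_module P "regular_module P" I by (rule rquot)
  have zero: "\<zero>\<^bsub>quotient_module (regular_module P) I\<^esub> = cls 0"
    by (simp add: q.Q_zero regular_coset)
  have carr: "carrier (quotient_module (regular_module P) I) = cls ` PV V"
    by (simp add: q.carrier_Q regular_coset)
  note r = res[unfolded free_resolution_def Let_def zero carr C_zero_eq]
  show "e \<in> Defs.module_hom P (free_module P (B 0)) (quotient_module (regular_module P) I)"
    "e ` C 0 = cls ` PV V" "d i \<in> Defs.module_hom P (free_module P (B (Suc i))) (free_module P (B i))"
    "d 0 ` C (Suc 0) = {x \<in> C 0. e x = cls 0}"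
    "d (Suc i) ` C (Suc (Suc i)) = {x \<in> C (Suc i). d i x = (\<lambda>_. 0)}"
    using r by blast+
qed

lemma e_add: "x \<in> C 0 \<Longrightarrow> y \<in> C 0 \<Longrightarrow> p \<in> PV V \<Longrightarrow> q \<in> PV V \<Longrightarrow> e x = cls p \<Longrightarrow> e y = cls q \<Longrightarrow>
    e (\<lambda>b. x b + y b) = cls (p + q)"
  and e_smult: "x \<in> C 0 \<Longrightarrow> p \<in> PV V \<Longrightarrow> r \<in> PV V \<Longrightarrow> e x = cls p \<Longrightarrow> e (\<lambda>b. r * x b) = cls (r * p)"
proof -
  interpret q: quot_module P "regular_module P" I by (rule rquot)
  show "x \<in> C 0 \<Longrightarrow> y \<in> C 0 \<Longrightarrow> p \<in> PV V \<Longrightarrow> q \<in> PV V \<Longrightarrow> e x = cls p \<Longrightarrow> e y = cls q \<Longrightarrow>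
    e (\<lambda>b. x b + y b) = cls (p + q)"
    using module_homD(2)[OF e_hom, of x y] q.Q_add[of p q] by (simp add: C_add_eq regular_coset)
  show "x \<in> C 0 \<Longrightarrow> p \<in> PV V \<Longrightarrow> r \<in> PV V \<Longrightarrow> e x = cls p \<Longrightarrow> e (\<lambda>b. r * x b) = cls (r * p)"
    using module_homD(3)[OF e_hom, of r x] q.Q_smult[of r p] by (simp add: C_smult_eq regular_coset)
qed

sublocale cx: acyclic_complex V "\<lambda>i. C i" d
proof
  fix i x y p
  show "(\<lambda>_. 0) \<in> C i" "x \<in> C i \<Longrightarrow> y \<in> C i \<Longrightarrow> (\<lambda>b. x b + y b) \<in> C i"
    "p \<in> PV V \<Longrightarrow> x \<in> C i \<Longrightarrow> (\<lambda>b. p * x b) \<in> C i" by (rule C_closed; assumption)+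
  show "x \<in> C (Suc i) \<Longrightarrow> d i x \<in> C i" by (rule module_homD(1)[OF d_hom])
  show "x \<in> C (Suc i) \<Longrightarrow> y \<in> C (Suc i) \<Longrightarrow> d i (\<lambda>b. x b + y b) = (\<lambda>b. d i x b + d i y b)"
    using module_homD(2)[OF d_hom, of x i y] by (simp only: C_add_eq)
  show "p \<in> PV V \<Longrightarrow> x \<in> C (Suc i) \<Longrightarrow> d i (\<lambda>b. p * x b) = (\<lambda>b. p * d i x b)"
    using module_homD(3)[OF d_hom, of p x i] by (simp only: C_smult_eq)
  show "x \<in> C (Suc i) \<Longrightarrow> d i x = (\<lambda>_. 0) \<Longrightarrow> \<exists>y\<in>C (Suc (Suc i)). d (Suc i) y = x"
    using d_image[of i] by (metis (mono_tags, lifting) imageE mem_Collect_eq)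
qed

lemma dd_zero: "y \<in> C (Suc (Suc i)) \<Longrightarrow> d i (d (Suc i) y) = (\<lambda>_. 0)"
  using d_image[of i] by (metis (mono_tags, lifting) imageI mem_Collect_eq)

text \<open>A chain map from the Koszul complex of \<open>U\<close> to the resolution that induces
  the map from k[F] to the Stanley-Reisner ring sending 1 to the class of \<open>p\<close>.\<close>

definition augmented :: "'k mpoly \<Rightarrow> (nat set \<Rightarrow> 'b \<Rightarrow> 'k mpoly) \<Rightarrow> bool" where
  "augmented p f \<longleftrightarrow> cx.koszul_family U f \<and> p \<in> PV V \<and> e (f {}) = cls p"

lemma augmented_empty: "augmented p f \<Longrightarrow> f {} \<in> C 0"
  by (auto simp: augmented_def cx.koszul_family_def)

lemma augmented_top: "augmented p f \<Longrightarrow> f U \<in> C (card U)"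
  by (auto simp: augmented_def cx.koszul_family_def)

text \<open>Multiplication with x_v is well defined from k[F] to the Stanley-Reisner ring, since x_v
  annihilates the variables outside \<open>F\<close>; hence it lifts to a comparison map.\<close>

lemma augmented_exists:
  assumes v: "v \<in> F"
  shows "\<exists>f. augmented (indet v) f"
proof -
  have vV: "indet v \<in> PV V" using v F_sub by auto
  then obtain x where x: "x \<in> C 0" "e x = cls (indet v)" using e_surj by (metis (no_types, lifting) imageE imageI)
  have "\<exists>f. cx.koszul_family U f \<and> f {} = x"
  proof (rule cx.koszul_family_exists[OF fin_U x(1)])
    fix u assume u: "u \<in> U"
    have "indet v * indet u \<in> I"
      by (rule ker_mult_indet_in_I[OF v F_sub isolated]) (use u in \<open>auto simp: restr_indet\<close>)
    then have "cls (indet u * indet v) = cls 0" by (simp add: cls_eq_iff mult.commute)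
    moreover have "e (\<lambda>b. indet u * x b) = cls (indet u * indet v)"
      by (rule e_smult[OF x(1) vV _ x(2)]) (use u in simp)
    ultimately show "(\<lambda>b. indet u * x b) \<in> d 0 ` C (Suc 0)"
      unfolding d0_image using C_closed(3)[of "indet u" x 0] x(1) u by simp
  qed
  then show ?thesis using x vV by (auto simp: augmented_def)
qed

section \<open>Evaluation of cocycles on Koszul families\<close>

definition cocycles :: "(('b \<Rightarrow> 'k mpoly) \<Rightarrow> 'k mpoly) set" where
  "cocycles = {z \<in> dual (card U). \<forall>x\<in>C (Suc (card U)). z (d (card U) x) = 0}"

lemma functional_simps:
  assumes "z \<in> dual i"
  shows "x \<in> C i \<Longrightarrow> z x \<in> PV V" "x \<in> C i \<Longrightarrow> y \<in> C i \<Longrightarrow> z (\<lambda>b. x b + y b) = z x + z y"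
    "p \<in> PV V \<Longrightarrow> x \<in> C i \<Longrightarrow> z (\<lambda>b. p * x b) = p * z x" "z (\<lambda>_. 0) = 0"
    "x \<in> C i \<Longrightarrow> y \<in> C i \<Longrightarrow> z (\<lambda>b. x b - y b) = z x - z y"
proof -
  show "x \<in> C i \<Longrightarrow> z x \<in> PV V" using module_homD(1)[OF assms] by simp
  show add: "x \<in> C i \<Longrightarrow> y \<in> C i \<Longrightarrow> z (\<lambda>b. x b + y b) = z x + z y" for x y
    using module_homD(2)[OF assms, of x y] by (simp add: C_add_eq)
  show smult: "p \<in> PV V \<Longrightarrow> x \<in> C i \<Longrightarrow> z (\<lambda>b. p * x b) = p * z x" for p x
    using module_homD(3)[OF assms, of p x] by (simp add: C_smult_eq)
  show "z (\<lambda>_. 0) = 0" using smult[of 0 "\<lambda>_. 0"] C_closed(1) by simp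
  show "x \<in> C i \<Longrightarrow> y \<in> C i \<Longrightarrow> z (\<lambda>b. x b - y b) = z x - z y"
    using add[of x "\<lambda>b. - 1 * y b"] smult[of "- 1" y] C_closed(3)[of "- 1" y i] by simp
qed

text \<open>Every coefficient of \<open>kdel h U\<close> is a multiple of a variable outside
  \<open>F\<close>, and linearity carries this over to the value of \<open>z\<close>.\<close>

lemma functional_kdel:
  assumes z: "z \<in> dual i"
    and h: "\<And>u. u \<in> U \<Longrightarrow> h (U - {u}) \<in> C i"
  shows "restr F (z (kdel h U)) = 0"
proof -
  have "z (\<lambda>b. \<Sum>u\<in>A. kcoeff u U * h (U - {u}) b) = (\<Sum>u\<in>A. kcoeff u U * z (h (U - {u}))) \<and>
    (\<lambda>b. \<Sum>u\<in>A. kcoeff u U * h (U - {u}) b) \<in> C i" if "finite A" "A \<subseteq> U" for A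
    using that
  proof (induction A rule: finite_induct)
    case (insert a A)
    have a: "kcoeff a U \<in> PV V" by (rule kcoeff_in_PV) (use insert.prems in auto)
    have "h (U - {a}) \<in> C i" using h insert.prems by auto
    then have *: "(\<lambda>b. kcoeff a U * h (U - {a}) b) \<in> C i" "z (\<lambda>b. kcoeff a U * h (U - {a}) b) = kcoeff a U * z (h (U - {a}))"
      using C_closed(3)[OF a] functional_simps(3)[OF z a] by auto
    then show ?case
      using insert functional_simps(2)[OF z *(1)] C_closed(2)[OF *(1)] by simp
  qed (simp add: functional_simps(4)[OF z] C_closed)
  then have "z (kdel h U) = (\<Sum>u\<in>U. kcoeff u U * z (h (U - {u})))"
    unfolding kdel_def using fin_U(1) by blast
  then show ?thesis by (simp add: restr_sum restr_kcoeff)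
qed

text \<open>A null homotopy writes \<open>g U\<close> as a boundary plus \<open>kdel h U\<close>.
  The cocycle kills the boundary, and restriction to \<open>F\<close> kills the value on the
  rest.\<close>

lemma cocycle_null:
  assumes z: "z \<in> cocycles" and g: "cx.koszul_family U g" and g0: "e (g {}) = cls 0"
  shows "restr F (z (g U)) = 0"
proof -
  have zh: "z \<in> dual (card U)"
    and zd: "\<And>x. x \<in> C (Suc (card U)) \<Longrightarrow> z (d (card U) x) = 0" using z by (auto simp: cocycles_def)
  have "g {} \<in> C 0" using g by (auto simp: cx.koszul_family_def)
  then have "g {} \<in> d 0 ` C (Suc 0)" unfolding d0_image using g0 by simp
  from cx.koszul_family_null[OF fin_U g this] obtain h where
    h: "\<And>A. A \<subseteq> U \<Longrightarrow> h A \<in> C (Suc (card A))" "\<And>A. A \<subseteq> U \<Longrightarrow> d (card A) (h A) = (\<lambda>b. g A b - kdel h A b)"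
    by blast
  have hU: "h (U - {u}) \<in> C (card U)" if "u \<in> U" for u
  proof -
    have "Suc (card (U - {u})) = card U" using card_Suc_Diff1[OF fin_U(1) that] .
    then show ?thesis using h(1)[of "U - {u}"] by simp
  qed
  have gU: "g U \<in> C (card U)" using g by (auto simp: cx.koszul_family_def)
  have kU: "kdel h U \<in> C (card U)" by (rule cx.kdel_closed[OF fin_U]) (rule hU)
  have "z (\<lambda>b. g U b - kdel h U b) = 0" using zd[OF h(1)[OF order_refl]] h(2)[OF order_refl] by simp
  then have "z (g U) = z (kdel h U)" by (simp add: functional_simps(5)[OF zh gU kU])
  then show ?thesis using functional_kdel[OF zh, of h] hU by simp
qed

text \<open>Both \<open>q\<close> times \<open>f\<close> and \<open>p\<close> times \<open>g\<close>
  lift multiplication with \<open>p * q\<close>, so their difference is null homotopic.\<close>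

lemma cocycle_compat:
  assumes z: "z \<in> cocycles" and f: "augmented p f" and g: "augmented q g" and pq: "restr F p = p" "restr F q = q"
  shows "q * restr F (z (f U)) = p * restr F (z (g U))"
proof -
  have zh: "z \<in> dual (card U)" using z by (auto simp: cocycles_def)
  have fk: "cx.koszul_family U f" "cx.koszul_family U g" and PV: "p \<in> PV V" "q \<in> PV V"
    and aug: "e (f {}) = cls p" "e (g {}) = cls q" using f g by (auto simp: augmented_def)
  let ?h = "\<lambda>A b. q * f A b - p * g A b"
  have "cx.koszul_family U ?h"
    by (intro cx.koszul_family_diff cx.koszul_family_smult fk PV fin_U)
  moreover have "e (?h {}) = cls 0"
  proof -
    note c = augmented_empty[OF f] augmented_empty[OF g]
    have "e (\<lambda>b. q * f {} b + - p * g {} b) = cls (q * p + - p * q)"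
      by (intro e_add e_smult C_closed c PV PV_closed aug)
    then show ?thesis by simp
  qed
  ultimately have "restr F (z (?h U)) = 0" by (rule cocycle_null[OF z])
  also have "z (?h U) = q * z (f U) - p * z (g U)"
    using augmented_top[OF f] augmented_top[OF g] PV
    by (simp add: functional_simps(3,5)[OF zh] C_closed(3))
  finally show ?thesis using pq by simp
qed

text \<open>One component of a comparison map from the resolution to the Koszul complex. The last
  clause is the induction invariant: boundaries go to boundaries. It allows the next component to be
  chosen on basis vectors without looking at the previous ones.\<close>

definition chain_component :: "nat \<Rightarrow> (('b \<Rightarrow> 'k mpoly) \<Rightarrow> nat set \<Rightarrow> 'k mpoly) \<Rightarrow> bool" where
  "chain_component i g \<longleftrightarrow> (\<forall>x\<in>C i. g x \<in> kchains V U i) \<and>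
     (\<forall>x\<in>C i. \<forall>y\<in>C i. g (\<lambda>b. x b + y b) = (\<lambda>A. g x A + g y A)) \<and>
     (\<forall>p\<in>PV V. \<forall>x\<in>C i. g (\<lambda>b. p * x b) = (\<lambda>A. p * g x A)) \<and>
     (\<forall>y\<in>C (Suc i). g (d i y) \<in> kdiff U ` kchains V U (Suc i))"

definition extend :: "('b \<Rightarrow> nat set \<Rightarrow> 'k mpoly) \<Rightarrow> ('b \<Rightarrow> 'k mpoly) \<Rightarrow> nat set \<Rightarrow> 'k mpoly" where
  "extend y x A = lin_ext P id (\<lambda>b. y b A) x"

lemma hom_id: "hom_to_type P id"
  by (simp add: hom_to_type_def)

lemma extend_add: "x \<in> C i \<Longrightarrow> x' \<in> C i \<Longrightarrow> extend y (\<lambda>b. x b + x' b) = (\<lambda>A. extend y x A + extend y x' A)"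
  using lin_ext_add[OF cring_poly_ring hom_id, of x "B i" x'] by (simp add: extend_def[abs_def] C_add_eq)

lemma extend_smult: "p \<in> PV V \<Longrightarrow> x \<in> C i \<Longrightarrow> extend y (\<lambda>b. p * x b) = (\<lambda>A. p * extend y x A)"
  using lin_ext_smult[OF cring_poly_ring hom_id, of x "B i" p] by (simp add: extend_def[abs_def] C_smult_eq)

lemma extend_unit: "extend y (unit_vec P b) = y b"
  by (simp add: extend_def[abs_def] lin_ext_unit[OF cring_poly_ring hom_id])

lemma C_induct [consumes 1, case_names zero unit add smult]:
  assumes "x \<in> C i" "Q (\<lambda>_. 0)" "\<And>b. b \<in> B i \<Longrightarrow> unit_vec P b \<in> C i \<Longrightarrow> Q (unit_vec P b)"
    "\<And>x y. x \<in> C i \<Longrightarrow> y \<in> C i \<Longrightarrow> Q x \<Longrightarrow> Q y \<Longrightarrow> Q (\<lambda>b. x b + y b)"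
    "\<And>p x. p \<in> PV V \<Longrightarrow> x \<in> C i \<Longrightarrow> Q x \<Longrightarrow> Q (\<lambda>b. p * x b)"
  shows "Q x"
proof (rule free_module_induct[OF cring_poly_ring assms(1)])
  show "Q (unit_vec P b)" if "b \<in> B i" for b
    using assms(3)[OF that unit_vec_closed[OF cring_poly_ring that]] .
qed (use assms in simp_all)

lemma extend_kchains:
  assumes "\<And>b. b \<in> B i \<Longrightarrow> y b \<in> kchains V U j" "x \<in> C i"
  shows "extend y x \<in> kchains V U j"
  using assms(2)
proof (induction x rule: C_induct)
  case zero
  have "extend y (\<lambda>_. 0) = (\<lambda>_. 0)" by (simp add: extend_def[abs_def] lin_ext_def)
  then show ?case by (simp add: kchains_def)
next
  case (add x x')
  then show ?case
    unfolding extend_add[OF add(1,2)] by (intro acyclic_complex.add[OF acyclic_koszul[OF fin_U]])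
next
  case (smult p x)
  then show ?case
    unfolding extend_smult[OF smult(1,2)] by (intro acyclic_complex.smult[OF acyclic_koszul[OF fin_U]])
qed (simp add: extend_unit assms(1))

text \<open>By the invariant each basis vector has a Koszul preimage, and these are extended
  linearly. The invariant in the next degree follows from exactness of the Koszul complex, because
  two successive differentials of the resolution compose to zero.\<close>

lemma chain_component_step:
  assumes g: "chain_component i g"
  shows "\<exists>g'. chain_component (Suc i) g' \<and> (\<forall>x\<in>C (Suc i). kdiff U (g' x) = g (d i x))"
proof -
  interpret K: acyclic_complex V "kchains V U :: nat \<Rightarrow> (nat set \<Rightarrow> 'k mpoly) set" "\<lambda>i. kdiff U"
    by (rule acyclic_koszul[OF fin_U])
  have unitC: "unit_vec P b \<in> C j" if "b \<in> B j" for b j using unit_vec_closed[OF cring_poly_ring that] .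
  have "\<forall>b. \<exists>y. b \<in> B (Suc i) \<longrightarrow> y \<in> kchains V U (Suc i) \<and> kdiff U y = g (d i (unit_vec P b))"
  proof
    fix b
    show "\<exists>y. b \<in> B (Suc i) \<longrightarrow> y \<in> kchains V U (Suc i) \<and> kdiff U y = g (d i (unit_vec P b))"
    proof (cases "b \<in> B (Suc i)")
      case True
      then have "g (d i (unit_vec P b)) \<in> kdiff U ` kchains V U (Suc i)"
        using g unitC[OF True] by (simp add: chain_component_def)
      then show ?thesis by auto
    qed simp
  qed
  then obtain y where y: "\<And>b. b \<in> B (Suc i) \<Longrightarrow> y b \<in> kchains V U (Suc i)"
    "\<And>b. b \<in> B (Suc i) \<Longrightarrow> kdiff U (y b) = g (d i (unit_vec P b))" by metis
  define g' where "g' = extend y"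
  have g'c: "g' x \<in> kchains V U (Suc i)" if "x \<in> C (Suc i)" for x
    unfolding g'_def by (rule extend_kchains[OF y(1) that])
  have gd: "g (\<lambda>_. 0) = (\<lambda>_. 0)" "g' (\<lambda>_. 0) = (\<lambda>_. 0)"
  proof -
    have "g (\<lambda>b. 0 * (0 :: 'k mpoly)) = (\<lambda>A. 0 * g (\<lambda>_. 0) A)"
      using g C_closed(1)[of i] by (auto simp: chain_component_def dest!: bspec[of _ _ 0] bspec[of _ _ "\<lambda>_. 0"])
    then show "g (\<lambda>_. 0) = (\<lambda>_. 0)" by simp
    show "g' (\<lambda>_. 0) = (\<lambda>_. 0)" by (simp add: g'_def extend_def[abs_def] lin_ext_def)
  qed
  have comm: "kdiff U (g' x) = g (d i x)" if "x \<in> C (Suc i)" for x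
    using that
  proof (induction x rule: C_induct)
    case zero
    show ?case by (simp add: gd cx.dm_zero K.dm_zero)
  next
    case (unit b)
    then show ?case by (simp add: g'_def extend_unit y(2))
  next
    case (add x x')
    have "g (d i (\<lambda>b. x b + x' b)) = (\<lambda>A. g (d i x) A + g (d i x') A)"
      using g cx.dm_closed[OF add(1)] cx.dm_closed[OF add(2)] by (simp add: chain_component_def cx.dm_add[OF add(1,2)])
    moreover have "kdiff U (g' (\<lambda>b. x b + x' b)) = (\<lambda>A. kdiff U (g' x) A + kdiff U (g' x') A)"
      unfolding g'_def extend_add[OF add(1,2)] by (rule K.dm_add) (use g'c add in \<open>auto simp: g'_def\<close>)
    ultimately show ?case using add by simp
  next
    case (smult p x)
    have "g (d i (\<lambda>b. p * x b)) = (\<lambda>A. p * g (d i x) A)"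
      using g cx.dm_closed[OF smult(2)] smult(1) by (simp add: chain_component_def cx.dm_smult[OF smult(1,2)])
    moreover have "kdiff U (g' (\<lambda>b. p * x b)) = (\<lambda>A. p * kdiff U (g' x) A)"
      unfolding g'_def extend_smult[OF smult(1,2)] by (rule K.dm_smult) (use g'c smult in \<open>auto simp: g'_def\<close>)
    ultimately show ?case using smult by simp
  qed
  have "chain_component (Suc i) g'"
    unfolding chain_component_def
  proof (intro conjI ballI)
    fix w assume w: "w \<in> C (Suc (Suc i))"
    have dw: "d (Suc i) w \<in> C (Suc i)" by (rule cx.dm_closed[OF w])
    have "kdiff U (g' (d (Suc i) w)) = (\<lambda>_. 0)" using comm[OF dw] dd_zero[OF w] gd by simp
    from K.exact[OF g'c[OF dw] this] obtain y where
      y: "y \<in> kchains V U (Suc (Suc i))" "kdiff U y = g' (d (Suc i) w)" by blast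
    show "g' (d (Suc i) w) \<in> kdiff U ` kchains V U (Suc (Suc i))"
      unfolding y(2)[symmetric] by (rule imageI[OF y(1)])
  qed (use g'c in \<open>auto simp: g'_def extend_add extend_smult\<close>)
  then show ?thesis using comm by blast
qed

text \<open>Degree zero lifts the projection from the Stanley-Reisner ring to k[F]. A boundary of
  the resolution is represented in \<open>I\<close>, which restriction to \<open>F\<close> kills, so
  its image is a Koszul boundary.\<close>

lemma chain_component_base:
  "\<exists>g. chain_component 0 g \<and> (\<forall>x\<in>C 0. e x = cls (g x {}))"
proof -
  interpret K: acyclic_complex V "kchains V U :: nat \<Rightarrow> (nat set \<Rightarrow> 'k mpoly) set" "\<lambda>i. kdiff U"
    by (rule acyclic_koszul[OF fin_U])
  have "\<forall>b. \<exists>p. b \<in> B 0 \<longrightarrow> p \<in> PV V \<and> e (unit_vec P b) = cls p"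
  proof
    fix b
    show "\<exists>p. b \<in> B 0 \<longrightarrow> p \<in> PV V \<and> e (unit_vec P b) = cls p"
    proof (cases "b \<in> B 0")
      case True
      then have "e (unit_vec P b) \<in> cls ` PV V"
        unfolding e_surj[symmetric] by (intro imageI unit_vec_closed[OF cring_poly_ring])
      then show ?thesis by auto
    qed simp
  qed
  then obtain p where p: "\<And>b. b \<in> B 0 \<Longrightarrow> p b \<in> PV V" "\<And>b. b \<in> B 0 \<Longrightarrow> e (unit_vec P b) = cls (p b)" by metis
  define y where "y b A = (if A = {} then p b else 0)" for b and A :: "nat set"
  define g where "g = extend y"
  have y: "y b \<in> kchains V U 0" if "b \<in> B 0" for b using p(1)[OF that] by (auto simp: y_def kchains_def)
  have gc: "g x \<in> kchains V U 0" if "x \<in> C 0" for x unfolding g_def by (rule extend_kchains[OF y that])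
  then have gPV: "g x {} \<in> PV V" if "x \<in> C 0" for x using that by (auto simp: kchains_def)
  have e0: "e (\<lambda>_. 0) = cls 0"
  proof -
    have "e (\<lambda>_. 0) \<in> cls ` PV V" unfolding e_surj[symmetric] by (rule imageI[OF C_closed(1)])
    then obtain q where q: "q \<in> PV V" "e (\<lambda>_. 0) = cls q" by auto
    then show ?thesis using e_smult[OF C_closed(1) q(1) _ q(2), of 0] by simp
  qed
  have eg: "e x = cls (g x {})" if "x \<in> C 0" for x
    using that
  proof (induction x rule: C_induct)
    case zero
    show ?case by (simp add: e0 g_def extend_def lin_ext_def)
  next
    case (unit b)
    then show ?case using p(2) by (simp add: g_def extend_unit y_def)
  next
    case (add x x')
    then show ?case using e_add[OF add(1,2) gPV gPV] by (simp add: g_def extend_add[OF add(1,2)])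
  next
    case (smult r x)
    then show ?case using e_smult[OF smult(2) gPV smult(1)] by (simp add: g_def extend_smult[OF smult(1,2)])
  qed
  have "g (d 0 w) \<in> kdiff U ` kchains V U (Suc 0)" if w: "w \<in> C (Suc 0)" for w
  proof (rule kdiff_lift[OF fin_U])
    have dw: "d 0 w \<in> C 0" by (rule cx.dm_closed[OF w])
    show c: "g (d 0 w) \<in> kchains V U 0" by (rule gc[OF dw])
    show "kbd U (g (d 0 w)) A = 0" if "A \<subseteq> U" for A by (rule kbd_kchains_0[OF c fin_U(1) that])
    have "d 0 w \<in> d 0 ` C (Suc 0)" using w by (rule imageI)
    then have "cls (g (d 0 w) {}) = cls 0" unfolding d0_image using eg[OF dw] by simp
    then show "restr (V - U) (g (d 0 w) {}) = 0" unfolding V_minus_U by (intro restr_I[OF F]) (simp add: cls_eq_iff)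
  qed
  then have "chain_component 0 g"
    unfolding chain_component_def using gc by (auto simp: g_def extend_add extend_smult)
  then show ?thesis using eg by blast
qed

text \<open>The top component of a comparison map to the Koszul complex of \<open>U\<close> is a cocycle that detects
  the augmentation of every Koszul family.\<close>

lemma detecting_cocycle:
  "\<exists>z\<in>cocycles. \<forall>p f. augmented p f \<longrightarrow> restr F (z (f U)) = restr F p"
proof -
  interpret K: acyclic_complex V "kchains V U :: nat \<Rightarrow> (nat set \<Rightarrow> 'k mpoly) set" "\<lambda>i. kdiff U"
    by (rule acyclic_koszul[OF fin_U])
  obtain g0 where g0: "chain_component 0 g0" "\<And>x. x \<in> C 0 \<Longrightarrow> e x = cls (g0 x {})"
    using chain_component_base by blast
  \<comment> \<open>The second condition keeps the given component \<open>g0\<close> as the starting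
    point of the dependent choice.\<close>
  define Q where "Q n g \<longleftrightarrow> chain_component n g \<and> (n = 0 \<longrightarrow> g = g0)" for n g
  have "\<exists>g. \<forall>n. Q n (g n) \<and> (\<forall>x\<in>C (Suc n). kdiff U (g (Suc n) x) = g n (d n x))"
  proof (rule dependent_nat_choice)
    show "\<exists>g. Q 0 g" using g0 by (auto simp: Q_def)
    show "\<exists>g'. Q (Suc n) g' \<and> (\<forall>x\<in>C (Suc n). kdiff U (g' x) = g (d n x))" if "Q n g" for g n
      using chain_component_step[of n g] that by (auto simp: Q_def)
  qed
  then obtain g where gQ: "\<forall>n. Q n (g n) \<and> (\<forall>x\<in>C (Suc n). kdiff U (g (Suc n) x) = g n (d n x))" by blast
  have g: "\<And>n. chain_component n (g n)" "g 0 = g0"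
    "\<And>n x. x \<in> C (Suc n) \<Longrightarrow> kdiff U (g (Suc n) x) = g n (d n x)" using gQ by (simp_all add: Q_def)
  note gs = g(1)[unfolded chain_component_def]
  have gc: "g n x \<in> kchains V U n" if "x \<in> C n" for n x using gs that by blast
  have g_add: "g n (\<lambda>b. x b + y b) = (\<lambda>A. g n x A + g n y A)" if "x \<in> C n" "y \<in> C n" for n x y using gs that by blast
  have g_smult: "g n (\<lambda>b. p * x b) = (\<lambda>A. p * g n x A)" if "p \<in> PV V" "x \<in> C n" for n p x using gs that by blast
  let ?c = "card U"
  \<comment> \<open>The coefficient at the top basis element. Every Koszul boundary has coefficient
    0 there, as the sum over \<open>U - U\<close> is empty, so \<open>z\<close> is a
    cocycle.\<close>
  define z where "z = restrict (\<lambda>x. g ?c x U) (C ?c)"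
  have "z \<in> dual ?c"
    unfolding z_def
  proof (rule module_homI[OF _ _ _ module_free_module[OF cring_poly_ring]])
    fix x assume x: "x \<in> C ?c"
    show "g ?c x U \<in> carrier (regular_module P)" using gc[OF x] by (simp add: kchains_def)
    show "g ?c (x \<oplus>\<^bsub>free_module P (B ?c)\<^esub> y) U = g ?c x U \<oplus>\<^bsub>regular_module P\<^esub> g ?c y U" if "y \<in> C ?c" for y
      using g_add[OF x that] by (simp add: C_add_eq)
    show "g ?c (p \<odot>\<^bsub>free_module P (B ?c)\<^esub> x) U = p \<odot>\<^bsub>regular_module P\<^esub> g ?c x U" if "p \<in> carrier P" for p
      using g_smult[OF that x] by (simp add: C_smult_eq)
  qed
  moreover have "z (d ?c x) = 0" if x: "x \<in> C (Suc ?c)" for x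
  proof -
    have "g ?c (d ?c x) \<in> kdiff U ` kchains V U (Suc ?c)" using gs x by blast
    then obtain k' where k': "k' \<in> kchains V U (Suc ?c)" "g ?c (d ?c x) = kdiff U k'" by blast
    have "kdiff U k' U = 0" by (simp add: kdiff_def kbd_def)
    then show ?thesis using k' cx.dm_closed[OF x] by (simp add: z_def)
  qed
  ultimately have z: "z \<in> cocycles" by (simp add: cocycles_def)
  have "restr F (z (f U)) = restr F p" if f: "augmented p f" for p f
  proof -
    have fk: "\<And>A. A \<subseteq> U \<Longrightarrow> f A \<in> C (card A)" "\<And>A i. A \<subseteq> U \<Longrightarrow> card A = Suc i \<Longrightarrow> d i (f A) = kdel f A"
      and p: "p \<in> PV V" and ef: "e (f {}) = cls p"
      using f by (auto simp: augmented_def cx.koszul_family_def)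
    define E :: "nat set \<Rightarrow> nat set \<Rightarrow> 'k mpoly" where "E A = (\<lambda>B. if B = A then 1 else 0)" for A
    have E: "K.koszul_family U E"
      unfolding K.koszul_family_def
    proof (intro allI impI conjI)
      fix A i assume A: "A \<subseteq> U"
      then show "E A \<in> kchains V U (card A)" by (auto simp: E_def kchains_def)
      show "kdiff U (E A) = kdel E A"
      proof
        fix B
        show "kdiff U (E A) B = kdel E A B"
        proof (cases "B \<subseteq> U")
          case True
          then show ?thesis using kbd_unit[OF fin_U(1) A True] by (simp add: kdiff_def E_def kdel_def)
        next
          case False
          then have "B \<noteq> A - {u}" for u using A by auto
          then show ?thesis using False by (simp add: kdiff_def kdel_def E_def)
        qed
      qed
    qed
    \<comment> \<open>Composing \<open>f\<close> with the comparison map gives an endomorphism of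
      the Koszul complex. On homology in degree zero it agrees with \<open>p\<close> times the
      identity \<open>E\<close>, so the difference is null homotopic.\<close>
    define G where "G A = g (card A) (f A)" for A
    have G: "K.koszul_family U G"
      unfolding K.koszul_family_def
    proof (intro allI impI conjI)
      fix A i assume A: "A \<subseteq> U"
      then show "G A \<in> kchains V U (card A)" using gc fk(1) by (simp add: G_def)
      assume i: "card A = Suc i"
      have fin: "finite A" using A fin_U(1) finite_subset by blast
      have fA: "f (A - {u}) \<in> C i" if "u \<in> A" for u
        using fk(1)[of "A - {u}"] A card_Suc_Diff1[OF fin that] i by auto
      have lin: "g i (\<lambda>b. \<Sum>u\<in>X. kcoeff u A * f (A - {u}) b) = (\<lambda>D. \<Sum>u\<in>X. kcoeff u A * g i (f (A - {u})) D) \<and>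
         (\<lambda>b. \<Sum>u\<in>X. kcoeff u A * f (A - {u}) b) \<in> C i" if "finite X" "X \<subseteq> A" for X
        using that
      proof (induction X rule: finite_induct)
        case empty
        have "g i (\<lambda>b. 0 * 0) = (\<lambda>A. 0 * g i (\<lambda>_. 0) A)" using g_smult[OF PV_closed(1) C_closed(1)] .
        then show ?case by (simp add: C_closed)
      next
        case (insert a X)
        have a: "kcoeff a A \<in> PV V" by (rule kcoeff_in_PV) (use insert.prems A in auto)
        have fa: "f (A - {a}) \<in> C i" using fA insert.prems by auto
        note * = C_closed(3)[OF a fa] g_smult[OF a fa]
        then show ?case
          using insert g_add[OF *(1)] C_closed(2)[OF *(1)] by simp
      qed
      have "kdiff U (G A) = g i (d i (f A))" using g(3)[of "f A" i] fk(1)[OF A] i by (simp add: G_def)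
      also have "\<dots> = g i (kdel f A)" using fk(2)[OF A i] by simp
      also have "\<dots> = (\<lambda>D. \<Sum>u\<in>A. kcoeff u A * g i (f (A - {u})) D)"
        unfolding kdel_def using lin[OF fin order_refl] by blast
      also have "\<dots> = kdel G A"
        unfolding kdel_def using card_Suc_Diff1[OF fin] i by (intro ext sum.cong) (auto simp: G_def)
      finally show "kdiff U (G A) = kdel G A" .
    qed
    let ?D = "\<lambda>A B. G A B - p * E A B"
    have D: "K.koszul_family U ?D" by (intro K.koszul_family_diff K.koszul_family_smult G E p fin_U)
    have "?D {} \<in> kdiff U ` kchains V U (Suc 0)"
    proof (rule kdiff_lift[OF fin_U])
      show c: "?D {} \<in> kchains V U 0" using D by (auto simp: K.koszul_family_def)
      show "kbd U (?D {}) A = 0" if "A \<subseteq> U" for A by (rule kbd_kchains_0[OF c fin_U(1) that])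
      have "cls (g0 (f {}) {}) = cls p" using ef g0(2)[OF augmented_empty[OF f]] by simp
      then have "?D {} {} \<in> I" by (simp add: cls_eq_iff G_def g(2) E_def)
      then show "restr (V - U) (?D {} {}) = 0" unfolding V_minus_U by (rule restr_I[OF F])
    qed
    from K.koszul_family_null[OF fin_U D this] obtain h where
      h: "\<And>A. A \<subseteq> U \<Longrightarrow> h A \<in> kchains V U (Suc (card A))"
        "\<And>A. A \<subseteq> U \<Longrightarrow> kdiff U (h A) = (\<lambda>b. ?D A b - kdel h A b)" by blast
    \<comment> \<open>In the top coefficient the boundary part of the homotopy is absent; what
      remains is a combination of variables outside \<open>F\<close>.\<close>
    have "kdiff U (h U) U = 0" by (simp add: kdiff_def kbd_def)
    then have "?D U U = kdel h U U" using fun_cong[OF h(2)[OF order_refl], of U] by simp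
    then have "restr F (?D U U) = 0" by (simp add: kdel_def restr_sum restr_kcoeff)
    then show ?thesis using augmented_top[OF f] by (simp add: G_def E_def z_def)
  qed
  then show ?thesis using z by blast
qed

end

text \<open>The ideal generated by the variables of \<open>F\<close> in k[F] annihilates the
  variables outside \<open>F\<close>. Functionals with values in this ideal are therefore linear
  over the whole ring.\<close>

lemma (in SR) ker_mult_in_I:
  assumes F: "F \<subseteq> V" "\<And>u w. u \<in> V - F \<Longrightarrow> w \<in> F \<Longrightarrow> {u, w} \<notin> \<Delta>" and p: "p \<in> PV V" "restr F p = 0"
    and q: "q \<in> PV F" "lookup q 0 = 0"
  shows "p * q \<in> I"
proof -
  have "restr {} q = 0" using q(2) by (intro poly_mapping_eqI) (simp add: lookup_restr)
  with q(1) show ?thesis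
  proof (induction rule: ker_restr_induct)
    case (add a b)
    then show ?case using I_closed(3) by (simp add: distrib_left)
  next
    case (mult w r)
    have "indet w * p \<in> I" by (rule ker_mult_indet_in_I[of w F]) (use F p mult in auto)
    then have "indet w * p * r \<in> I" using I_closed(7) PV_mono[OF F(1) mult(2)] by blast
    then show ?case by (simp add: algebra_simps)
  qed (simp add: I_closed)
qed

section \<open>Functionals on the Ext module\<close>

context SR_resolution
begin

abbreviation "c \<equiv> card U"
abbreviation "N \<equiv> regular_module P"
abbreviation "H \<equiv> hom_module P (free_module P (B c)) N"

definition coboundaries :: "(('b \<Rightarrow> 'k mpoly) \<Rightarrow> 'k mpoly) set" where
  "coboundaries = (case c of 0 \<Rightarrow> {\<zero>\<^bsub>H\<^esub>}
     | Suc b \<Rightarrow> (\<lambda>g. compose (C c) g (d b)) ` dual b)"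

abbreviation "Ext \<equiv> induced_quotient_action (ext_module P B d N c)"

lemma Ext_eq: "Ext = induced_quotient_action (quotient_module (H\<lparr>carrier := cocycles\<rparr>) coboundaries)"
proof -
  have "{f \<in> carrier H. \<forall>x\<in>C (Suc c). f (d c x) = \<zero>\<^bsub>N\<^esub>} = cocycles"
    by (auto simp: cocycles_def hom_module_def)
  then show ?thesis by (simp add: ext_module_def Let_def coboundaries_def)
qed

lemma H_add_value: "x \<in> C c \<Longrightarrow> (f \<oplus>\<^bsub>H\<^esub> g) x = f x + g x"
  and H_smult_value: "x \<in> C c \<Longrightarrow> (p \<odot>\<^bsub>H\<^esub> f) x = p * f x"
  by (simp_all add: hom_module_def)

lemma coboundaries_ne: "coboundaries \<noteq> {}"
proof (cases c)
  case (Suc b)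
  have "(\<lambda>x\<in>C b. 0) \<in> dual b"
    by (rule module_homI) (simp_all add: module_free_module cring_poly_ring)
  then show ?thesis by (auto simp: coboundaries_def Suc)
qed (simp add: coboundaries_def)

text \<open>On \<open>f U\<close> the functional \<open>g\<close> composed with the differential
  takes the value of \<open>g\<close> on \<open>kdel f U\<close>, which lies in the ideal of the
  variables outside \<open>F\<close>.\<close>

lemma coboundary_value:
  assumes h: "h \<in> coboundaries" and f: "augmented p f"
  shows "restr F (h (f U)) = 0"
proof (cases c)
  case 0
  then have "h = \<zero>\<^bsub>H\<^esub>" using h by (simp add: coboundaries_def)
  then have "h (f U) = 0" using augmented_top[OF f] by (simp add: hom_module_def)
  then show ?thesis by simp
next
  case (Suc b)
  then obtain g where g: "g \<in> dual b" "h = compose (C c) g (d b)"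
    using h by (auto simp: coboundaries_def)
  have "d b (f U) = kdel f U" using f Suc by (auto simp: augmented_def cx.koszul_family_def)
  then have "h (f U) = g (kdel f U)" using augmented_top[OF f] by (simp add: g(2) compose_def)
  moreover have "f (U - {u}) \<in> C b" if "u \<in> U" for u
  proof -
    have "Suc (card (U - {u})) = c" by (rule card_Suc_Diff1[OF fin_U(1) that])
    then have "card (U - {u}) = b" using Suc by simp
    moreover have "f (U - {u}) \<in> C (card (U - {u}))"
      using f by (auto simp: augmented_def cx.koszul_family_def)
    ultimately show ?thesis by simp
  qed
  ultimately show ?thesis using functional_kdel[OF g(1), of f] by simp
qed

lemma carrier_Ext: "carrier Ext = (\<lambda>z. (\<lambda>h. h \<oplus>\<^bsub>H\<^esub> z) ` coboundaries) ` cocycles"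
  unfolding Ext_eq by (auto simp: induced_quotient_action_def quotient_module_def A_RCOSETS_def RCOSETS_def r_coset_def)

lemma Ext_add: "X \<oplus>\<^bsub>Ext\<^esub> Y = {x \<oplus>\<^bsub>H\<^esub> y | x y. x \<in> X \<and> y \<in> Y}"
  unfolding Ext_eq by (auto simp: induced_quotient_action_def quotient_module_def set_add_def set_mult_def)

lemma Ext_smult: "R \<odot>\<^bsub>Ext\<^esub> X = {h \<oplus>\<^bsub>H\<^esub> (p \<odot>\<^bsub>H\<^esub> x) | h p x. h \<in> coboundaries \<and> p \<in> R \<and> x \<in> X}"
  unfolding Ext_eq by (auto simp: induced_quotient_action_def quotient_module_def a_r_coset_def r_coset_def)

text \<open>The value \<open>restr F (z (f U)) * m\<close> vanishes on coboundaries, so it descends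
  to Ext and is transported to \<open>W\<close>. The multiplier \<open>m\<close> leaves room for
  removing constant terms, whose absence makes the functional linear over the Stanley-Reisner
  ring.\<close>

lemma indet_in_trace_of_functional:
  fixes W :: "('k mpoly set, 'w, 'm) module_scheme"
  assumes W: "Module.module S W" and iso: "module_iso S W Ext"
    and f: "augmented p f" and m: "m \<in> PV F"
    and const: "\<And>z. z \<in> cocycles \<Longrightarrow> lookup (restr F (z (f U)) * m) 0 = 0"
    and z: "z \<in> cocycles"
  shows "cls (restr F (z (f U)) * m) \<in> trace_ideal S W"
proof -
  define th where "th z = restr F (z (f U)) * m" for z :: "('b \<Rightarrow> 'k mpoly) \<Rightarrow> 'k mpoly"
  have fU: "f U \<in> C c" by (rule augmented_top[OF f])
  have thF: "th z \<in> PV F" for z unfolding th_def using m restr_in_PV_self by blast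
  then have thV: "th z \<in> PV V" for z using PV_mono[OF F_sub] by blast
  have th_add: "th (x \<oplus>\<^bsub>H\<^esub> y) = th x + th y" for x y
    by (simp add: th_def H_add_value[OF fU] distrib_right)
  have th_smult: "th (r \<odot>\<^bsub>H\<^esub> x) = restr F r * th x" for r x
    by (simp add: th_def H_smult_value[OF fU])
  have th_cob: "th h = 0" if "h \<in> coboundaries" for h
    using coboundary_value[OF that f] by (simp add: th_def)
  define tau where "tau X = cls (th (SOME z. z \<in> X))" for X
  have same: "th x = th y" if "X \<in> carrier Ext" "x \<in> X" "y \<in> X" for X x y
    using that by (auto simp: carrier_Ext th_add th_cob)
  have tau: "tau X = cls (th x)" if "X \<in> carrier Ext" "x \<in> X" for X x
  proof -
    have "(SOME z. z \<in> X) \<in> X" using that(2) by (rule someI[where P = "\<lambda>z. z \<in> X"])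
    then show ?thesis unfolding tau_def using same[OF that(1) _ that(2)] by simp
  qed
  have ne: "\<exists>x. x \<in> X" if "X \<in> carrier Ext" for X using that coboundaries_ne by (auto simp: carrier_Ext)
  have th0: "lookup (th x) 0 = 0" if X: "X \<in> carrier Ext" "x \<in> X" for X x
  proof -
    obtain h z where "h \<in> coboundaries" "z \<in> cocycles" "x = h \<oplus>\<^bsub>H\<^esub> z" using X by (auto simp: carrier_Ext)
    then show ?thesis using const[of z] th_cob by (simp add: th_add) (simp add: th_def)
  qed
  obtain \<phi> where \<phi>: "\<phi> \<in> Defs.module_hom S W Ext" "bij_betw \<phi> (carrier W) (carrier Ext)"
    using iso by (auto simp: module_iso_def)
  interpret W: Module.module S W by (rule W)
  define \<psi> where "\<psi> = restrict (\<lambda>w. tau (\<phi> w)) (carrier W)"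
  have \<phi>c: "\<phi> w \<in> carrier Ext" if "w \<in> carrier W" for w using module_homD(1)[OF \<phi>(1) that] .
  have "\<psi> \<in> Defs.module_hom S W (regular_module S)"
    unfolding \<psi>_def
  proof (rule module_homI[OF _ _ _ W])
    fix w assume w: "w \<in> carrier W"
    obtain x where x: "x \<in> \<phi> w" using ne[OF \<phi>c[OF w]] by blast
    show "tau (\<phi> w) \<in> carrier (regular_module S)" using tau[OF \<phi>c[OF w] x] thV by simp
    show "tau (\<phi> (w \<oplus>\<^bsub>W\<^esub> w')) = tau (\<phi> w) \<oplus>\<^bsub>regular_module S\<^esub> tau (\<phi> w')" if w': "w' \<in> carrier W" for w'
    proof -
      obtain x' where x': "x' \<in> \<phi> w'" using ne[OF \<phi>c[OF w']] by blast
      have "x \<oplus>\<^bsub>H\<^esub> x' \<in> \<phi> (w \<oplus>\<^bsub>W\<^esub> w')"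
        unfolding module_homD(2)[OF \<phi>(1) w w'] Ext_add using x x' by blast
      then have "tau (\<phi> (w \<oplus>\<^bsub>W\<^esub> w')) = cls (th (x \<oplus>\<^bsub>H\<^esub> x'))"
        by (intro tau \<phi>c W.M.a_closed w w')
      then show ?thesis
        using tau[OF \<phi>c[OF w] x] tau[OF \<phi>c[OF w'] x'] thV by (simp add: th_add S_add)
    qed
    show "tau (\<phi> (r \<odot>\<^bsub>W\<^esub> w)) = r \<odot>\<^bsub>regular_module S\<^esub> tau (\<phi> w)" if r: "r \<in> carrier S" for r
    proof -
      obtain p where p: "p \<in> PV V" "r = cls p" using r by (rule in_S_E)
      have "p \<in> r" using p I_closed(2) by (simp add: mem_cls_iff)
      moreover obtain h where h: "h \<in> coboundaries" using coboundaries_ne by blast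
      ultimately have "h \<oplus>\<^bsub>H\<^esub> (p \<odot>\<^bsub>H\<^esub> x) \<in> \<phi> (r \<odot>\<^bsub>W\<^esub> w)"
        unfolding module_homD(3)[OF \<phi>(1) r w] Ext_smult using x by blast
      then have "tau (\<phi> (r \<odot>\<^bsub>W\<^esub> w)) = cls (th (h \<oplus>\<^bsub>H\<^esub> (p \<odot>\<^bsub>H\<^esub> x)))"
        by (intro tau \<phi>c W.smult_closed r w)
      also have "\<dots> = cls (restr F p * th x)" by (simp add: th_add th_smult th_cob[OF h])
      \<comment> \<open>The scalar acts through \<open>restr F p\<close>. The difference to
        \<open>p\<close> involves only variables outside \<open>F\<close>, and \<open>th x\<close>,
        having no constant term, annihilates these.\<close>
      also have "\<dots> = cls (p * th x)"
      proof -
        have "(restr F p - p) * th x \<in> I"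
          by (rule ker_mult_in_I[OF F_sub isolated]) (use p thF th0[OF \<phi>c[OF w] x] in auto)
        then show ?thesis by (simp add: cls_eq_iff algebra_simps)
      qed
      finally show ?thesis using tau[OF \<phi>c[OF w] x] p thV by (simp add: S_mult)
    qed
  qed
  note \<psi> = this
  obtain h where h: "h \<in> coboundaries" using coboundaries_ne by blast
  have X: "(\<lambda>h. h \<oplus>\<^bsub>H\<^esub> z) ` coboundaries \<in> carrier Ext" using z by (auto simp: carrier_Ext)
  then have "(\<lambda>h. h \<oplus>\<^bsub>H\<^esub> z) ` coboundaries \<in> \<phi> ` carrier W"
    using bij_betw_imp_surj_on[OF \<phi>(2)] by simp
  then obtain w where w: "w \<in> carrier W" "\<phi> w = (\<lambda>h. h \<oplus>\<^bsub>H\<^esub> z) ` coboundaries"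
    by (elim imageE) simp
  have "\<psi> w = cls (th (h \<oplus>\<^bsub>H\<^esub> z))" using tau[OF X, of "h \<oplus>\<^bsub>H\<^esub> z"] h w by (simp add: \<psi>_def)
  then have "\<psi> w = cls (th z)" by (simp add: th_add th_cob[OF h])
  then show ?thesis using trace_ideal_hom[OF W \<psi> w(1)] by (simp add: th_def)
qed

lemma cocycles_combination:
  assumes x: "x \<in> cocycles" and y: "y \<in> cocycles" and a: "a \<in> PV V" and b: "b \<in> PV V"
  shows "\<exists>z\<in>cocycles. \<forall>w\<in>C c. z w = a * x w + b * y w"
proof -
  have h: "x \<in> dual c" "y \<in> dual c"
    and z: "\<And>w. w \<in> C (Suc c) \<Longrightarrow> x (d c w) = 0" "\<And>w. w \<in> C (Suc c) \<Longrightarrow> y (d c w) = 0"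
    using x y by (auto simp: cocycles_def)
  define z where "z = restrict (\<lambda>w. a * x w + b * y w) (C c)"
  have "z \<in> dual c"
    unfolding z_def
  proof (rule module_homI[OF _ _ _ module_free_module[OF cring_poly_ring]])
    fix w assume w: "w \<in> C c"
    show "a * x w + b * y w \<in> carrier N" using functional_simps(1)[OF h(1) w] functional_simps(1)[OF h(2) w] a b by simp
    show "a * x (w \<oplus>\<^bsub>free_module P (B c)\<^esub> w') + b * y (w \<oplus>\<^bsub>free_module P (B c)\<^esub> w') =
      (a * x w + b * y w) \<oplus>\<^bsub>N\<^esub> (a * x w' + b * y w')" if "w' \<in> C c" for w'
      using functional_simps(2)[OF h(1) w that] functional_simps(2)[OF h(2) w that] by (simp add: C_add_eq algebra_simps)
    show "a * x (r \<odot>\<^bsub>free_module P (B c)\<^esub> w) + b * y (r \<odot>\<^bsub>free_module P (B c)\<^esub> w) = r \<odot>\<^bsub>N\<^esub> (a * x w + b * y w)"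
      if "r \<in> carrier P" for r
      using functional_simps(3)[OF h(1) that w] functional_simps(3)[OF h(2) that w] by (simp add: C_smult_eq algebra_simps)
  qed
  then have "z \<in> cocycles" using z cx.dm_closed by (simp add: cocycles_def z_def)
  then show ?thesis by (intro bexI[of _ z]) (simp_all add: z_def)
qed

text \<open>The functional \<open>\<theta> z = restr F (z (f U))\<close> on cocycles represents the map from the canonical module
  to that of the component \<open>F\<close> induced by multiplication with \<open>indet v\<close>. If all its values lie in the
  ideal of the variables of \<open>F\<close>, it is linear over the Stanley-Reisner ring. Otherwise comparison with
  another vertex of \<open>F\<close> shows that \<open>v\<close> is the only vertex of \<open>F\<close>, and \<open>\<theta>\<close> takes the value 1.\<close>

lemma indet_in_trace_canonical:
  fixes W :: "('k mpoly set, 'w, 'm) module_scheme"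
  assumes W: "Module.module S W" and iso: "module_iso S W Ext" and v: "v \<in> F"
  shows "cls (indet v) \<in> trace_ideal S W"
proof -
  obtain f where f: "augmented (indet v) f" using augmented_exists[OF v] by blast
  obtain z1 where z1: "z1 \<in> cocycles" "\<And>p f. augmented p f \<Longrightarrow> restr F (z1 (f U)) = restr F p"
    using detecting_cocycle by blast
  have vF: "(indet v :: 'k mpoly) \<in> PV F" "restr F (indet v) = (indet v :: 'k mpoly)" using v by (simp_all add: restr_indet)
  note trace = indet_in_trace_of_functional[OF W iso f]
  show ?thesis
  proof (cases "\<forall>z\<in>cocycles. lookup (restr F (z (f U))) 0 = 0")
    case True
    have "cls (restr F (z1 (f U)) * 1) \<in> trace_ideal S W"
      by (rule trace) (use True z1 in auto)
    then show ?thesis by (simp add: z1(2)[OF f] vF(2))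
  next
    case False
    then obtain z0 where z0: "z0 \<in> cocycles" "lookup (restr F (z0 (f U))) 0 \<noteq> 0" by blast
    define q where "q = restr F (z0 (f U))"
    have single: "w = v" if w: "w \<in> F" for w
    proof (rule ccontr)
      assume ne: "w \<noteq> v"
      obtain g where g: "augmented (indet w) g" using augmented_exists[OF w] by blast
      have "indet w * q = indet v * restr F (z0 (g U))"
        unfolding q_def by (rule cocycle_compat[OF z0(1) f g]) (use v w in \<open>simp_all add: restr_indet\<close>)
      \<comment> \<open>The coefficient of x_w is the constant term of \<open>q\<close> on the left
        and 0 on the right.\<close>
      from arg_cong[OF this, of "\<lambda>p. lookup p (single w 1)"]
      show False using z0(2) ne unfolding lookup_indet_mult q_def by simp
    qed
    then have Fv: "F = {v}" using v by blast
    define a where "a = lookup q 0"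
    have a: "a \<noteq> 0" using z0(2) by (simp add: a_def q_def)
    have qF: "q - single 0 a \<in> PV F" by (simp add: q_def restr_in_PV_self)
    have "restr (F - {v}) (q - single 0 a) = 0"
      unfolding Fv by (intro poly_mapping_eqI) (simp add: lookup_restr lookup_minus a_def)
    from ker_restr_single_variable[OF qF this] obtain r where
      r: "r \<in> PV F" "q - single 0 a = indet v * r" by blast
    have rV: "r \<in> PV V" by (rule PV_mono[OF F_sub r(1)])
    \<comment> \<open>Here \<open>z0\<close> takes the value a + x_v r and \<open>z1\<close> the
      value x_v, so (z0 - r z1) / a takes the value 1.\<close>
    obtain z where z: "z \<in> cocycles"
      "\<And>w. w \<in> C c \<Longrightarrow> z w = single 0 (inverse a) * z0 w + - (single 0 (inverse a) * r) * z1 w"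
      using cocycles_combination[OF z0(1) z1(1), of "single 0 (inverse a)" "- (single 0 (inverse a) * r)"] rV
      by auto
    have "restr F (z (f U)) = single 0 (inverse a) * (q - r * indet v)"
      using r(1) z1(2)[OF f] vF
      by (simp add: z(2)[OF augmented_top[OF f]] q_def restr_single in_PV_iff_restr algebra_simps)
    also have "q - r * indet v = single 0 a" using r(2) by (simp add: algebra_simps)
    finally have one: "restr F (z (f U)) = 1" using a by (simp add: mult_single)
    \<comment> \<open>With multiplier x_v no value of the functional has a constant term, and the
      cocycle with value 1 now yields x_v.\<close>
    have "cls (restr F (z (f U)) * indet v) \<in> trace_ideal S W"
    proof (rule trace[OF vF(1) _ z(1)])
      fix y
      have "restr {} (restr F (y (f U)) * indet v) = 0" by (simp add: restr_indet)
      then show "lookup (restr F (y (f U)) * indet v) 0 = 0"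
        by (metis lookup_restr keys_zero lookup_zero subset_refl)
    qed
    then show ?thesis by (simp add: one)
  qed
qed

end

section \<open>Components\<close>

context SR
begin

abbreviation "rank \<equiv> Max (card ` \<Delta>)"

lemma facet_above: "F \<in> \<Delta> \<Longrightarrow> \<exists>G\<in>facets \<Delta>. F \<subseteq> G"
proof -
  assume F: "F \<in> \<Delta>"
  have "finite {G \<in> \<Delta>. F \<subseteq> G}" using fin_\<Delta> by simp
  moreover have "{G \<in> \<Delta>. F \<subseteq> G} \<noteq> {}" using F by auto
  ultimately obtain G where "G \<in> {G \<in> \<Delta>. F \<subseteq> G}" "\<forall>H\<in>{G \<in> \<Delta>. F \<subseteq> G}. G \<subseteq> H \<longrightarrow> G = H"
    using finite_has_maximal[of "{G \<in> \<Delta>. F \<subseteq> G}"] by blast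
  then show ?thesis by (intro bexI[of _ G]) (auto simp: facets_def)
qed

lemma face_dim_bound:
  assumes D: "finite D" "D \<noteq> {}"
  shows "complex_dim D = int (Max (card ` D)) - 1"
proof -
  have "complex_dim D = Max ((\<lambda>n. int n - 1) ` card ` D)"
    by (simp add: complex_dim_def face_dim_def image_image)
  also have "\<dots> = int (Max (card ` D)) - 1"
    by (rule mono_Max_commute[symmetric]) (use D in \<open>auto simp: mono_def\<close>)
  finally show ?thesis .
qed

definition edges :: "(nat \<times> nat) set" where
  "edges = {(u, w). {u, w} \<in> \<Delta>}\<^sup>*"

lemma components_eq: "components \<Delta> = (\<lambda>v. {F \<in> \<Delta>. F \<subseteq> edges `` {v}}) ` V"
  by (simp add: components_def edges_def Union_\<Delta>)

lemma edges_refl: "v \<in> edges `` {v}"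
  by (simp add: edges_def)

lemma edges_step: "u \<in> edges `` {v} \<Longrightarrow> {u, w} \<in> \<Delta> \<Longrightarrow> w \<in> edges `` {v}"
  unfolding edges_def by (auto intro: rtrancl_into_rtrancl)

lemma edges_sub_V: "v \<in> V \<Longrightarrow> edges `` {v} \<subseteq> V"
proof
  fix w assume v: "v \<in> V" and "w \<in> edges `` {v}"
  then have "(v, w) \<in> {(u, w). {u, w} \<in> \<Delta>}\<^sup>*" by (simp add: edges_def)
  then show "w \<in> V" by (induction rule: rtrancl_induct) (use v sub_V in auto)
qed

text \<open>An edge path cannot leave a facet: each edge lies in some facet, and a facet that meets
  \<open>F\<close> equals \<open>F\<close>. The component of \<open>v\<close> thus consists of all
  subsets of the facet containing \<open>v\<close>.\<close>

lemma components_of_disjoint_facets: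
  assumes card: "\<And>F. F \<in> facets \<Delta> \<Longrightarrow> F \<noteq> {} \<Longrightarrow> card F = rank"
    and disj: "\<And>F G. F \<in> facets \<Delta> \<Longrightarrow> G \<in> facets \<Delta> \<Longrightarrow> F \<noteq> G \<Longrightarrow> F \<inter> G = {}"
    and C: "C \<in> components \<Delta>"
  shows "is_simplex C \<and> complex_dim C = complex_dim \<Delta>"
proof -
  obtain v where v: "v \<in> V" and C: "C = {F \<in> \<Delta>. F \<subseteq> edges `` {v}}" using C by (auto simp: components_eq)
  obtain F where F: "F \<in> facets \<Delta>" "v \<in> F" using facet_above[OF vertex[OF v]] by auto
  have F\<Delta>: "F \<in> \<Delta>" using F by (simp add: facets_def)
  have "w \<in> F" if "w \<in> edges `` {v}" for w
  proof -
    have "(v, w) \<in> {(u, w). {u, w} \<in> \<Delta>}\<^sup>*" using that by (simp add: edges_def)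
    then show ?thesis
    proof (induction rule: rtrancl_induct)
      case (step u w)
      then obtain G where "G \<in> facets \<Delta>" "{u, w} \<subseteq> G" using facet_above[of "{u, w}"] by auto
      then show ?case using disj[OF F(1), of G] step by blast
    qed (fact F)
  qed
  moreover have "w \<in> edges `` {v}" if "w \<in> F" for w
    by (rule edges_step[OF edges_refl]) (rule face_sub[OF F\<Delta>], use F(2) that in auto)
  ultimately have "edges `` {v} = F" by blast
  then have CF: "C = Pow F" using face_sub[OF F\<Delta>] by (auto simp: C)
  have "facets C = {F}" by (auto simp: CF facets_def)
  moreover have "Max (card ` C) = card F"
    unfolding CF using fin_face[OF F\<Delta>] by (intro Max_eqI) (auto intro: card_mono)
  moreover have "complex_dim C = int (Max (card ` C)) - 1"
    by (rule face_dim_bound) (use fin_face[OF F\<Delta>] in \<open>auto simp: CF\<close>)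
  moreover have "complex_dim \<Delta> = int rank - 1" by (rule face_dim_bound[OF fin_\<Delta>]) (use empty_face in auto)
  moreover have "card F = rank" by (rule card[OF F(1)]) (use F(2) in auto)
  ultimately show ?thesis by (auto simp: is_simplex_def)
qed

text \<open>All faces of the component lie below its only facet \<open>F\<close>. Since the vertices
  reachable from \<open>v\<close> are faces themselves, \<open>F\<close> is the whole class of
  \<open>v\<close>, and no edge leaves a class.\<close>

lemma disjoint_facets_of_components:
  assumes simplex: "\<And>C. C \<in> components \<Delta> \<Longrightarrow> is_simplex C \<and> complex_dim C = complex_dim \<Delta>"
    and v: "v \<in> V"
  obtains F where "F \<in> \<Delta>" "v \<in> F" "card F = rank" "\<And>u w. u \<in> V - F \<Longrightarrow> w \<in> F \<Longrightarrow> {u, w} \<notin> \<Delta>"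
proof -
  define C where "C = {F \<in> \<Delta>. F \<subseteq> edges `` {v}}"
  have "C \<in> components \<Delta>" using v by (auto simp: components_eq C_def)
  then have "is_simplex C" and dim: "complex_dim C = complex_dim \<Delta>" using simplex by auto
  then obtain F where F: "facets C = {F}" by (auto simp: is_simplex_def)
  have F\<Delta>: "F \<in> \<Delta>" "F \<subseteq> edges `` {v}" using F by (auto simp: facets_def C_def)
  have finC: "finite C" using fin_\<Delta> by (simp add: C_def)
  have top: "G \<subseteq> F" if G: "G \<in> C" for G
  proof -
    have "finite {H \<in> C. G \<subseteq> H}" "{H \<in> C. G \<subseteq> H} \<noteq> {}" using finC G by auto
    then obtain H where "H \<in> {H \<in> C. G \<subseteq> H}" "\<forall>K\<in>{H \<in> C. G \<subseteq> H}. H \<subseteq> K \<longrightarrow> H = K"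
      using finite_has_maximal[of "{H \<in> C. G \<subseteq> H}"] by blast
    then have "H \<in> facets C" "G \<subseteq> H" by (auto simp: facets_def)
    then show ?thesis using F by simp
  qed
  have eq: "F = edges `` {v}"
  proof
    show "edges `` {v} \<subseteq> F"
    proof
      fix w assume w: "w \<in> edges `` {v}"
      then have "{w} \<in> C" using edges_sub_V[OF v] vertex by (auto simp: C_def)
      then show "w \<in> F" using top by blast
    qed
  qed (fact F\<Delta>(2))
  have "Max (card ` C) = card F"
    using top finC F fin_face[OF F\<Delta>(1)] by (intro Max_eqI) (auto intro: card_mono simp: facets_def)
  then have "complex_dim C = int (card F) - 1"
    using face_dim_bound[OF finC] F by (auto simp: facets_def)
  moreover have "complex_dim \<Delta> = int rank - 1" by (rule face_dim_bound[OF fin_\<Delta>]) (use empty_face in auto)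
  ultimately have "card F = rank" using dim by simp
  moreover have "{u, w} \<notin> \<Delta>" if "u \<in> V - F" "w \<in> F" for u w
  proof
    assume "{u, w} \<in> \<Delta>"
    then have "u \<in> edges `` {v}" using edges_step[of w v u] that(2) eq by (simp add: insert_commute)
    then show False using that(1) eq by simp
  qed
  moreover have "v \<in> F" using eq edges_refl by simp
  ultimately show thesis using that F\<Delta>(1) by blast
qed

text \<open>The class of x_v does not vanish on a face \<open>D\<close> containing \<open>v\<close>,
  so some set of \<open>rank\<close> vertices must lie in all facets above \<open>D\<close>. A facet
  with fewer vertices, taken as \<open>D\<close>, excludes this. For
  \<open>D = F \<inter> G\<close>, a set of this size inside \<open>F\<close> equals
  \<open>F\<close> and is then not contained in \<open>G\<close>.\<close>

lemma facets_of_trace: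
  assumes tr: "irr \<subseteq> trace_ideal S (exterior_power S K.\<Omega> rank)"
  shows "F \<in> facets \<Delta> \<Longrightarrow> F \<noteq> {} \<Longrightarrow> card F = rank"
    and "F \<in> facets \<Delta> \<Longrightarrow> G \<in> facets \<Delta> \<Longrightarrow> F \<noteq> G \<Longrightarrow> F \<inter> G = {}"
proof -
  have nonzero: False
    if D: "D \<in> \<Delta>" "v \<in> D" and facet: "\<And>J. J \<subseteq> V \<Longrightarrow> card J = rank \<Longrightarrow> \<exists>F\<in>facets \<Delta>. D \<subseteq> F \<and> \<not> J \<subseteq> F" for D v
  proof -
    have "v \<in> V" using D sub_V by blast
    then have "cls (indet v) \<in> trace_ideal S (exterior_power S K.\<Omega> rank)" using tr indet_irrelevant by blast
    then have "rho D (cls (indet v)) = 0"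
      using trace_exterior_vanishes[where d = rank and t = "cls (indet v)", OF D(1)] facet by blast
    then show False using D by (simp add: rho_cls restr_indet)
  qed
  have le: "card F \<le> rank" if "F \<in> facets \<Delta>" for F
    using that fin_\<Delta> by (auto simp: facets_def)
  show "card F = rank" if F: "F \<in> facets \<Delta>" "F \<noteq> {}"
  proof (rule ccontr)
    assume "card F \<noteq> rank"
    then have less: "card F < rank" using le[OF F(1)] by simp
    have F\<Delta>: "F \<in> \<Delta>" using F(1) by (simp add: facets_def)
    obtain v where "v \<in> F" using F(2) by blast
    moreover have "\<exists>F'\<in>facets \<Delta>. F \<subseteq> F' \<and> \<not> J \<subseteq> F'" if "card J = rank" for J
      using card_mono[OF fin_face[OF F\<Delta>], of J] less that F(1) by (intro bexI[of _ F]) auto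
    ultimately show False using nonzero[OF F\<Delta>] by blast
  qed
  show "F \<inter> G = {}" if F: "F \<in> facets \<Delta>" and G: "G \<in> facets \<Delta>" and ne: "F \<noteq> G"
  proof (rule ccontr)
    assume "F \<inter> G \<noteq> {}"
    then obtain v where v: "v \<in> F \<inter> G" by blast
    have \<Delta>: "F \<in> \<Delta>" "G \<in> \<Delta>" using F G by (simp_all add: facets_def)
    then have D: "F \<inter> G \<in> \<Delta>" using face_sub by blast
    have "\<exists>F'\<in>facets \<Delta>. F \<inter> G \<subseteq> F' \<and> \<not> J \<subseteq> F'" if J: "card J = rank" for J
    proof (cases "J \<subseteq> F")
      case True
      then have JF: "J = F" using card_subset_eq[OF fin_face[OF \<Delta>(1)] True] le[OF F] J
          card_mono[OF fin_face[OF \<Delta>(1)] True] by simp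
      have "\<not> F \<subseteq> G" using F G ne by (auto simp: facets_def)
      then show ?thesis using G JF by (intro bexI[of _ G]) auto
    next
      case False
      then show ?thesis using F by (intro bexI[of _ F]) auto
    qed
    then show False using nonzero[OF D v] by blast
  qed
qed

end

theorem corollary5p18:
  fixes N :: nat and \<Delta> :: "nat set set"
  assumes "simplicial_complex {1..N} \<Delta>"
    and "\<forall>C\<in>components \<Delta>. pure C"
  shows "(nearly_regular (SR_ring TYPE('k::field_char_0) {1..N} \<Delta>) (SR_grading TYPE('k) {1..N} \<Delta>)
            \<longleftrightarrow> (\<forall>C\<in>components \<Delta>. is_simplex C \<and> complex_dim C = complex_dim \<Delta>))
       \<and> (nearly_regular (SR_ring TYPE('k) {1..N} \<Delta>) (SR_grading TYPE('k) {1..N} \<Delta>)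
            \<longrightarrow> (\<forall>W :: ('k mpoly set, 'w) module.
                  canonical_module (poly_ring TYPE('k) {1..N}) (SR_ideal TYPE('k) {1..N} \<Delta>) W
                  \<longrightarrow> irrelevant_ideal (SR_ring TYPE('k) {1..N} \<Delta>) (SR_grading TYPE('k) {1..N} \<Delta>)
                        \<subseteq> trace_ideal (SR_ring TYPE('k) {1..N} \<Delta>) W))"
proof -
  define V where "V = {1..N}"
  interpret SR_char_0 "TYPE('k)" V \<Delta>
    by (intro SR_char_0.intro SR.intro) (use assms(1) in \<open>simp add: V_def\<close>)
  have nr: "nearly_regular S grading \<longleftrightarrow> irr \<subseteq> trace_ideal S (exterior_power S K.\<Omega> rank)"
    by (simp add: nearly_regular_def krull_dim_S)
  have equiv: "nearly_regular S grading \<longleftrightarrow> (\<forall>C\<in>components \<Delta>. is_simplex C \<and> complex_dim C = complex_dim \<Delta>)"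
  proof
    assume "nearly_regular S grading"
    then show "\<forall>C\<in>components \<Delta>. is_simplex C \<and> complex_dim C = complex_dim \<Delta>"
      unfolding nr using components_of_disjoint_facets facets_of_trace by blast
  next
    assume simplex: "\<forall>C\<in>components \<Delta>. is_simplex C \<and> complex_dim C = complex_dim \<Delta>"
    show "nearly_regular S grading"
      unfolding nr
    proof (rule irrelevant_subset)
      show "Module.module S (exterior_power S K.\<Omega> rank)"
        by (rule exterior_module.module_\<Lambda>) (intro exterior_module.intro K.module_\<Omega>)
      fix v assume v: "v \<in> V"
      obtain F where F: "F \<in> \<Delta>" "v \<in> F" "card F = rank" "\<And>u w. u \<in> V - F \<Longrightarrow> w \<in> F \<Longrightarrow> {u, w} \<notin> \<Delta>"
        using disjoint_facets_of_components[OF _ v] simplex by blast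
      show "cls (indet v) \<in> trace_ideal S (exterior_power S K.\<Omega> rank)"
        using indet_in_trace_exterior[OF F(1,2,4)] by (simp add: F(3))
    qed
  qed
  moreover have "irr \<subseteq> trace_ideal S W"
    if nr: "nearly_regular S grading" and W: "canonical_module (poly_ring TYPE('k) V) I W" for W :: "('k mpoly set, 'w) module"
  proof (rule irrelevant_subset)
    show M: "Module.module S W" using W by (simp add: canonical_module_def)
    fix v assume v: "v \<in> V"
    obtain F where face: "F \<in> \<Delta>" "v \<in> F" "card F = rank" "\<And>u w. u \<in> V - F \<Longrightarrow> w \<in> F \<Longrightarrow> {u, w} \<notin> \<Delta>"
      using disjoint_facets_of_components[OF _ v] nr equiv by blast
    obtain B :: "nat \<Rightarrow> nat set" and d e where
      res: "free_resolution (poly_ring TYPE('k) V) (quotient_module (regular_module (poly_ring TYPE('k) V)) I) B d e"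
      and iso: "module_iso S W (induced_quotient_action (ext_module (poly_ring TYPE('k) V) B d (regular_module (poly_ring TYPE('k) V))
         (the_enat (krull_dim (poly_ring TYPE('k) V)) - the_enat (krull_dim S))))"
      using W by (auto simp: canonical_module_def)
    interpret SR_resolution "TYPE('k)" V \<Delta> B d e F
      by (intro SR_resolution.intro SR_resolution_axioms.intro SR_char_0_axioms res face)
    \<comment> \<open>Every component has \<open>rank\<close> vertices, so the codimension is the
      number of variables outside \<open>F\<close>, whichever vertex \<open>v\<close> is
      considered.\<close>
    have "the_enat (krull_dim (poly_ring TYPE('k) V)) - the_enat (krull_dim S) = card (V - F)"
      using card_Diff_subset[OF fin_face[OF face(1)] sub_V[OF face(1)]] by (simp add: krull_dim_poly_ring[OF fin_V] krull_dim_S face(3))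
    then show "cls (indet v) \<in> trace_ideal S W" using indet_in_trace_canonical[OF M _ face(2)] iso by simp
  qed
  ultimately show ?thesis unfolding V_def[symmetric] SR_ring_eq by blast
qed

end
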